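(* Let $(\Gamma,\Pi)$, $\Gamma=(V,E,s,t)$, be a finitely separated digraph and $L=L_{\mathbb F}(\Gamma,\Pi)$ its Leavitt path algebra over a field $\mathbb F$. Then the category $\mathfrak M_L$ of unital right $L$-modules is equivalent to the full subcategory of the category of quiver representations of $\Gamma$ whose objects are the representations $\rho$ satisfying $$(I)\qquad \text{for all } X\in\Pi,\quad (\rho(e))_{e\in X}:\rho(sX)\longrightarrow\bigoplus_{e\in X}\rho(te)\ \text{ is an isomorphism.}$$ Similarly, the full subcategory of graded quiver representations of $\Gamma$ (with respect to the standard $\mathbb Z$-grading, where the grade of a path is its length) satisfying $(I)$ is equivalent to the category of graded unital right $L$-modules (with respect to the standard $\mathbb Z$-grading).
   Context: A digraph $\Gamma=(V,E,s,t)$ has vertex set $V$, arrow set $E$ (both possibly infinite) and source and target maps $s,t:E\to V$; write $se,te$ for $s(e),t(e)$. A separated digraph is a pair $(\Gamma,\Pi)$ where $\Pi$ is a partition of $E$ such that arrows in the same part $X\in\Pi$ have the same source, denoted $sX$. It is finitely separated if every $X\in\Pi$ is finite. $L=L_{\mathbb F}(\Gamma,\Pi)$ is the (not necessarily unital) $\mathbb F$-algebra generated by $V\sqcup E\sqcup E^*$, where $E^*=\{e^*: e\in E\}$, $s(e^* )=te$, $t(e^* )=se$, subject to: (V) $vw=\delta_{v,w}v$ for $v,w\in V$; (E) $s(e)e=e=e\,t(e)$ for $e\in E\sqcup E^*$; (SCK1) $e^*f=\delta_{e,f}\,te$ for $e,f\in X$, $X\in\Pi$; (SCK2) $sX=\sum_{e\in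 X}ee^*$ for every finite $X\in\Pi$. The standard $\mathbb Z$-grading of $L$ is given by $|v|=0$, $|e|=1$, $|e^*|=-1$ for $v\in V$, $e\in E$. A right $L$-module $M$ is unital if $ML=M$. A quiver representation $\rho$ of $\Gamma$ assigns a (possibly infinite dimensional) $\mathbb F$-vector space $\rho(v)$ to each $v\in V$ and a linear map $\rho(e):\rho(se)\to\rho(te)$ to each $e\in E$; a morphism $\rho\to\sigma$ is a family of linear maps $\varphi_v:\rho(v)\to\sigma(v)$, $v\in V$, such that, for every $e \in E$, first $\rho(e)$ then $\varphi_{te}$ equals first $\varphi_{se}$ then $\sigma(e)$. In a graded quiver representation each $\rho(v)$ is $\mathbb Z$-graded and each $\rho(e)$ sends homogeneous elements of grade $n$ to homogeneous elements of grade $n+1$. Graded objects have grade-preserving morphisms. *)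

theory Defs
  imports
    "HOL-Algebra.Module"
    "HOL-Algebra.QuotRing"
    "HOL-Algebra.Generated_Groups"
    "HOL-Library.Poly_Mapping"
    "HOL-Library.Disjoint_Sets"
    "HOL-Library.Equipollence"
    "Graph_Theory.Digraph"
begin

section \<open>Categories and equivalences\<close>

text \<open>Composition is in diagrammatic order: \<open>Comp C a b c f g\<close> is \<open>f : a \<rightarrow> b\<close> followed by
  \<open>g : b \<rightarrow> c\<close>. Hom sets of different objects need not be disjoint, hence the object
  arguments of \<open>Comp\<close> and of the arrow part of functors.\<close>

record ('o, 'm) category =
  Obj :: "'o set"
  Hom :: "'o \<Rightarrow> 'o \<Rightarrow> 'm set"
  Id :: "'o \<Rightarrow> 'm"
  Comp :: "'o \<Rightarrow> 'o \<Rightarrow> 'o \<Rightarrow> 'm \<Rightarrow> 'm \<Rightarrow> 'm"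

locale category =
  fixes C :: "('o, 'm) category"
  assumes Id_in_Hom: "a \<in> Obj C \<Longrightarrow> Id C a \<in> Hom C a a"
    and Comp_in_Hom: "\<lbrakk>a \<in> Obj C; b \<in> Obj C; c \<in> Obj C; f \<in> Hom C a b; g \<in> Hom C b c\<rbrakk>
      \<Longrightarrow> Comp C a b c f g \<in> Hom C a c"
    and Id_Comp: "\<lbrakk>a \<in> Obj C; b \<in> Obj C; f \<in> Hom C a b\<rbrakk> \<Longrightarrow> Comp C a a b (Id C a) f = f"
    and Comp_Id: "\<lbrakk>a \<in> Obj C; b \<in> Obj C; f \<in> Hom C a b\<rbrakk> \<Longrightarrow> Comp C a b b f (Id C b) = f"
    and Comp_assoc: "\<lbrakk>a \<in> Obj C; b \<in> Obj C; c \<in> Obj C; d \<in> Obj C;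
        f \<in> Hom C a b; g \<in> Hom C b c; h \<in> Hom C c d\<rbrakk>
      \<Longrightarrow> Comp C a c d (Comp C a b c f g) h = Comp C a b d f (Comp C b c d g h)"

definition full_subcategory :: "('o, 'm) category \<Rightarrow> ('o \<Rightarrow> bool) \<Rightarrow> ('o, 'm) category" where
  "full_subcategory C P = C\<lparr>Obj := {a \<in> Obj C. P a}\<rparr>"

record ('o1, 'm1, 'o2, 'm2) funct =
  on_obj :: "'o1 \<Rightarrow> 'o2"
  on_hom :: "'o1 \<Rightarrow> 'o1 \<Rightarrow> 'm1 \<Rightarrow> 'm2"

definition is_functor ::
  "('o1, 'm1) category \<Rightarrow> ('o2, 'm2) category \<Rightarrow> ('o1, 'm1, 'o2, 'm2) funct \<Rightarrow> bool" where
  "is_functor C D F \<longleftrightarrow>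
    (\<forall>a\<in>Obj C. on_obj F a \<in> Obj D) \<and>
    (\<forall>a\<in>Obj C. \<forall>b\<in>Obj C. \<forall>f\<in>Hom C a b. on_hom F a b f \<in> Hom D (on_obj F a) (on_obj F b)) \<and>
    (\<forall>a\<in>Obj C. on_hom F a a (Id C a) = Id D (on_obj F a)) \<and>
    (\<forall>a\<in>Obj C. \<forall>b\<in>Obj C. \<forall>c\<in>Obj C. \<forall>f\<in>Hom C a b. \<forall>g\<in>Hom C b c.
      on_hom F a c (Comp C a b c f g) =
        Comp D (on_obj F a) (on_obj F b) (on_obj F c) (on_hom F a b f) (on_hom F b c g))"

definition id_functor :: "('o, 'm, 'o, 'm) funct" where
  "id_functor = \<lparr>on_obj = (\<lambda>a. a), on_hom = (\<lambda>a b f. f)\<rparr>"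

definition comp_functor ::
  "('o1, 'm1, 'o2, 'm2) funct \<Rightarrow> ('o2, 'm2, 'o3, 'm3) funct \<Rightarrow> ('o1, 'm1, 'o3, 'm3) funct" where
  "comp_functor F G = \<lparr>on_obj = (\<lambda>a. on_obj G (on_obj F a)),
     on_hom = (\<lambda>a b f. on_hom G (on_obj F a) (on_obj F b) (on_hom F a b f))\<rparr>"

definition is_iso :: "('o, 'm) category \<Rightarrow> 'o \<Rightarrow> 'o \<Rightarrow> 'm \<Rightarrow> bool" where
  "is_iso C a b f \<longleftrightarrow> f \<in> Hom C a b \<and>
    (\<exists>g\<in>Hom C b a. Comp C a b a f g = Id C a \<and> Comp C b a b g f = Id C b)"

definition natural_iso :: "('o1, 'm1) category \<Rightarrow> ('o2, 'm2) category \<Rightarrow>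
    ('o1, 'm1, 'o2, 'm2) funct \<Rightarrow> ('o1, 'm1, 'o2, 'm2) funct \<Rightarrow> ('o1 \<Rightarrow> 'm2) \<Rightarrow> bool" where
  "natural_iso C D F G \<eta> \<longleftrightarrow>
    (\<forall>a\<in>Obj C. is_iso D (on_obj F a) (on_obj G a) (\<eta> a)) \<and>
    (\<forall>a\<in>Obj C. \<forall>b\<in>Obj C. \<forall>f\<in>Hom C a b.
      Comp D (on_obj F a) (on_obj F b) (on_obj G b) (on_hom F a b f) (\<eta> b) =
      Comp D (on_obj F a) (on_obj G a) (on_obj G b) (\<eta> a) (on_hom G a b f))"

definition equivalent_categories :: "('o1, 'm1) category \<Rightarrow> ('o2, 'm2) category \<Rightarrow> bool" where
  "equivalent_categories C D \<longleftrightarrow> category C \<and> category D \<and>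
    (\<exists>F G \<eta> \<epsilon>. is_functor C D F \<and> is_functor D C G \<and>
      natural_iso C C id_functor (comp_functor F G) \<eta> \<and>
      natural_iso D D (comp_functor G F) id_functor \<epsilon>)"


section \<open>Vector spaces with carriers\<close>

text \<open>An \<open>\<F>\<close>-vector space is a record of type \<open>('f, 'u) module\<close> satisfying the locale
  \<open>module\<close> over \<open>scalar_field\<close>; its ring fields \<open>mult\<close> and \<open>one\<close> play no role.
  The type \<open>'u\<close> serves as the universe: all objects of the categories below are built from
  vector spaces whose carriers are subsets of it. A universe that is infinite and into which the
  vertex set embeds is closed under direct sums of vector spaces indexed by the vertices.
  Linear maps are extensional, so that equality of maps is equality on the domain.\<close>

definition scalar_field :: "'f::field ring" where
  "scalar_field = \<lparr>carrier = UNIV, mult = (*), one = 1, zero = 0, add = (+)\<rparr>"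

abbreviation vspace :: "('f::field, 'u, 'z) module_scheme \<Rightarrow> bool" where
  "vspace M \<equiv> Module.module scalar_field M"

definition linear_maps ::
  "('f::field, 'u, 'z) module_scheme \<Rightarrow> ('f, 'w, 'y) module_scheme \<Rightarrow> ('u \<Rightarrow> 'w) set" where
  "linear_maps M N = {f \<in> carrier M \<rightarrow>\<^sub>E carrier N.
     (\<forall>x\<in>carrier M. \<forall>y\<in>carrier M. f (x \<oplus>\<^bsub>M\<^esub> y) = f x \<oplus>\<^bsub>N\<^esub> f y) \<and>
     (\<forall>c. \<forall>x\<in>carrier M. f (c \<odot>\<^bsub>M\<^esub> x) = c \<odot>\<^bsub>N\<^esub> f x)}"

definition direct_sum :: "'i set \<Rightarrow> ('i \<Rightarrow> ('f::field, 'u) module) \<Rightarrow> ('f, 'i \<Rightarrow> 'u) module" where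
  "direct_sum I M =
    \<lparr>carrier = {x \<in> \<Pi>\<^sub>E i\<in>I. carrier (M i). finite {i \<in> I. x i \<noteq> \<zero>\<^bsub>M i\<^esub>}},
     mult = undefined, one = undefined,
     zero = (\<lambda>i\<in>I. \<zero>\<^bsub>M i\<^esub>),
     add = (\<lambda>x y. \<lambda>i\<in>I. x i \<oplus>\<^bsub>M i\<^esub> y i),
     smult = (\<lambda>c x. \<lambda>i\<in>I. c \<odot>\<^bsub>M i\<^esub> x i)\<rparr>"

text \<open>\<open>M\<close> is the internal direct sum of the subspaces \<open>D n\<close>, \<open>n \<in> \<int>\<close>.\<close>

definition int_graded :: "('f::field, 'u, 'z) module_scheme \<Rightarrow> (int \<Rightarrow> 'u set) \<Rightarrow> bool" where
  "int_graded M D \<longleftrightarrow> (\<forall>n. submodule (D n) (scalar_field :: 'f ring) M) \<and>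
    (\<forall>x\<in>carrier M. \<exists>!c. (\<forall>n. c n \<in> D n) \<and> finite {n. c n \<noteq> \<zero>\<^bsub>M\<^esub>} \<and>
       x = (\<Oplus>\<^bsub>M\<^esub>n\<in>{n. c n \<noteq> \<zero>\<^bsub>M\<^esub>}. c n))"


section \<open>Separated digraphs and their Leavitt path algebras\<close>

text \<open>The source and target maps are \<open>tail\<close> and \<open>head\<close>.\<close>

locale separated_digraph = wf_digraph \<Gamma>
  for \<Gamma> :: "('v, 'e) pre_digraph" and P :: "'e set set" +
  assumes partition: "partition_on (arcs \<Gamma>) P"
    and same_source: "\<lbrakk>X \<in> P; e \<in> X; f \<in> X\<rbrakk> \<Longrightarrow> tail \<Gamma> e = tail \<Gamma> f"

locale finitely_separated_digraph = separated_digraph +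
  assumes finite_part: "X \<in> P \<Longrightarrow> finite X"

definition part_source :: "('v, 'e) pre_digraph \<Rightarrow> 'e set \<Rightarrow> 'v" where
  "part_source \<Gamma> X = the_elem (tail \<Gamma> ` X)"

text \<open>The free monoid, written additively so that \<open>poly_mapping\<close> over it is the monoid algebra,
  that is, the algebra of noncommutative polynomials.\<close>

datatype 'g free_monoid = Wrd (letters: "'g list")

instantiation free_monoid :: (type) monoid_add
begin

definition zero_free_monoid :: "'a free_monoid" where
  "zero_free_monoid = Wrd []"

definition plus_free_monoid :: "'a free_monoid \<Rightarrow> 'a free_monoid \<Rightarrow> 'a free_monoid" where
  "plus_free_monoid u w = Wrd (letters u @ letters w)"

instance
  by standard (simp_all add: zero_free_monoid_def plus_free_monoid_def)

end

type_synonym ('g, 'f) ncpoly = "'g free_monoid \<Rightarrow>\<^sub>0 'f"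

definition free_algebra :: "'g set \<Rightarrow> ('g, 'f::field) ncpoly ring" where
  "free_algebra G = \<lparr>carrier = {p. \<forall>w\<in>Poly_Mapping.keys p. set (letters w) \<subseteq> G},
     mult = (*), one = 1, zero = 0, add = (+)\<rparr>"

definition gen :: "'g \<Rightarrow> ('g, 'f::field) ncpoly" where
  "gen g = Poly_Mapping.single (Wrd [g]) 1"

text \<open>\<open>Ghost e\<close> is the generator \<open>e\<^sup>*\<close>.\<close>

datatype ('v, 'e) lpa_gen = Vertex 'v | Arrow 'e | Ghost 'e

abbreviation vtx :: "'v \<Rightarrow> (('v, 'e) lpa_gen, 'f::field) ncpoly" where "vtx v \<equiv> gen (Vertex v)"
abbreviation arr :: "'e \<Rightarrow> (('v, 'e) lpa_gen, 'f::field) ncpoly" where "arr e \<equiv> gen (Arrow e)"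
abbreviation gho :: "'e \<Rightarrow> (('v, 'e) lpa_gen, 'f::field) ncpoly" where "gho e \<equiv> gen (Ghost e)"

definition lpa_gens :: "('v, 'e) pre_digraph \<Rightarrow> ('v, 'e) lpa_gen set" where
  "lpa_gens \<Gamma> = Vertex ` verts \<Gamma> \<union> Arrow ` arcs \<Gamma> \<union> Ghost ` arcs \<Gamma>"

definition lpa_relations ::
  "('v, 'e) pre_digraph \<Rightarrow> 'e set set \<Rightarrow> (('v, 'e) lpa_gen, 'f::field) ncpoly set" where
  "lpa_relations \<Gamma> P =
    \<comment> \<open>(V)\<close>
    {vtx v * vtx w - (if v = w then vtx v else 0) | v w. v \<in> verts \<Gamma> \<and> w \<in> verts \<Gamma>} \<union>
    \<comment> \<open>(E)\<close>
    {vtx (tail \<Gamma> e) * arr e - arr e | e. e \<in> arcs \<Gamma>} \<union>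
    {arr e * vtx (head \<Gamma> e) - arr e | e. e \<in> arcs \<Gamma>} \<union>
    {vtx (head \<Gamma> e) * gho e - gho e | e. e \<in> arcs \<Gamma>} \<union>
    {gho e * vtx (tail \<Gamma> e) - gho e | e. e \<in> arcs \<Gamma>} \<union>
    \<comment> \<open>(SCK1)\<close>
    {gho e * arr f - (if e = f then vtx (head \<Gamma> e) else 0) | e f X. X \<in> P \<and> e \<in> X \<and> f \<in> X} \<union>
    \<comment> \<open>(SCK2)\<close>
    {vtx (part_source \<Gamma> X) - (\<Sum>e\<in>X. arr e * gho e) | X. X \<in> P \<and> finite X}"

definition lpa_ideal ::
  "('v, 'e) pre_digraph \<Rightarrow> 'e set set \<Rightarrow> (('v, 'e) lpa_gen, 'f::field) ncpoly set" where
  "lpa_ideal \<Gamma> P = genideal (free_algebra (lpa_gens \<Gamma>)) (lpa_relations \<Gamma> P)"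

text \<open>All relations lie in the augmentation ideal \<open>A\<^sub>+\<close> (the polynomials without constant term)
  of the free unital algebra \<open>A\<close>, which is the free non-unital algebra on the generators. The
  two-sided ideal of \<open>A\<close> they generate is the ideal of the non-unital algebra \<open>A\<^sub>+\<close> they
  generate, so \<open>A\<^sub>+\<close> modulo this ideal is the non-unital algebra with these generators and
  relations. Scalars act as constant polynomials. The record field \<open>one\<close> is meaningless, as the
  algebra has no unit when there are infinitely many vertices.\<close>

type_synonym ('v, 'e, 'f) lpa_elem = "(('v, 'e) lpa_gen, 'f) ncpoly set"

definition lpa_coset ::
  "('v, 'e) pre_digraph \<Rightarrow> 'e set set \<Rightarrow> (('v, 'e) lpa_gen, 'f::field) ncpoly \<Rightarrow> ('v, 'e, 'f) lpa_elem"
where "lpa_coset \<Gamma> P p = a_r_coset (free_algebra (lpa_gens \<Gamma>)) (lpa_ideal \<Gamma> P) p"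

definition leavitt_path_algebra ::
  "('v, 'e) pre_digraph \<Rightarrow> 'e set set \<Rightarrow> ('f::field, ('v, 'e, 'f) lpa_elem) module" where
  "leavitt_path_algebra \<Gamma> P =
    (let Q = free_algebra (lpa_gens \<Gamma>) Quot lpa_ideal \<Gamma> P
     in \<lparr>carrier = {lpa_coset \<Gamma> P p | p. p \<in> carrier (free_algebra (lpa_gens \<Gamma>)) \<and> Poly_Mapping.lookup p 0 = 0},
         mult = mult Q, one = undefined, zero = zero Q, add = add Q,
         smult = (\<lambda>c x. lpa_coset \<Gamma> P (Poly_Mapping.single 0 c) \<otimes>\<^bsub>Q\<^esub> x)\<rparr>)"

fun gen_degree :: "('v, 'e) lpa_gen \<Rightarrow> int" where
  "gen_degree (Vertex v) = 0"
| "gen_degree (Arrow e) = 1"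
| "gen_degree (Ghost e) = -1"

definition lpa_grade ::
  "('v, 'e) pre_digraph \<Rightarrow> 'e set set \<Rightarrow> int \<Rightarrow> ('v, 'e, 'f::field) lpa_elem set" where
  "lpa_grade \<Gamma> P n =
    {lpa_coset \<Gamma> P p | p. p \<in> carrier (free_algebra (lpa_gens \<Gamma>)) \<and> Poly_Mapping.lookup p 0 = 0 \<and>
       (\<forall>w\<in>Poly_Mapping.keys p. sum_list (map gen_degree (letters w)) = n)}"


section \<open>Categories of unital right modules\<close>

text \<open>As usual over a not necessarily unital \<open>\<F>\<close>-algebra, a right module is an
  \<open>\<F>\<close>-vector space with a bilinear action.\<close>

record ('f, 'u, 'l) rmod = "('f, 'u) module" +
  ract :: "'u \<Rightarrow> 'l \<Rightarrow> 'u"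

record ('f, 'u, 'l) graded_rmod = "('f, 'u, 'l) rmod" +
  grade :: "int \<Rightarrow> 'u set"

locale right_module =
  fixes L :: "('f::field, 'l) module" and M :: "('f, 'u, 'l, 'z) rmod_scheme"
  assumes vspace: "vspace M"
    and ract_closed: "\<lbrakk>x \<in> carrier M; a \<in> carrier L\<rbrakk> \<Longrightarrow> ract M x a \<in> carrier M"
    and ract_add_left: "\<lbrakk>x \<in> carrier M; y \<in> carrier M; a \<in> carrier L\<rbrakk>
      \<Longrightarrow> ract M (x \<oplus>\<^bsub>M\<^esub> y) a = ract M x a \<oplus>\<^bsub>M\<^esub> ract M y a"
    and ract_add_right: "\<lbrakk>x \<in> carrier M; a \<in> carrier L; b \<in> carrier L\<rbrakk>
      \<Longrightarrow> ract M x (a \<oplus>\<^bsub>L\<^esub> b) = ract M x a \<oplus>\<^bsub>M\<^esub> ract M x b"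
    and ract_smult_left: "\<lbrakk>x \<in> carrier M; a \<in> carrier L\<rbrakk>
      \<Longrightarrow> ract M (c \<odot>\<^bsub>M\<^esub> x) a = c \<odot>\<^bsub>M\<^esub> ract M x a"
    and ract_smult_right: "\<lbrakk>x \<in> carrier M; a \<in> carrier L\<rbrakk>
      \<Longrightarrow> ract M x (c \<odot>\<^bsub>L\<^esub> a) = c \<odot>\<^bsub>M\<^esub> ract M x a"
    and ract_mult: "\<lbrakk>x \<in> carrier M; a \<in> carrier L; b \<in> carrier L\<rbrakk>
      \<Longrightarrow> ract M x (a \<otimes>\<^bsub>L\<^esub> b) = ract M (ract M x a) b"

text \<open>\<open>M L\<close> is the additive subgroup generated by the products \<open>x a\<close>.\<close>

locale unital_right_module = right_module +
  assumes unital: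
    "generate (add_monoid M) {ract M x a | x a. x \<in> carrier M \<and> a \<in> carrier L} = carrier M"

locale graded_unital_right_module = unital_right_module L M
  for L :: "('f::field, 'l) module" and G :: "int \<Rightarrow> 'l set"
    and M :: "('f, 'u, 'l, 'z) graded_rmod_scheme" +
  assumes graded: "int_graded M (grade M)"
    and ract_grade: "\<lbrakk>x \<in> grade M m; a \<in> G n\<rbrakk> \<Longrightarrow> ract M x a \<in> grade M (m + n)"

definition rmod_homs :: "('f::field, 'l) module \<Rightarrow>
    ('f, 'u, 'l, 'z) rmod_scheme \<Rightarrow> ('f, 'u, 'l, 'z) rmod_scheme \<Rightarrow> ('u \<Rightarrow> 'u) set" where
  "rmod_homs L M N = {f \<in> linear_maps M N.
     \<forall>x\<in>carrier M. \<forall>a\<in>carrier L. f (ract M x a) = ract N (f x) a}"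

definition unital_modules ::
  "('f::field, 'l) module \<Rightarrow> (('f, 'u, 'l) rmod, 'u \<Rightarrow> 'u) category" where
  "unital_modules L =
    \<lparr>Obj = {M. unital_right_module L M},
     Hom = rmod_homs L,
     Id = (\<lambda>M. \<lambda>x\<in>carrier M. x),
     Comp = (\<lambda>M N K f g. compose (carrier M) g f)\<rparr>"

definition graded_unital_modules :: "('f::field, 'l) module \<Rightarrow> (int \<Rightarrow> 'l set) \<Rightarrow>
    (('f, 'u, 'l) graded_rmod, 'u \<Rightarrow> 'u) category" where
  "graded_unital_modules L G =
    \<lparr>Obj = {M. graded_unital_right_module L G M},
     Hom = (\<lambda>M N. {f \<in> rmod_homs L M N. \<forall>n. f ` grade M n \<subseteq> grade N n}),
     Id = (\<lambda>M. \<lambda>x\<in>carrier M. x),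
     Comp = (\<lambda>M N K f g. compose (carrier M) g f)\<rparr>"


section \<open>Categories of quiver representations\<close>

record ('v, 'e, 'f, 'u) quiver_rep =
  rspace :: "'v \<Rightarrow> ('f, 'u) module"
  rmap :: "'e \<Rightarrow> 'u \<Rightarrow> 'u"

record ('v, 'e, 'f, 'u) graded_quiver_rep = "('v, 'e, 'f, 'u) quiver_rep" +
  rgrade :: "'v \<Rightarrow> int \<Rightarrow> 'u set"

definition is_quiver_rep ::
  "('v, 'e) pre_digraph \<Rightarrow> ('v, 'e, 'f::field, 'u, 'z) quiver_rep_scheme \<Rightarrow> bool" where
  "is_quiver_rep \<Gamma> \<rho> \<longleftrightarrow> (\<forall>v\<in>verts \<Gamma>. vspace (rspace \<rho> v)) \<and>
    (\<forall>e\<in>arcs \<Gamma>. rmap \<rho> e \<in> linear_maps (rspace \<rho> (tail \<Gamma> e)) (rspace \<rho> (head \<Gamma> e)))"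

definition is_graded_quiver_rep ::
  "('v, 'e) pre_digraph \<Rightarrow> ('v, 'e, 'f::field, 'u) graded_quiver_rep \<Rightarrow> bool" where
  "is_graded_quiver_rep \<Gamma> \<rho> \<longleftrightarrow> is_quiver_rep \<Gamma> \<rho> \<and>
    (\<forall>v\<in>verts \<Gamma>. int_graded (rspace \<rho> v) (rgrade \<rho> v)) \<and>
    (\<forall>e\<in>arcs \<Gamma>. \<forall>n. rmap \<rho> e ` rgrade \<rho> (tail \<Gamma> e) n \<subseteq> rgrade \<rho> (head \<Gamma> e) (n + 1))"

definition rep_homs :: "('v, 'e) pre_digraph \<Rightarrow> ('v, 'e, 'f::field, 'u, 'z) quiver_rep_scheme \<Rightarrow>
    ('v, 'e, 'f, 'u, 'z) quiver_rep_scheme \<Rightarrow> ('v \<Rightarrow> 'u \<Rightarrow> 'u) set" where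
  "rep_homs \<Gamma> \<rho> \<sigma> = {\<phi> \<in> \<Pi>\<^sub>E v\<in>verts \<Gamma>. linear_maps (rspace \<rho> v) (rspace \<sigma> v).
     \<forall>e\<in>arcs \<Gamma>. \<forall>x\<in>carrier (rspace \<rho> (tail \<Gamma> e)).
       \<phi> (head \<Gamma> e) (rmap \<rho> e x) = rmap \<sigma> e (\<phi> (tail \<Gamma> e) x)}"

definition quiver_reps ::
  "('v, 'e) pre_digraph \<Rightarrow> (('v, 'e, 'f::field, 'u) quiver_rep, 'v \<Rightarrow> 'u \<Rightarrow> 'u) category" where
  "quiver_reps \<Gamma> =
    \<lparr>Obj = {\<rho>. is_quiver_rep \<Gamma> \<rho>},
     Hom = rep_homs \<Gamma>,
     Id = (\<lambda>\<rho>. \<lambda>v\<in>verts \<Gamma>. \<lambda>x\<in>carrier (rspace \<rho> v). x),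
     Comp = (\<lambda>\<rho> \<sigma> \<tau> \<phi> \<psi>. \<lambda>v\<in>verts \<Gamma>. compose (carrier (rspace \<rho> v)) (\<psi> v) (\<phi> v))\<rparr>"

definition graded_quiver_reps ::
  "('v, 'e) pre_digraph \<Rightarrow> (('v, 'e, 'f::field, 'u) graded_quiver_rep, 'v \<Rightarrow> 'u \<Rightarrow> 'u) category" where
  "graded_quiver_reps \<Gamma> =
    \<lparr>Obj = {\<rho>. is_graded_quiver_rep \<Gamma> \<rho>},
     Hom = (\<lambda>\<rho> \<sigma>. {\<phi> \<in> rep_homs \<Gamma> \<rho> \<sigma>. \<forall>v\<in>verts \<Gamma>. \<forall>n. \<phi> v ` rgrade \<rho> v n \<subseteq> rgrade \<sigma> v n}),
     Id = (\<lambda>\<rho>. \<lambda>v\<in>verts \<Gamma>. \<lambda>x\<in>carrier (rspace \<rho> v). x),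
     Comp = (\<lambda>\<rho> \<sigma> \<tau> \<phi> \<psi>. \<lambda>v\<in>verts \<Gamma>. compose (carrier (rspace \<rho> v)) (\<psi> v) (\<phi> v))\<rparr>"

definition condition_I :: "('v, 'e) pre_digraph \<Rightarrow> 'e set set \<Rightarrow>
    ('v, 'e, 'f::field, 'u, 'z) quiver_rep_scheme \<Rightarrow> bool" where
  "condition_I \<Gamma> P \<rho> \<longleftrightarrow> (\<forall>X\<in>P.
    let S = rspace \<rho> (part_source \<Gamma> X);
        T = direct_sum X (\<lambda>e. rspace \<rho> (head \<Gamma> e));
        \<theta> = (\<lambda>x\<in>carrier S. \<lambda>e\<in>X. rmap \<rho> e x)
    in \<theta> \<in> linear_maps S T \<and> bij_betw \<theta> (carrier S) (carrier T))"

end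

theory Submission
  imports Defs "HOL-Algebra.Free_Abelian_Groups"
begin

text \<open>A unital module \<open>M\<close> is the direct sum of its corners \<open>M v\<close>, and the arrows act between
  them, so \<open>M\<close> yields a representation; by (SCK1) and (SCK2) the maps \<open>y \<mapsto> y e\<^sup>*\<close> assemble to the
  inverse of the map in (I). Conversely, (I) supplies unique maps for the ghost arrows, and these
  make the direct sum of the spaces \<open>\<rho>(v)\<close> a unital module. A morphism of representations commutes
  with the ghost arrows automatically, because it commutes with the isomorphisms (I) inverse to
  them; hence the functor taking corners is fully faithful. In the graded case the inverse of (I)
  lowers degrees by one, since (I) detects homogeneous components.\<close>

section \<open>Equivalences from fully faithful, essentially surjective functors\<close>

text \<open>Three obstacles shape the proof. The algebra is a quotient of a free algebra and may
  have no unit, so its modules are handled through the operators by which its generators act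
  (\<open>generator_module\<close>): relations become identities between operators, and unitality
  says that each element is a finite sum of its vertex components. Next, all objects of a category
  have carriers in one type \<open>'u\<close>, whereas a direct sum of the spaces \<rho>(v) consists
  of functions on the vertices; it is copied into \<open>'u\<close> along an injection, and this is
  where the size of \<open>'u\<close> matters. Sums over the vertices are therefore used only
  through their injections and projections (\<open>biproduct\<close>), which treats the copied sum
  and the corners of a module alike. Finally, plain and graded objects have different record types;
  most of the algebra is stated for arbitrary record extensions, so that the graded case only adds
  degree checks.\<close>

lemma is_iso_Hom: "is_iso C a b f \<Longrightarrow> f \<in> Hom C a b"
  by (simp add: is_iso_def)

lemma category_full_subcategory:
  assumes "category C"
  shows "category (full_subcategory C Q)"
  using assms unfolding category_def full_subcategory_def by simp

text \<open>A chosen inverse, so that the inverses of the components of a natural isomorphism form a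
  function of the object.\<close>

definition inverse_arrow :: "('o, 'm) category \<Rightarrow> 'o \<Rightarrow> 'o \<Rightarrow> 'm \<Rightarrow> 'm" where
  "inverse_arrow C a b f = (SOME g. g \<in> Hom C b a \<and> Comp C a b a f g = Id C a \<and> Comp C b a b g f = Id C b)"

lemma inverse_arrow:
  assumes "is_iso C a b f"
  shows "inverse_arrow C a b f \<in> Hom C b a"
    and "Comp C a b a f (inverse_arrow C a b f) = Id C a"
    and "Comp C b a b (inverse_arrow C a b f) f = Id C b"
proof -
  have "\<exists>g. g \<in> Hom C b a \<and> Comp C a b a f g = Id C a \<and> Comp C b a b g f = Id C b"
    using assms by (auto simp: is_iso_def)
  from someI_ex[OF this]
  show "inverse_arrow C a b f \<in> Hom C b a"
    and "Comp C a b a f (inverse_arrow C a b f) = Id C a"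
    and "Comp C b a b (inverse_arrow C a b f) f = Id C b"
    by (auto simp: inverse_arrow_def)
qed

lemma is_iso_inverse_arrow:
  assumes "is_iso C a b f"
  shows "is_iso C b a (inverse_arrow C a b f)"
  using inverse_arrow[OF assms] is_iso_Hom[OF assms] unfolding is_iso_def by blast

context category
begin

text \<open>An isomorphism is monic: composing with its inverse recovers \<open>f\<close> from its
  composite with \<open>g\<close>.\<close>

lemma cancel_iso_right:
  assumes "a \<in> Obj C" "b \<in> Obj C" "c \<in> Obj C" "is_iso C b c g"
    and "f \<in> Hom C a b" "f' \<in> Hom C a b" "Comp C a b c f g = Comp C a b c f' g"
  shows "f = f'"
proof -
  note inv = inverse_arrow[OF assms(4)]
  have "h = Comp C a c b (Comp C a b c h g) (inverse_arrow C b c g)" if "h \<in> Hom C a b" for h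
    using that assms inv is_iso_Hom[OF assms(4)] by (simp add: Comp_assoc Comp_Id)
  then show ?thesis using assms(5-7) by metis
qed

text \<open>Inserting the inverse of \<open>s\<close> followed by \<open>s\<close> in front of
  \<open>f'\<close> exposes one side of the square; after rewriting it, \<open>t\<close> meets its
  inverse and cancels. This serves to invert natural isomorphisms and to prove naturality of the
  unit below.\<close>

lemma square_inverse:
  assumes obj: "a \<in> Obj C" "b \<in> Obj C" "a' \<in> Obj C" "b' \<in> Obj C"
    and iso: "is_iso C a a' s" "is_iso C b b' t"
    and hom: "f \<in> Hom C a b" "f' \<in> Hom C a' b'"
    and sq: "Comp C a b b' f t = Comp C a a' b' s f'"
  shows "Comp C a' b' b f' (inverse_arrow C b b' t) = Comp C a' a b (inverse_arrow C a a' s) f"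
proof -
  let ?s = "inverse_arrow C a a' s" and ?t = "inverse_arrow C b b' t"
  note s = inverse_arrow[OF iso(1)] is_iso_Hom[OF iso(1)]
  note t = inverse_arrow[OF iso(2)] is_iso_Hom[OF iso(2)]
  have "Comp C a' b' b f' ?t = Comp C a' b' b (Comp C a' a' b' (Comp C a' a a' ?s s) f') ?t"
    using obj s hom by (simp add: Id_Comp)
  also have "Comp C a' a' b' (Comp C a' a a' ?s s) f' = Comp C a' a b' ?s (Comp C a b b' f t)"
    unfolding sq using obj s hom by (intro Comp_assoc)
  also have "Comp C a' b' b (Comp C a' a b' ?s (Comp C a b b' f t)) ?t =
      Comp C a' a b ?s (Comp C a b' b (Comp C a b b' f t) ?t)"
    using obj s t hom by (intro Comp_assoc Comp_in_Hom)
  also have "Comp C a b' b (Comp C a b b' f t) ?t = f"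
    using obj t hom Comp_assoc[of a b b' b f t ?t] Comp_Id[of a b f] by simp
  finally show ?thesis .
qed

end

lemma natural_iso_inverse:
  assumes "category D" "is_functor C D F" "is_functor C D G" "natural_iso C D F G \<eta>"
  shows "natural_iso C D G F (\<lambda>a. inverse_arrow D (on_obj F a) (on_obj G a) (\<eta> a))"
  unfolding natural_iso_def
proof (intro conjI ballI)
  fix a assume "a \<in> Obj C"
  then show "is_iso D (on_obj G a) (on_obj F a) (inverse_arrow D (on_obj F a) (on_obj G a) (\<eta> a))"
    using assms(4) by (intro is_iso_inverse_arrow) (auto simp: natural_iso_def)
next
  fix a b f assume "a \<in> Obj C" "b \<in> Obj C" "f \<in> Hom C a b"
  then show "Comp D (on_obj G a) (on_obj G b) (on_obj F b) (on_hom G a b f)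
       (inverse_arrow D (on_obj F b) (on_obj G b) (\<eta> b)) =
      Comp D (on_obj G a) (on_obj F a) (on_obj F b)
       (inverse_arrow D (on_obj F a) (on_obj G a) (\<eta> a)) (on_hom F a b f)"
    using assms by (intro category.square_inverse) (auto simp: natural_iso_def is_functor_def)
qed

lemma is_functor_id: "is_functor C C id_functor"
  by (simp add: is_functor_def id_functor_def)

lemma is_functor_comp:
  assumes "is_functor C D F" "is_functor D E G"
  shows "is_functor C E (comp_functor F G)"
  using assms by (simp add: is_functor_def comp_functor_def)

text \<open>The inverted counit is the unit of the reversed equivalence, and the inverted unit is
  its counit.\<close>

lemma equivalent_categories_sym:
  assumes "equivalent_categories C D"
  shows "equivalent_categories D C"
proof -
  from assms obtain F G \<eta> \<epsilon> where cat: "category C" "category D"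
    and F: "is_functor C D F" and G: "is_functor D C G"
    and \<eta>: "natural_iso C C id_functor (comp_functor F G) \<eta>"
    and \<epsilon>: "natural_iso D D (comp_functor G F) id_functor \<epsilon>"
    by (auto simp: equivalent_categories_def)
  show ?thesis unfolding equivalent_categories_def
    using cat F G
      natural_iso_inverse[OF cat(1) is_functor_id is_functor_comp[OF F G] \<eta>]
      natural_iso_inverse[OF cat(2) is_functor_comp[OF G F] is_functor_id \<epsilon>]
    by blast
qed

text \<open>The quasi-inverse chooses preimages of objects up to isomorphism. Every equation in
  \<open>C\<close> is checked after applying the faithful functor \<open>F\<close>, and equations
  between arrows into F(G d) after composing with the monic \<epsilon>(d).\<close>

theorem equivalent_categories_if_fully_faithful:
  assumes catC: "category C" and catD: "category D" and F: "is_functor C D F"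
    and ff: "\<And>a b. \<lbrakk>a \<in> Obj C; b \<in> Obj C\<rbrakk>
      \<Longrightarrow> bij_betw (on_hom F a b) (Hom C a b) (Hom D (on_obj F a) (on_obj F b))"
    and es: "\<And>d. d \<in> Obj D \<Longrightarrow> \<exists>c\<in>Obj C. \<exists>f. is_iso D (on_obj F c) d f"
  shows "equivalent_categories C D"
proof -
  interpret C: category C by fact
  interpret D: category D by fact
  obtain G0 where G0: "\<And>d. d \<in> Obj D \<Longrightarrow> G0 d \<in> Obj C \<and> (\<exists>f. is_iso D (on_obj F (G0 d)) d f)"
    using es by metis
  then obtain \<epsilon> where \<epsilon>: "\<And>d. d \<in> Obj D \<Longrightarrow> is_iso D (on_obj F (G0 d)) d (\<epsilon> d)"
    by metis
  have G0: "G0 d \<in> Obj C" if "d \<in> Obj D" for d using G0 that by blast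
  have F0: "on_obj F a \<in> Obj D" if "a \<in> Obj C" for a
    using F that by (simp add: is_functor_def)
  have F1: "on_hom F a b f \<in> Hom D (on_obj F a) (on_obj F b)"
    if "a \<in> Obj C" "b \<in> Obj C" "f \<in> Hom C a b" for a b f
    using F that by (simp add: is_functor_def)
  have Fid: "on_hom F a a (Id C a) = Id D (on_obj F a)" if "a \<in> Obj C" for a
    using F that by (simp add: is_functor_def)
  have Fcomp: "on_hom F a c (Comp C a b c f g) =
      Comp D (on_obj F a) (on_obj F b) (on_obj F c) (on_hom F a b f) (on_hom F b c g)"
    if "a \<in> Obj C" "b \<in> Obj C" "c \<in> Obj C" "f \<in> Hom C a b" "g \<in> Hom C b c" for a b c f g
    using F that by (simp add: is_functor_def)
  \<comment> \<open>The inverse of \<open>F\<close> on a Hom set. The objects are arguments because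
    Hom sets of different objects may overlap.\<close>
  define lift where "lift a b h = the_inv_into (Hom C a b) (on_hom F a b) h" for a b h
  have lift: "lift a b h \<in> Hom C a b" "on_hom F a b (lift a b h) = h"
    if "a \<in> Obj C" "b \<in> Obj C" "h \<in> Hom D (on_obj F a) (on_obj F b)" for a b h
    using bij_betwE[OF bij_betw_the_inv_into[OF ff[OF that(1,2)]]]
      f_the_inv_into_f_bij_betw[OF ff[OF that(1,2)]] that(3)
    by (auto simp: lift_def)
  have F_inj: "f = g" if "a \<in> Obj C" "b \<in> Obj C" "f \<in> Hom C a b" "g \<in> Hom C a b"
    "on_hom F a b f = on_hom F a b g" for a b f g
    using ff[OF that(1,2)] that(3-5) unfolding bij_betw_def by (meson inj_onD)
  let ?inv = "\<lambda>d. inverse_arrow D (on_obj F (G0 d)) d (\<epsilon> d)"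
  \<comment> \<open>The conjugate of \<open>h\<close> by the chosen isomorphisms: the only arrow
    between the F(G d) that makes the square with \<open>h\<close> commute. This uniqueness is what
    \<open>conj_eqI\<close> provides.\<close>
  define conj where "conj d d' h = Comp D (on_obj F (G0 d)) d' (on_obj F (G0 d'))
      (Comp D (on_obj F (G0 d)) d d' (\<epsilon> d) h) (?inv d')" for d d' h
  note [simp] = G0 F0 F1 Fid Fcomp lift is_iso_Hom[OF \<epsilon>] inverse_arrow[OF \<epsilon>]
    C.Id_in_Hom D.Id_in_Hom C.Comp_in_Hom D.Comp_in_Hom
  have conj: "conj d d' h \<in> Hom D (on_obj F (G0 d)) (on_obj F (G0 d'))"
    "Comp D (on_obj F (G0 d)) (on_obj F (G0 d')) d' (conj d d' h) (\<epsilon> d') =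
      Comp D (on_obj F (G0 d)) d d' (\<epsilon> d) h"
    if "d \<in> Obj D" "d' \<in> Obj D" "h \<in> Hom D d d'" for d d' h
    using that by (simp_all add: conj_def D.Comp_assoc D.Comp_Id)
  have conj_eqI: "conj d d' h = k"
    if "d \<in> Obj D" "d' \<in> Obj D" "h \<in> Hom D d d'" "k \<in> Hom D (on_obj F (G0 d)) (on_obj F (G0 d'))"
      "Comp D (on_obj F (G0 d)) (on_obj F (G0 d')) d' k (\<epsilon> d') =
        Comp D (on_obj F (G0 d)) d d' (\<epsilon> d) h" for d d' h k
    by (rule D.cancel_iso_right[OF _ _ _ \<epsilon>[of d'] _ _ trans[OF conj(2) that(5)[symmetric]]])
      (use that in \<open>simp_all add: conj(1)\<close>)
  define G where "G = \<lparr>on_obj = G0, on_hom = (\<lambda>d d' h. lift (G0 d) (G0 d') (conj d d' h))\<rparr>"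
  have G_functor: "is_functor D C G"
    unfolding is_functor_def
  proof (intro conjI ballI)
    fix a assume a: "a \<in> Obj D"
    then have *: "conj a a (Id D a) = Id D (on_obj F (G0 a))"
      by (intro conj_eqI) (simp_all add: D.Id_Comp D.Comp_Id)
    show "on_hom G a a (Id D a) = Id C (on_obj G a)"
      by (rule F_inj[of "G0 a" "G0 a"]) (use a * in \<open>simp_all add: G_def conj\<close>)
  next
    fix a b c f g
    assume a: "a \<in> Obj D" "b \<in> Obj D" "c \<in> Obj D" "f \<in> Hom D a b" "g \<in> Hom D b c"
    \<comment> \<open>Sliding \<epsilon> past \<open>conj b c g\<close> and past
      \<open>conj a b f\<close> turns the composite into the square that characterises the conjugate
      of the composite arrow.\<close>
    have *: "conj a c (Comp D a b c f g) =
      Comp D (on_obj F (G0 a)) (on_obj F (G0 b)) (on_obj F (G0 c)) (conj a b f) (conj b c g)"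
    proof (rule conj_eqI)
      have "Comp D (on_obj F (G0 a)) (on_obj F (G0 c)) c
          (Comp D (on_obj F (G0 a)) (on_obj F (G0 b)) (on_obj F (G0 c)) (conj a b f) (conj b c g)) (\<epsilon> c)
        = Comp D (on_obj F (G0 a)) (on_obj F (G0 b)) c (conj a b f)
            (Comp D (on_obj F (G0 b)) b c (\<epsilon> b) g)"
        using a by (simp add: D.Comp_assoc conj)
      also have "\<dots> = Comp D (on_obj F (G0 a)) b c
            (Comp D (on_obj F (G0 a)) (on_obj F (G0 b)) b (conj a b f) (\<epsilon> b)) g"
        using a by (simp add: D.Comp_assoc conj(1))
      also have "\<dots> = Comp D (on_obj F (G0 a)) a c (\<epsilon> a) (Comp D a b c f g)"
        using a by (simp add: D.Comp_assoc conj(2))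
      finally show "Comp D (on_obj F (G0 a)) (on_obj F (G0 c)) c
          (Comp D (on_obj F (G0 a)) (on_obj F (G0 b)) (on_obj F (G0 c)) (conj a b f) (conj b c g)) (\<epsilon> c)
        = Comp D (on_obj F (G0 a)) a c (\<epsilon> a) (Comp D a b c f g)" .
    qed (use a in \<open>simp_all add: conj(1)\<close>)
    show "on_hom G a c (Comp D a b c f g) =
      Comp C (on_obj G a) (on_obj G b) (on_obj G c) (on_hom G a b f) (on_hom G b c g)"
      by (rule F_inj[of "G0 a" "G0 c"]) (use a * in \<open>simp_all add: G_def conj(1)\<close>)
  qed (simp_all add: G_def conj)
  have counit: "natural_iso D D (comp_functor G F) id_functor \<epsilon>"
    unfolding natural_iso_def by (simp add: comp_functor_def id_functor_def G_def conj \<epsilon>)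
  \<comment> \<open>The component is forced by a triangle identity: \<open>F\<close> has to send it
    to the inverse of \<epsilon> at \<open>F a\<close>.\<close>
  define \<eta> where "\<eta> a = lift a (G0 (on_obj F a)) (?inv (on_obj F a))" for a
  have \<eta>: "\<eta> a \<in> Hom C a (G0 (on_obj F a))" "on_hom F a (G0 (on_obj F a)) (\<eta> a) = ?inv (on_obj F a)"
    if "a \<in> Obj C" for a
    using that by (simp_all add: \<eta>_def)
  have unit: "natural_iso C C id_functor (comp_functor F G) \<eta>"
    unfolding natural_iso_def
  proof (intro conjI ballI)
    fix a assume a: "a \<in> Obj C"
    \<comment> \<open>The inverse of the unit component lifts \<epsilon> itself; the two identities
      hold because their images under \<open>F\<close> do.\<close>
    let ?g = "lift (G0 (on_obj F a)) a (\<epsilon> (on_obj F a))"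
    have "Comp C a (G0 (on_obj F a)) a (\<eta> a) ?g = Id C a"
      by (rule F_inj[of a a]) (use a \<eta> in \<open>simp_all\<close>)
    moreover have "Comp C (G0 (on_obj F a)) a (G0 (on_obj F a)) ?g (\<eta> a) = Id C (G0 (on_obj F a))"
      by (rule F_inj[of "G0 (on_obj F a)" "G0 (on_obj F a)"]) (use a \<eta> in \<open>simp_all\<close>)
    ultimately show "is_iso C (on_obj id_functor a) (on_obj (comp_functor F G) a) (\<eta> a)"
      unfolding is_iso_def using a \<eta>
      by (auto simp: id_functor_def comp_functor_def G_def intro!: bexI[of _ ?g])
  next
    fix a b f assume a: "a \<in> Obj C" "b \<in> Obj C" "f \<in> Hom C a b"
    let ?Fa = "on_obj F a" and ?Fb = "on_obj F b" and ?f = "on_hom F a b f"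
    have *: "Comp D ?Fa ?Fb (on_obj F (G0 ?Fb)) ?f (?inv ?Fb) =
       Comp D ?Fa (on_obj F (G0 ?Fa)) (on_obj F (G0 ?Fb)) (?inv ?Fa) (conj ?Fa ?Fb ?f)"
      using a by (intro D.square_inverse \<epsilon>) (simp_all add: conj)
    show "Comp C (on_obj id_functor a) (on_obj id_functor b) (on_obj (comp_functor F G) b)
        (on_hom id_functor a b f) (\<eta> b) =
       Comp C (on_obj id_functor a) (on_obj (comp_functor F G) a) (on_obj (comp_functor F G) b) (\<eta> a)
        (on_hom (comp_functor F G) a b f)"
      by (rule F_inj[of a "G0 ?Fb"]) (use a \<eta> * in \<open>simp_all add: id_functor_def comp_functor_def G_def conj(1)\<close>)
  qed
  show ?thesis unfolding equivalent_categories_def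
    using catC catD F G_functor unit counit by blast
qed

section \<open>Vector spaces, linear maps and gradings\<close>

lemma scalar_field_simps [simp]:
  "carrier scalar_field = UNIV" "mult scalar_field = (*)" "one scalar_field = 1"
  "ring.zero scalar_field = 0" "add scalar_field = (+)"
  by (simp_all add: scalar_field_def)

lemma cring_scalar_field: "cring (scalar_field :: 'f::field ring)"
proof (rule cringI)
  show "abelian_group (scalar_field :: 'f ring)"
    by (rule abelian_groupI) (auto simp: algebra_simps intro: exI[of _ "- x" for x :: 'f] eq_neg_iff_add_eq_0)
  show "Group.comm_monoid (scalar_field :: 'f ring)"
    by (rule comm_monoidI) (auto simp: algebra_simps)
qed (auto simp: algebra_simps)

lemma vspaceI:
  assumes "abelian_group M"
    and "\<And>c x. x \<in> carrier M \<Longrightarrow> c \<odot>\<^bsub>M\<^esub> x \<in> carrier M"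
    and "\<And>c d x. x \<in> carrier M \<Longrightarrow> (c + d) \<odot>\<^bsub>M\<^esub> x = c \<odot>\<^bsub>M\<^esub> x \<oplus>\<^bsub>M\<^esub> d \<odot>\<^bsub>M\<^esub> x"
    and "\<And>c x y. \<lbrakk>x \<in> carrier M; y \<in> carrier M\<rbrakk> \<Longrightarrow> c \<odot>\<^bsub>M\<^esub> (x \<oplus>\<^bsub>M\<^esub> y) = c \<odot>\<^bsub>M\<^esub> x \<oplus>\<^bsub>M\<^esub> c \<odot>\<^bsub>M\<^esub> y"
    and "\<And>c d x. x \<in> carrier M \<Longrightarrow> (c * d) \<odot>\<^bsub>M\<^esub> x = c \<odot>\<^bsub>M\<^esub> (d \<odot>\<^bsub>M\<^esub> x)"
    and "\<And>x. x \<in> carrier M \<Longrightarrow> 1 \<odot>\<^bsub>M\<^esub> x = x"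
  shows "vspace M"
  by (rule moduleI) (use assms cring_scalar_field in auto)

text \<open>The scalars form the whole type \<open>'f\<close>, so the rules below restate those of
  \<open>module\<close> free of side conditions on scalars and with the field operations of
  \<open>'f\<close>.\<close>

locale vect = fixes M :: "('f::field, 'u, 'z) module_scheme" (structure)
  assumes vspace: "vspace M"
begin

sublocale Module.module "scalar_field :: 'f ring" M by (rule vspace)

lemma smult_mem [simp, intro]: "x \<in> carrier M \<Longrightarrow> c \<odot> x \<in> carrier M"
  by simp

lemma smult_add_left: "x \<in> carrier M \<Longrightarrow> (c + d) \<odot> x = c \<odot> x \<oplus> d \<odot> x"
  using smult_l_distr[of c d x] by simp

lemma smult_add_right: "\<lbrakk>x \<in> carrier M; y \<in> carrier M\<rbrakk> \<Longrightarrow> c \<odot> (x \<oplus> y) = c \<odot> x \<oplus> c \<odot> y"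
  using smult_r_distr[of c x y] by simp

lemma smult_smult: "x \<in> carrier M \<Longrightarrow> c \<odot> (d \<odot> x) = (c * d) \<odot> x"
  using smult_assoc1[of c d x] by simp

lemma smult_1 [simp]: "x \<in> carrier M \<Longrightarrow> 1 \<odot> x = x"
  using smult_one[of x] by simp

lemma smult_0 [simp]: "x \<in> carrier M \<Longrightarrow> 0 \<odot> x = \<zero>"
  using smult_l_null[of x] by simp

lemma smult_zero [simp]: "c \<odot> \<zero> = \<zero>"
  using smult_r_null[of c] by simp

lemma smult_minus_1: "x \<in> carrier M \<Longrightarrow> (- 1) \<odot> x = \<ominus> x"
proof -
  assume x: "x \<in> carrier M"
  then have "(- 1) \<odot> x \<oplus> x = (- 1 + 1) \<odot> x" by (subst smult_add_left) auto
  then have "(- 1) \<odot> x \<oplus> x = \<zero>" using x by simp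
  then show ?thesis using x by (intro minus_equality[symmetric]) auto
qed

text \<open>Closure under negatives comes from the scalar -1.\<close>

lemma submodule_vspaceI:
  assumes "H \<subseteq> carrier M" "\<zero> \<in> H" "\<And>x y. \<lbrakk>x \<in> H; y \<in> H\<rbrakk> \<Longrightarrow> x \<oplus> y \<in> H"
    "\<And>c x. x \<in> H \<Longrightarrow> c \<odot> x \<in> H"
  shows "submodule H (scalar_field :: 'f ring) M"
  using assms smult_minus_1 by (intro submoduleI) (auto, metis subsetD)

lemma submodule_vspaceD:
  assumes "submodule H (scalar_field :: 'f ring) M"
  shows "H \<subseteq> carrier M" "\<zero> \<in> H" "\<And>x y. \<lbrakk>x \<in> H; y \<in> H\<rbrakk> \<Longrightarrow> x \<oplus> y \<in> H"
    "\<And>c x. x \<in> H \<Longrightarrow> c \<odot> x \<in> H"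
proof -
  show H: "H \<subseteq> carrier M" "\<And>x y. \<lbrakk>x \<in> H; y \<in> H\<rbrakk> \<Longrightarrow> x \<oplus> y \<in> H" "\<And>c x. x \<in> H \<Longrightarrow> c \<odot> x \<in> H"
    using submoduleE[OF assms] by auto
  obtain x where "x \<in> H" using submoduleE(2)[OF assms] by auto
  then show "\<zero> \<in> H" using H(1) H(3)[of x 0] by auto
qed

text \<open>Stated for a mere set that contains zero and is closed under addition, so that it also
  serves for sets of sums and for generated subgroups.\<close>

lemma finsum_mem:
  assumes "finite A" "\<zero> \<in> H" "H \<subseteq> carrier M" "\<And>x y. \<lbrakk>x \<in> H; y \<in> H\<rbrakk> \<Longrightarrow> x \<oplus> y \<in> H"
    and "\<And>a. a \<in> A \<Longrightarrow> f a \<in> H"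
  shows "finsum M f A \<in> H"
  using assms(1,5)
proof (induction rule: finite_induct)
  case (insert a A)
  then have "f \<in> insert a A \<rightarrow> carrier M" using assms(3) by auto
  then show ?case using insert assms(4) by (auto simp: Pi_def)
qed (use assms in auto)

lemma finsum_superset:
  assumes "finite B" "A \<subseteq> B" "\<And>a. a \<in> A \<Longrightarrow> f a \<in> carrier M" "\<And>b. b \<in> B - A \<Longrightarrow> f b = \<zero>"
  shows "finsum M f B = finsum M f A"
proof (rule add.finprod_mono_neutral_cong_left[symmetric])
  show "f \<in> B \<rightarrow> carrier M" using assms(3,4) by (metis DiffI Pi_I zero_closed)
qed (use assms in auto)

end

lemma linear_mapsI:
  assumes "f \<in> carrier M \<rightarrow>\<^sub>E carrier N"
    and "\<And>x y. \<lbrakk>x \<in> carrier M; y \<in> carrier M\<rbrakk> \<Longrightarrow> f (x \<oplus>\<^bsub>M\<^esub> y) = f x \<oplus>\<^bsub>N\<^esub> f y"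
    and "\<And>c x. x \<in> carrier M \<Longrightarrow> f (c \<odot>\<^bsub>M\<^esub> x) = c \<odot>\<^bsub>N\<^esub> f x"
  shows "f \<in> linear_maps M N"
  using assms by (simp add: linear_maps_def)

lemma linear_maps_extensional: "f \<in> linear_maps M N \<Longrightarrow> f \<in> carrier M \<rightarrow>\<^sub>E carrier N"
  by (simp add: linear_maps_def)

lemma linear_maps_closed: "\<lbrakk>f \<in> linear_maps M N; x \<in> carrier M\<rbrakk> \<Longrightarrow> f x \<in> carrier N"
  by (auto simp: linear_maps_def)

lemma linear_maps_add:
  "\<lbrakk>f \<in> linear_maps M N; x \<in> carrier M; y \<in> carrier M\<rbrakk> \<Longrightarrow> f (x \<oplus>\<^bsub>M\<^esub> y) = f x \<oplus>\<^bsub>N\<^esub> f y"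
  by (simp add: linear_maps_def)

lemma linear_maps_smult:
  "\<lbrakk>f \<in> linear_maps M N; x \<in> carrier M\<rbrakk> \<Longrightarrow> f (c \<odot>\<^bsub>M\<^esub> x) = c \<odot>\<^bsub>N\<^esub> f x"
  by (simp add: linear_maps_def)

lemma linear_maps_zero:
  assumes "f \<in> linear_maps M N" "vspace M" "vspace N"
  shows "f \<zero>\<^bsub>M\<^esub> = \<zero>\<^bsub>N\<^esub>"
proof -
  interpret M: vect M by (rule vect.intro) fact
  interpret N: vect N by (rule vect.intro) fact
  show ?thesis
    using linear_maps_smult[OF assms(1), of "\<zero>\<^bsub>M\<^esub>" 0] linear_maps_closed[OF assms(1), of "\<zero>\<^bsub>M\<^esub>"] by simp
qed

lemma linear_maps_finsum:
  assumes "f \<in> linear_maps M N" "vspace M" "vspace N" "finite A" "\<And>a. a \<in> A \<Longrightarrow> g a \<in> carrier M"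
  shows "f (finsum M g A) = finsum N (\<lambda>a. f (g a)) A"
proof -
  interpret M: vect M by (rule vect.intro) fact
  interpret N: vect N by (rule vect.intro) fact
  show ?thesis using assms(4,5)
  proof (induction rule: finite_induct)
    case empty
    then show ?case using linear_maps_zero[OF assms(1-3)] by simp
  next
    case (insert a A)
    then have "f \<in> carrier M \<rightarrow> carrier N" using linear_maps_closed[OF assms(1)] by auto
    with insert show ?case by (simp add: Pi_def linear_maps_add[OF assms(1)])
  qed
qed

lemma linear_maps_compose:
  assumes "f \<in> linear_maps M N" "g \<in> linear_maps N K" "vspace M"
  shows "compose (carrier M) g f \<in> linear_maps M K"
proof -
  interpret M: vect M by (rule vect.intro) fact
  show ?thesis
    using assms(1,2) by (intro linear_mapsI)
      (auto simp: compose_def linear_maps_closed linear_maps_add linear_maps_smult)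
qed

lemma linear_maps_id:
  assumes "vspace M"
  shows "(\<lambda>x\<in>carrier M. x) \<in> linear_maps M M"
proof -
  interpret M: vect M by (rule vect.intro) fact
  show ?thesis by (auto simp: linear_maps_def)
qed

lemma linear_maps_eqI:
  assumes "f \<in> linear_maps M N" "g \<in> linear_maps M N" "\<And>x. x \<in> carrier M \<Longrightarrow> f x = g x"
  shows "f = g"
  using assms by (meson PiE_ext linear_maps_extensional)

lemma linear_maps_inverse:
  assumes f: "f \<in> linear_maps M N" and bij: "bij_betw f (carrier M) (carrier N)" and "vspace M" "vspace N"
  shows "(\<lambda>y\<in>carrier N. the_inv_into (carrier M) f y) \<in> linear_maps N M"
proof -
  interpret M: vect M by (rule vect.intro) fact
  interpret N: vect N by (rule vect.intro) fact
  let ?g = "the_inv_into (carrier M) f"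
  have g: "?g y \<in> carrier M" "f (?g y) = y" if "y \<in> carrier N" for y
    using bij that bij_betwE[OF bij_betw_the_inv_into[OF bij]] by (auto simp: f_the_inv_into_f_bij_betw)
  have gf: "?g (f x) = x" if "x \<in> carrier M" for x
    using bij that by (simp add: bij_betw_def the_inv_into_f_f)
  have "?g (x \<oplus>\<^bsub>N\<^esub> y) = ?g x \<oplus>\<^bsub>M\<^esub> ?g y" if "x \<in> carrier N" "y \<in> carrier N" for x y
    using gf[of "?g x \<oplus>\<^bsub>M\<^esub> ?g y"] that g by (simp add: linear_maps_add[OF f])
  moreover have "?g (c \<odot>\<^bsub>N\<^esub> x) = c \<odot>\<^bsub>M\<^esub> ?g x" if "x \<in> carrier N" for c x
    using gf[of "c \<odot>\<^bsub>M\<^esub> ?g x"] that g by (simp add: linear_maps_smult[OF f])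
  ultimately show ?thesis using g by (auto simp: linear_maps_def)
qed

text \<open>The definition sums a total family over its exact support, and a linear map may shrink
  that support. Spanning and independence over arbitrary finite index sets can be checked along
  linear maps without tracking supports.\<close>

lemma int_graded_iff:
  fixes M :: "('f::field, 'u, 'z) module_scheme"
  assumes "vspace M"
  shows "int_graded M D \<longleftrightarrow> (\<forall>n. submodule (D n) (scalar_field :: 'f ring) M) \<and>
    (\<forall>x\<in>carrier M. \<exists>S c. finite S \<and> (\<forall>n\<in>S. c n \<in> D n) \<and> x = finsum M c S) \<and>
    (\<forall>S c. finite S \<longrightarrow> (\<forall>n\<in>S. c n \<in> D n) \<longrightarrow> finsum M c S = \<zero>\<^bsub>M\<^esub> \<longrightarrow> (\<forall>n\<in>S. c n = \<zero>\<^bsub>M\<^esub>))"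
    (is "?L \<longleftrightarrow> ?sub \<and> ?ex \<and> ?ind")
proof
  interpret M: vect M by (rule vect.intro) fact
  let ?dec = "\<lambda>x c. (\<forall>n. c n \<in> D n) \<and> finite {n. c n \<noteq> \<zero>\<^bsub>M\<^esub>} \<and> x = (\<Oplus>\<^bsub>M\<^esub>n\<in>{n. c n \<noteq> \<zero>\<^bsub>M\<^esub>}. c n)"
  \<comment> \<open>Padding by zero turns a family on \<open>S\<close> into a total one; this uses
    that zero lies in every \<open>D n\<close>.\<close>
  have dec: "?dec (finsum M c S) (\<lambda>n. if n \<in> S then c n else \<zero>\<^bsub>M\<^esub>)"
    if sub: ?sub and S: "finite S" "\<forall>n\<in>S. c n \<in> D n" for S c
  proof -
    let ?c = "\<lambda>n. if n \<in> S then c n else \<zero>\<^bsub>M\<^esub>"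
    have D: "D n \<subseteq> carrier M" "\<zero>\<^bsub>M\<^esub> \<in> D n" for n using M.submodule_vspaceD[of "D n"] sub by auto
    have fin: "finite {n. ?c n \<noteq> \<zero>\<^bsub>M\<^esub>}" by (rule finite_subset[OF _ S(1)]) auto
    have "finsum M c S = finsum M ?c S"
      using S D(1)[THEN subsetD] by (intro M.finsum_cong') auto
    also have "\<dots> = finsum M ?c {n. ?c n \<noteq> \<zero>\<^bsub>M\<^esub>}"
      using S D by (intro M.finsum_superset) auto
    finally show ?thesis using fin S D by auto
  qed
  {
    assume L: ?L
    then have sub: ?sub by (simp add: int_graded_def)
    have D: "D n \<subseteq> carrier M" "\<zero>\<^bsub>M\<^esub> \<in> D n" for n using M.submodule_vspaceD[of "D n"] sub by auto
    have ?ex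
    proof
      fix x assume "x \<in> carrier M"
      then obtain c where "?dec x c" using L unfolding int_graded_def by blast
      then show "\<exists>S c. finite S \<and> (\<forall>n\<in>S. c n \<in> D n) \<and> x = finsum M c S" by blast
    qed
    moreover have ?ind
    proof (intro allI impI)
      fix S c assume S: "finite S" "\<forall>n\<in>S. c n \<in> D n" "finsum M c S = \<zero>\<^bsub>M\<^esub>"
      \<comment> \<open>Zero is decomposed by the padded family and also by the zero family;
        uniqueness identifies the two.\<close>
      have 1: "?dec \<zero>\<^bsub>M\<^esub> (\<lambda>n. if n \<in> S then c n else \<zero>\<^bsub>M\<^esub>)" using dec[OF sub S(1,2)] S(3) by simp
      have 2: "?dec \<zero>\<^bsub>M\<^esub> (\<lambda>n. \<zero>\<^bsub>M\<^esub>)" using D by simp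
      have "\<exists>!c. ?dec \<zero>\<^bsub>M\<^esub> c" using L unfolding int_graded_def by blast
      then obtain e where e: "\<And>c. ?dec \<zero>\<^bsub>M\<^esub> c \<Longrightarrow> c = e" by (elim ex1E) blast
      have "(\<lambda>n. if n \<in> S then c n else \<zero>\<^bsub>M\<^esub>) = (\<lambda>n. \<zero>\<^bsub>M\<^esub>)"
        using e[OF 1] e[OF 2] by simp
      then show "\<forall>n\<in>S. c n = \<zero>\<^bsub>M\<^esub>" by meson
    qed
    ultimately show "?sub \<and> ?ex \<and> ?ind" using sub by blast
  }
  {
    assume R: "?sub \<and> ?ex \<and> ?ind"
    then have sub: ?sub and ex: ?ex by blast+
    from R have ind: "\<And>S c n. \<lbrakk>finite S; \<forall>n\<in>S. c n \<in> D n; finsum M c S = \<zero>\<^bsub>M\<^esub>; n \<in> S\<rbrakk> \<Longrightarrow> c n = \<zero>\<^bsub>M\<^esub>"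
      by blast
    have D: "D n \<subseteq> carrier M" "\<zero>\<^bsub>M\<^esub> \<in> D n" "x \<in> D n \<Longrightarrow> y \<in> D n \<Longrightarrow> x \<oplus>\<^bsub>M\<^esub> y \<in> D n"
       "x \<in> D n \<Longrightarrow> c \<odot>\<^bsub>M\<^esub> x \<in> D n" for n x y c
      using M.submodule_vspaceD[of "D n"] sub by auto
    have "\<exists>!c. ?dec x c" if x: "x \<in> carrier M" for x
    proof (rule ex_ex1I)
      from ex x obtain S c where "finite S" "\<forall>n\<in>S. c n \<in> D n" "x = finsum M c S" by blast
      then have "?dec x (\<lambda>n. if n \<in> S then c n else \<zero>\<^bsub>M\<^esub>)" using dec[OF sub, of S c] by blast
      then show "\<exists>c. ?dec x c" by (rule exI[of _ "\<lambda>n. if n \<in> S then c n else \<zero>\<^bsub>M\<^esub>"])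
    next
      fix c d assume c: "?dec x c" and d: "?dec x d"
      \<comment> \<open>The termwise difference over the union of both supports sums to zero, so
        independence makes every difference vanish. Subtraction is written with the scalar -1 to
        stay within the closure rules of a subspace.\<close>
      let ?S = "{n. c n \<noteq> \<zero>\<^bsub>M\<^esub>} \<union> {n. d n \<noteq> \<zero>\<^bsub>M\<^esub>}"
      have carr: "c n \<in> carrier M" "d n \<in> carrier M" for n using c d D(1) by blast+
      have "finsum M c ?S = x" using c carr by (subst M.finsum_superset[of _ "{n. c n \<noteq> \<zero>\<^bsub>M\<^esub>}"]) (auto simp: d)
      moreover have "finsum M d ?S = x" using d carr by (subst M.finsum_superset[of _ "{n. d n \<noteq> \<zero>\<^bsub>M\<^esub>}"]) (auto simp: c)
      moreover have "finsum M (\<lambda>n. c n \<oplus>\<^bsub>M\<^esub> (- 1) \<odot>\<^bsub>M\<^esub> d n) ?S = finsum M c ?S \<oplus>\<^bsub>M\<^esub> (- 1) \<odot>\<^bsub>M\<^esub> finsum M d ?S"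
        using c d carr by (subst M.finsum_smult_ldistr) (auto intro!: M.finsum_addf)
      ultimately have "finsum M (\<lambda>n. c n \<oplus>\<^bsub>M\<^esub> (- 1) \<odot>\<^bsub>M\<^esub> d n) ?S = \<zero>\<^bsub>M\<^esub>"
        using x by (simp add: M.smult_minus_1 M.r_neg)
      from ind[OF _ _ this] have *: "c n \<oplus>\<^bsub>M\<^esub> (- 1) \<odot>\<^bsub>M\<^esub> d n = \<zero>\<^bsub>M\<^esub>" if "n \<in> ?S" for n
        using c d D that by simp
      show "c = d"
      proof
        fix n show "c n = d n"
        proof (cases "n \<in> ?S")
          case True
          then show ?thesis using *[of n] carr[of n] M.minus_equality[of "d n" "\<ominus>\<^bsub>M\<^esub> c n"]
            by (metis M.minus_equality M.minus_minus M.smult_minus_1 M.a_inv_closed)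
        qed auto
      qed
    qed
    then show ?L using sub by (simp add: int_graded_def)
  }
qed

section \<open>Direct sums inside the universe\<close>

text \<open>A direct sum described by its injections and projections rather than by a carrier of
  functions. The same lemmas then cover the external sum, its copy inside \<open>'u\<close> and the
  family of corners of a module. The index set may be infinite, hence the explicit finite
  supports.\<close>

locale biproduct =
  fixes I :: "'i set" and R :: "'i \<Rightarrow> ('f::field, 'u) module" and N :: "('f, 'w, 'z) module_scheme"
    and emb :: "'i \<Rightarrow> 'u \<Rightarrow> 'w" and proj :: "'i \<Rightarrow> 'w \<Rightarrow> 'u"
  assumes vspace_summand: "i \<in> I \<Longrightarrow> vspace (R i)"
    and vspace_sum: "vspace N"
    and emb_linear: "i \<in> I \<Longrightarrow> emb i \<in> linear_maps (R i) N"
    and proj_linear: "i \<in> I \<Longrightarrow> proj i \<in> linear_maps N (R i)"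
    and proj_emb: "\<lbrakk>i \<in> I; x \<in> carrier (R i)\<rbrakk> \<Longrightarrow> proj i (emb i x) = x"
    and proj_emb_other: "\<lbrakk>i \<in> I; j \<in> I; i \<noteq> j; x \<in> carrier (R i)\<rbrakk> \<Longrightarrow> proj j (emb i x) = \<zero>\<^bsub>R j\<^esub>"
    and finite_support: "y \<in> carrier N \<Longrightarrow> finite {i \<in> I. proj i y \<noteq> \<zero>\<^bsub>R i\<^esub>}"
    and decomposition: "y \<in> carrier N \<Longrightarrow>
      y = finsum N (\<lambda>i. emb i (proj i y)) {i \<in> I. proj i y \<noteq> \<zero>\<^bsub>R i\<^esub>}"

lemma vspace_direct_sum:
  assumes R: "\<And>i. i \<in> I \<Longrightarrow> vspace (R i)"
  shows "vspace (direct_sum I R)"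
proof (rule vspaceI)
  let ?N = "direct_sum I R"
  have V: "vect (R i)" if "i \<in> I" for i using R[OF that] by (rule vect.intro)
  have [simp]: "\<zero>\<^bsub>R i\<^esub> \<in> carrier (R i)" "\<ominus>\<^bsub>R i\<^esub> \<zero>\<^bsub>R i\<^esub> = \<zero>\<^bsub>R i\<^esub>" "\<zero>\<^bsub>R i\<^esub> \<oplus>\<^bsub>R i\<^esub> \<zero>\<^bsub>R i\<^esub> = \<zero>\<^bsub>R i\<^esub>"
    "c \<odot>\<^bsub>R i\<^esub> \<zero>\<^bsub>R i\<^esub> = \<zero>\<^bsub>R i\<^esub>" if "i \<in> I" for i c
  proof -
    interpret vect "R i" by (rule V) fact
    show "\<zero>\<^bsub>R i\<^esub> \<in> carrier (R i)" "\<ominus>\<^bsub>R i\<^esub> \<zero>\<^bsub>R i\<^esub> = \<zero>\<^bsub>R i\<^esub>" "\<zero>\<^bsub>R i\<^esub> \<oplus>\<^bsub>R i\<^esub> \<zero>\<^bsub>R i\<^esub> = \<zero>\<^bsub>R i\<^esub>"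
      "c \<odot>\<^bsub>R i\<^esub> \<zero>\<^bsub>R i\<^esub> = \<zero>\<^bsub>R i\<^esub>" by simp_all
  qed
  have [simp]: "\<ominus>\<^bsub>R i\<^esub> x \<in> carrier (R i)" "c \<odot>\<^bsub>R i\<^esub> x \<in> carrier (R i)"
    "\<zero>\<^bsub>R i\<^esub> \<oplus>\<^bsub>R i\<^esub> x = x" "\<ominus>\<^bsub>R i\<^esub> x \<oplus>\<^bsub>R i\<^esub> x = \<zero>\<^bsub>R i\<^esub>" "1 \<odot>\<^bsub>R i\<^esub> x = x"
    and smult: "(c + d) \<odot>\<^bsub>R i\<^esub> x = c \<odot>\<^bsub>R i\<^esub> x \<oplus>\<^bsub>R i\<^esub> d \<odot>\<^bsub>R i\<^esub> x"
      "(c * d) \<odot>\<^bsub>R i\<^esub> x = c \<odot>\<^bsub>R i\<^esub> (d \<odot>\<^bsub>R i\<^esub> x)"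
    if "i \<in> I" "x \<in> carrier (R i)" for i x c d
  proof -
    interpret vect "R i" by (rule V) fact
    show "\<ominus>\<^bsub>R i\<^esub> x \<in> carrier (R i)" "c \<odot>\<^bsub>R i\<^esub> x \<in> carrier (R i)"
      "\<zero>\<^bsub>R i\<^esub> \<oplus>\<^bsub>R i\<^esub> x = x" "\<ominus>\<^bsub>R i\<^esub> x \<oplus>\<^bsub>R i\<^esub> x = \<zero>\<^bsub>R i\<^esub>" "1 \<odot>\<^bsub>R i\<^esub> x = x"
      "(c + d) \<odot>\<^bsub>R i\<^esub> x = c \<odot>\<^bsub>R i\<^esub> x \<oplus>\<^bsub>R i\<^esub> d \<odot>\<^bsub>R i\<^esub> x"
      "(c * d) \<odot>\<^bsub>R i\<^esub> x = c \<odot>\<^bsub>R i\<^esub> (d \<odot>\<^bsub>R i\<^esub> x)"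
      using that by (simp_all add: l_neg smult_add_left smult_smult)
  qed
  have [simp]: "x \<oplus>\<^bsub>R i\<^esub> y \<in> carrier (R i)" and comm: "x \<oplus>\<^bsub>R i\<^esub> y = y \<oplus>\<^bsub>R i\<^esub> x"
    and smult_add: "c \<odot>\<^bsub>R i\<^esub> (x \<oplus>\<^bsub>R i\<^esub> y) = c \<odot>\<^bsub>R i\<^esub> x \<oplus>\<^bsub>R i\<^esub> c \<odot>\<^bsub>R i\<^esub> y"
    if "i \<in> I" "x \<in> carrier (R i)" "y \<in> carrier (R i)" for i x y c
  proof -
    interpret vect "R i" by (rule V) fact
    show "x \<oplus>\<^bsub>R i\<^esub> y \<in> carrier (R i)" "x \<oplus>\<^bsub>R i\<^esub> y = y \<oplus>\<^bsub>R i\<^esub> x"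
      "c \<odot>\<^bsub>R i\<^esub> (x \<oplus>\<^bsub>R i\<^esub> y) = c \<odot>\<^bsub>R i\<^esub> x \<oplus>\<^bsub>R i\<^esub> c \<odot>\<^bsub>R i\<^esub> y"
      using that by (simp_all add: a_comm smult_add_right)
  qed
  have assoc: "x \<oplus>\<^bsub>R i\<^esub> y \<oplus>\<^bsub>R i\<^esub> z = x \<oplus>\<^bsub>R i\<^esub> (y \<oplus>\<^bsub>R i\<^esub> z)"
    if "i \<in> I" "x \<in> carrier (R i)" "y \<in> carrier (R i)" "z \<in> carrier (R i)" for i x y z
  proof -
    interpret vect "R i" by (rule V) fact
    show ?thesis using that by (simp add: a_assoc)
  qed
  have memD: "x i \<in> carrier (R i)" if "x \<in> carrier (?N)" "i \<in> I" for x i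
    using that by (auto simp: direct_sum_def)
  \<comment> \<open>\<open>S\<close> may be any finite set off which \<open>f\<close> vanishes: for
    a sum of two families the union of their supports is at hand, while the exact support depends on
    cancellation.\<close>
  have memI: "restrict f I \<in> carrier (?N)"
    if "\<And>i. i \<in> I \<Longrightarrow> f i \<in> carrier (R i)" "finite S" "\<And>i. \<lbrakk>i \<in> I; i \<notin> S\<rbrakk> \<Longrightarrow> f i = \<zero>\<^bsub>R i\<^esub>" for f S
  proof -
    have "finite {i \<in> I. f i \<noteq> \<zero>\<^bsub>R i\<^esub>}" using that(2,3) by (auto intro: finite_subset[of _ S])
    then show ?thesis using that(1) by (auto simp: direct_sum_def cong: conj_cong)
  qed
  have extI: "x = y" if "x \<in> carrier (?N)" "y \<in> carrier (?N)"
    "\<And>i. i \<in> I \<Longrightarrow> x i = y i" for x y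
    using that by (auto simp: direct_sum_def intro: PiE_ext)
  have ops: "(x \<oplus>\<^bsub>?N\<^esub> y) = (\<lambda>i\<in>I. x i \<oplus>\<^bsub>R i\<^esub> y i)" "(c \<odot>\<^bsub>?N\<^esub> x) = (\<lambda>i\<in>I. c \<odot>\<^bsub>R i\<^esub> x i)"
    "\<zero>\<^bsub>?N\<^esub> = (\<lambda>i\<in>I. \<zero>\<^bsub>R i\<^esub>)" for x y c
    by (simp_all add: direct_sum_def)
  have fin: "finite {i \<in> I. x i \<noteq> \<zero>\<^bsub>R i\<^esub>}" if "x \<in> carrier (?N)" for x
    using that by (simp add: direct_sum_def)
  have add_mem: "x \<oplus>\<^bsub>?N\<^esub> y \<in> carrier (?N)"
    if "x \<in> carrier (?N)" "y \<in> carrier (?N)" for x y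
    unfolding ops using that memD fin
    by (intro memI[of _ "{i \<in> I. x i \<noteq> \<zero>\<^bsub>R i\<^esub>} \<union> {i \<in> I. y i \<noteq> \<zero>\<^bsub>R i\<^esub>}"]) auto
  have zero_mem: "\<zero>\<^bsub>?N\<^esub> \<in> carrier (?N)"
    unfolding ops by (rule memI[of _ "{}"]) auto
  show smult_mem: "c \<odot>\<^bsub>?N\<^esub> x \<in> carrier (?N)"
    if "x \<in> carrier (?N)" for c x
    unfolding ops using that memD fin by (intro memI[of _ "{i \<in> I. x i \<noteq> \<zero>\<^bsub>R i\<^esub>}"]) auto
  have eval: "(x \<oplus>\<^bsub>?N\<^esub> y) i = x i \<oplus>\<^bsub>R i\<^esub> y i" "(c \<odot>\<^bsub>?N\<^esub> x) i = c \<odot>\<^bsub>R i\<^esub> x i"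
    "\<zero>\<^bsub>?N\<^esub> i = \<zero>\<^bsub>R i\<^esub>" if "i \<in> I" for x y c i
    using that by (simp_all add: ops)
  note mem = add_mem zero_mem smult_mem
  show "abelian_group (?N)"
  proof (rule abelian_groupI)
    fix x assume x: "x \<in> carrier (?N)"
    let ?y = "\<lambda>i\<in>I. \<ominus>\<^bsub>R i\<^esub> x i"
    have y: "?y \<in> carrier (?N)"
      using x memD fin by (intro memI[of _ "{i \<in> I. x i \<noteq> \<zero>\<^bsub>R i\<^esub>}"]) auto
    have "?y \<oplus>\<^bsub>?N\<^esub> x = \<zero>\<^bsub>?N\<^esub>"
      using x y by (intro extI mem) (auto simp: eval memD)
    with y show "\<exists>y\<in>carrier (?N). y \<oplus>\<^bsub>?N\<^esub> x = \<zero>\<^bsub>?N\<^esub>" by blast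
    fix y assume y: "y \<in> carrier (?N)"
    have "(x \<oplus>\<^bsub>?N\<^esub> y) i = (y \<oplus>\<^bsub>?N\<^esub> x) i" if "i \<in> I" for i
      using that x y by (simp add: eval comm memD)
    with x y show "x \<oplus>\<^bsub>?N\<^esub> y = y \<oplus>\<^bsub>?N\<^esub> x" by (intro extI mem)
  qed (auto intro!: extI mem simp: eval memD assoc)
  show "(c + d) \<odot>\<^bsub>?N\<^esub> x = c \<odot>\<^bsub>?N\<^esub> x \<oplus>\<^bsub>?N\<^esub> d \<odot>\<^bsub>?N\<^esub> x"
    "(c * d) \<odot>\<^bsub>?N\<^esub> x = c \<odot>\<^bsub>?N\<^esub> (d \<odot>\<^bsub>?N\<^esub> x)"
    "1 \<odot>\<^bsub>?N\<^esub> x = x" if "x \<in> carrier (?N)" for c d x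
    using that by (auto intro!: extI mem simp: eval memD smult)
  show "c \<odot>\<^bsub>?N\<^esub> (x \<oplus>\<^bsub>?N\<^esub> y) =
      c \<odot>\<^bsub>?N\<^esub> x \<oplus>\<^bsub>?N\<^esub> c \<odot>\<^bsub>?N\<^esub> y"
    if "x \<in> carrier (?N)" "y \<in> carrier (?N)" for c x y
    using that by (auto intro!: extI mem simp: eval memD smult_add)
qed

text \<open>Evaluation at \<open>i\<close> is linear, hence commutes with finite sums.\<close>

lemma finsum_direct_sum:
  assumes "\<And>i. i \<in> I \<Longrightarrow> vspace (R i)" "finite A" "\<And>a. a \<in> A \<Longrightarrow> f a \<in> carrier (direct_sum I R)" "i \<in> I"
  shows "finsum (direct_sum I R) f A i = finsum (R i) (\<lambda>a. f a i) A"
proof -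
  interpret N: vect "direct_sum I R" using vspace_direct_sum[OF assms(1)] by (rule vect.intro)
  interpret Ri: vect "R i" using assms(1,4) by (intro vect.intro)
  have "(\<lambda>x\<in>carrier (direct_sum I R). x i) \<in> linear_maps (direct_sum I R) (R i)"
    using assms(4) N.a_closed N.smult_mem by (intro linear_mapsI) (auto simp: direct_sum_def)
  from linear_maps_finsum[OF this N.vspace Ri.vspace assms(2), of f] assms(3)
  have "finsum (direct_sum I R) f A i = finsum (R i) (\<lambda>a. (\<lambda>x\<in>carrier (direct_sum I R). x i) (f a)) A"
    using N.finsum_closed[of f A] by (simp add: Pi_def)
  also have "\<dots> = finsum (R i) (\<lambda>a. f a i) A"
    using assms(3,4) by (intro Ri.finsum_cong') (auto simp: direct_sum_def)
  finally show ?thesis .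
qed

definition single_family :: "'i set \<Rightarrow> ('i \<Rightarrow> ('f, 'u) module) \<Rightarrow> 'i \<Rightarrow> 'u \<Rightarrow> 'i \<Rightarrow> 'u" where
  "single_family I R i = (\<lambda>x\<in>carrier (R i). \<lambda>j\<in>I. if j = i then x else \<zero>\<^bsub>R j\<^esub>)"

lemma biproduct_direct_sum:
  assumes R: "\<And>i. i \<in> I \<Longrightarrow> vspace (R i)"
  shows "biproduct I R (direct_sum I R) (single_family I R) (\<lambda>i. \<lambda>x\<in>carrier (direct_sum I R). x i)"
proof (rule biproduct.intro)
  let ?N = "direct_sum I R"
  have V: "vect (R i)" if "i \<in> I" for i using R[OF that] by (rule vect.intro)
  have mon: "abelian_monoid (R i)" if "i \<in> I" for i
    using R[OF that] by (simp add: Module.module_def abelian_group_def)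
  note [simp] = abelian_monoid.zero_closed[OF mon] abelian_monoid.l_zero[OF mon] abelian_monoid.a_closed[OF mon]
    vect.smult_mem[OF V] vect.smult_zero[OF V]
  interpret N: vect ?N using vspace_direct_sum[OF R] by (rule vect.intro)
  show "vspace (R i)" if "i \<in> I" for i by (rule R) fact
  show "vspace ?N" by (rule N.vspace)
  have single_mem: "single_family I R i x \<in> carrier ?N" if "i \<in> I" "x \<in> carrier (R i)" for i x
  proof -
    have "finite {j \<in> I. (if j = i then x else \<zero>\<^bsub>R j\<^esub>) \<noteq> \<zero>\<^bsub>R j\<^esub>}"
      by (rule finite_subset[of _ "{i}"]) auto
    then show ?thesis using that by (auto simp: single_family_def direct_sum_def cong: conj_cong)
  qed
  show "single_family I R i \<in> linear_maps (R i) ?N" if "i \<in> I" for i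
    using that single_mem[of i]
    by (intro linear_mapsI) (auto simp: single_family_def direct_sum_def restrict_def)
  show "(\<lambda>x\<in>carrier ?N. x i) \<in> linear_maps ?N (R i)" if "i \<in> I" for i
    using that N.smult_mem N.a_closed by (intro linear_mapsI) (auto simp: direct_sum_def)
  show "(\<lambda>x\<in>carrier ?N. x i) (single_family I R i x) = x" if "i \<in> I" "x \<in> carrier (R i)" for i x
    using single_mem[OF that] that by (simp add: single_family_def)
  show "(\<lambda>x\<in>carrier ?N. x j) (single_family I R i x) = \<zero>\<^bsub>R j\<^esub>"
    if "i \<in> I" "j \<in> I" "i \<noteq> j" "x \<in> carrier (R i)" for i j x
    using single_mem[of i x] that by (simp add: single_family_def)
  show fin: "finite {i \<in> I. (\<lambda>x\<in>carrier ?N. x i) x \<noteq> \<zero>\<^bsub>R i\<^esub>}" if "x \<in> carrier ?N" for x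
    using that by (simp add: direct_sum_def)
  fix x assume x: "x \<in> carrier ?N"
  let ?S = "{i \<in> I. x i \<noteq> \<zero>\<^bsub>R i\<^esub>}"
  have xi: "x i \<in> carrier (R i)" if "i \<in> I" for i using x that by (auto simp: direct_sum_def)
  have S: "finite ?S" using fin[OF x] x by simp
  have mem: "finsum ?N (\<lambda>i. single_family I R i (x i)) ?S \<in> carrier ?N"
    using single_mem xi by (intro N.finsum_closed) auto
  have "x = finsum ?N (\<lambda>i. single_family I R i (x i)) ?S"
  proof (rule PiE_ext)
    show "x \<in> (\<Pi>\<^sub>E i\<in>I. carrier (R i))" using x by (simp add: direct_sum_def)
    show "finsum ?N (\<lambda>i. single_family I R i (x i)) ?S \<in> (\<Pi>\<^sub>E i\<in>I. carrier (R i))"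
      using mem by (simp add: direct_sum_def)
    fix j assume j: "j \<in> I"
    interpret Rj: vect "R j" by (rule V) fact
    have "finsum ?N (\<lambda>i. single_family I R i (x i)) ?S j = finsum (R j) (\<lambda>i. single_family I R i (x i) j) ?S"
      using R S j single_mem xi by (intro finsum_direct_sum) auto
    \<comment> \<open>Only the summand with index \<open>j\<close> can be nonzero at
      \<open>j\<close>; the intersection is empty exactly when \<open>x j\<close> is zero, and then
      both sides are zero.\<close>
    also have "\<dots> = finsum (R j) (\<lambda>i. single_family I R i (x i) j) (?S \<inter> {j})"
      using j xi S by (intro Rj.finsum_superset) (auto simp: single_family_def)
    also have "\<dots> = x j" using j xi by (cases "x j = \<zero>\<^bsub>R j\<^esub>") (auto simp: single_family_def)
    finally show "x j = finsum ?N (\<lambda>i. single_family I R i (x i)) ?S j" by simp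
  qed
  then show "x = finsum ?N (\<lambda>i. single_family I R i ((\<lambda>x\<in>carrier ?N. x i) x))
      {i \<in> I. (\<lambda>x\<in>carrier ?N. x i) x \<noteq> \<zero>\<^bsub>R i\<^esub>}"
    using x by simp
qed

section \<open>Copying direct sums into the universe\<close>

definition transported :: "('u \<Rightarrow> 'w) \<Rightarrow> ('f, 'u) module \<Rightarrow> ('f, 'w) module" where
  "transported h M = \<lparr>carrier = h ` carrier M, mult = undefined, one = undefined, ring.zero = h \<zero>\<^bsub>M\<^esub>,
     add = (\<lambda>x y. h (the_inv_into (carrier M) h x \<oplus>\<^bsub>M\<^esub> the_inv_into (carrier M) h y)),
     smult = (\<lambda>c x. h (c \<odot>\<^bsub>M\<^esub> the_inv_into (carrier M) h x))\<rparr>"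

lemma vspace_transported:
  assumes "vspace M" and h: "inj_on h (carrier M)"
  shows "vspace (transported h M)"
    and "restrict h (carrier M) \<in> linear_maps M (transported h M)"
    and "bij_betw (restrict h (carrier M)) (carrier M) (carrier (transported h M))"
proof -
  interpret M: vect M by (rule vect.intro) fact
  have [simp]: "the_inv_into (carrier M) h (h x) = x" if "x \<in> carrier M" for x
    using h that by (rule the_inv_into_f_f)
  have "abelian_group (transported h M)"
    by (rule abelian_groupI)
      (auto simp: transported_def M.a_assoc M.a_comm M.a_lcomm M.r_neg
        intro!: bexI[of _ "\<ominus>\<^bsub>M\<^esub> x" for x])
  then show "vspace (transported h M)"
    by (rule vspaceI)
      (auto simp: transported_def M.smult_add_left M.smult_add_right M.smult_smult)
  show "restrict h (carrier M) \<in> linear_maps M (transported h M)"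
    by (rule linear_mapsI) (auto simp: transported_def)
  show "bij_betw (restrict h (carrier M)) (carrier M) (carrier (transported h M))"
    using h by (auto simp: transported_def bij_betw_def)
qed

text \<open>Injections are followed by the copying map and projections are preceded by its inverse.
  The axioms carry over because these two maps are linear and mutually inverse.\<close>

lemma biproduct_transported:
  assumes "biproduct I R N emb proj" and h: "inj_on h (carrier N)"
  shows "biproduct I R (transported h N) (\<lambda>i. compose (carrier (R i)) (restrict h (carrier N)) (emb i))
    (\<lambda>i. compose (carrier (transported h N)) (proj i)
      (\<lambda>y\<in>carrier (transported h N). the_inv_into (carrier N) (restrict h (carrier N)) y))"
proof -
  interpret B: biproduct I R N emb proj by fact
  interpret N: vect N using B.vspace_sum by (rule vect.intro)
  let ?N = "transported h N" and ?h = "restrict h (carrier N)"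
  let ?g = "\<lambda>y\<in>carrier ?N. the_inv_into (carrier N) ?h y"
  note tr = vspace_transported[OF N.vspace h]
  have g: "?g \<in> linear_maps ?N N" by (rule linear_maps_inverse[OF tr(2,3) N.vspace tr(1)])
  note hm = linear_maps_closed[OF tr(2)] note gm = linear_maps_closed[OF g]
  have gh: "?g (?h x) = x" if "x \<in> carrier N" for x
    unfolding restrict_apply'[OF hm[OF that]]
    by (rule the_inv_into_f_f[OF bij_betw_imp_inj_on[OF tr(3)] that])
  have hg: "?h (?g y) = y" if "y \<in> carrier ?N" for y
    using that f_the_inv_into_f_bij_betw[OF tr(3)] by simp
  show ?thesis
  proof (rule biproduct.intro)
    fix i assume i: "i \<in> I"
    then show "vspace (R i)" by (rule B.vspace_summand)
    show "compose (carrier (R i)) ?h (emb i) \<in> linear_maps (R i) ?N"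
      using i tr B.emb_linear B.vspace_summand by (intro linear_maps_compose)
    show "compose (carrier ?N) (proj i) ?g \<in> linear_maps ?N (R i)"
      using i g tr B.proj_linear by (intro linear_maps_compose)
    fix x assume x: "x \<in> carrier (R i)"
    then have mem: "emb i x \<in> carrier N" by (rule linear_maps_closed[OF B.emb_linear[OF i]])
    show "compose (carrier ?N) (proj i) ?g (compose (carrier (R i)) ?h (emb i) x) = x"
      using x i mem hm[OF mem] gh[OF mem] by (simp add: compose_eq B.proj_emb del: restrict_apply)
    fix j assume "j \<in> I" "i \<noteq> j"
    then show "compose (carrier ?N) (proj j) ?g (compose (carrier (R i)) ?h (emb i) x) = \<zero>\<^bsub>R j\<^esub>"
      using x i mem hm[OF mem] gh[OF mem] by (simp add: compose_eq B.proj_emb_other del: restrict_apply)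
  next
    show "vspace ?N" by (rule tr)
    fix y assume y: "y \<in> carrier ?N"
    let ?x = "?g y"
    have x: "?x \<in> carrier N" using gm y .
    have eq: "compose (carrier ?N) (proj i) ?g y = proj i ?x" for i using y by (simp add: compose_eq del: restrict_apply)
    show "finite {i \<in> I. compose (carrier ?N) (proj i) ?g y \<noteq> \<zero>\<^bsub>R i\<^esub>}"
      unfolding eq using B.finite_support[OF x] .
    let ?S = "{i \<in> I. proj i ?x \<noteq> \<zero>\<^bsub>R i\<^esub>}"
    have p: "proj i ?x \<in> carrier (R i)" if "i \<in> I" for i
      by (rule linear_maps_closed[OF B.proj_linear[OF that] x])
    have q: "emb i (proj i ?x) \<in> carrier N" if "i \<in> I" for i
      by (rule linear_maps_closed[OF B.emb_linear[OF that] p[OF that]])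
    have "y = ?h (finsum N (\<lambda>i. emb i (proj i ?x)) ?S)"
      by (rule trans[OF hg[OF y, symmetric] arg_cong[OF B.decomposition[OF x], of ?h]])
    also have "\<dots> = finsum ?N (\<lambda>i. ?h (emb i (proj i ?x))) ?S"
      using B.finite_support[OF x] q by (intro linear_maps_finsum[OF tr(2) N.vspace tr(1)]) auto
    also have "\<dots> = finsum ?N (\<lambda>i. compose (carrier (R i)) ?h (emb i) (proj i ?x)) ?S"
      using p q hm vect.intro[OF tr(1)]
      by (intro abelian_monoid.finsum_cong')
        (auto simp: compose_eq vect_def Module.module_def abelian_group_def simp del: restrict_apply)
    finally show "y = finsum ?N (\<lambda>i. compose (carrier (R i)) ?h (emb i) (compose (carrier ?N) (proj i) ?g y))
       {i \<in> I. compose (carrier ?N) (proj i) ?g y \<noteq> \<zero>\<^bsub>R i\<^esub>}"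
      unfolding eq .
  qed
qed

text \<open>A finitely supported family is encoded as a finite set of pairs, and an infinite set is
  equipotent to the set of its finite subsets.\<close>

lemma inj_direct_sum_universe:
  fixes R :: "'i \<Rightarrow> ('f::field, 'u) module"
  assumes "infinite (UNIV :: 'u set)" "I \<lesssim> (UNIV :: 'u set)"
  shows "\<exists>h :: ('i \<Rightarrow> 'u) \<Rightarrow> 'u. inj_on h (carrier (direct_sum I R))"
proof -
  obtain k :: "'i \<Rightarrow> 'u" where k: "inj_on k I" using assms(2) by (auto simp: lepoll_def)
  let ?enc = "\<lambda>x :: 'i \<Rightarrow> 'u. (\<lambda>i. (k i, x i)) ` {i \<in> I. x i \<noteq> \<zero>\<^bsub>R i\<^esub>}"
  have "(UNIV :: ('u \<times> 'u) set) \<approx> (UNIV :: 'u set)"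
    using card_of_Times_same_infinite[OF assms(1)] by (simp add: eqpoll_iff_card_of_ordIso)
  moreover have "Fpow (UNIV :: ('u \<times> 'u) set) \<approx> (UNIV :: ('u \<times> 'u) set)"
    using assms(1) by (intro eqpoll_Fpow) (simp add: finite_prod)
  ultimately have "Fpow (UNIV :: ('u \<times> 'u) set) \<approx> (UNIV :: 'u set)"
    using eqpoll_trans by blast
  then obtain c :: "('u \<times> 'u) set \<Rightarrow> 'u" where c: "inj_on c (Fpow UNIV)"
    unfolding eqpoll_def bij_betw_def by blast
  have "inj_on ?enc (carrier (direct_sum I R))"
  proof (rule inj_onI)
    fix x y assume xy: "x \<in> carrier (direct_sum I R)" "y \<in> carrier (direct_sum I R)" and eq: "?enc x = ?enc y"
    \<comment> \<open>A nonzero coordinate is recovered from the pair tagged by \<open>k i\<close>.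
      A zero coordinate leaves no pair, which is why the argument is applied in both
      directions.\<close>
    have *: "a i \<noteq> \<zero>\<^bsub>R i\<^esub> \<Longrightarrow> a i = b i" if "?enc a = ?enc b" "i \<in> I" for a b i
    proof -
      assume "a i \<noteq> \<zero>\<^bsub>R i\<^esub>"
      then have "(k i, a i) \<in> ?enc b" using that by blast
      then show "a i = b i" using k that(2) by (auto dest: inj_onD)
    qed
    have "x i = y i" if "i \<in> I" for i using *[OF eq that] *[OF eq[symmetric] that] by metis
    with xy show "x = y" by (auto simp: direct_sum_def intro: PiE_ext)
  qed
  moreover have "?enc ` carrier (direct_sum I R) \<subseteq> Fpow UNIV"
    by (auto simp: Fpow_def direct_sum_def)
  ultimately have "inj_on (c \<circ> ?enc) (carrier (direct_sum I R))"
    using c by (meson comp_inj_on inj_on_subset)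
  then show ?thesis by blast
qed

lemma biproduct_exists:
  fixes R :: "'i \<Rightarrow> ('f::field, 'u) module"
  assumes "infinite (UNIV :: 'u set)" "I \<lesssim> (UNIV :: 'u set)" "\<And>i. i \<in> I \<Longrightarrow> vspace (R i)"
  obtains N :: "('f, 'u) module" and emb proj where "biproduct I R N emb proj"
proof -
  obtain h :: "('i \<Rightarrow> 'u) \<Rightarrow> 'u" where h: "inj_on h (carrier (direct_sum I R))"
    using inj_direct_sum_universe[OF assms(1,2)] by blast
  show thesis
    by (rule that, rule biproduct_transported[OF biproduct_direct_sum[OF assms(3)] h])
qed

context biproduct
begin

sublocale sum: vect N by (rule vect.intro) (rule vspace_sum)

lemma proj_closed: "\<lbrakk>i \<in> I; y \<in> carrier N\<rbrakk> \<Longrightarrow> proj i y \<in> carrier (R i)"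
  by (rule linear_maps_closed[OF proj_linear])

lemma emb_closed: "\<lbrakk>i \<in> I; x \<in> carrier (R i)\<rbrakk> \<Longrightarrow> emb i x \<in> carrier N"
  by (rule linear_maps_closed[OF emb_linear])

lemma proj_zero: "i \<in> I \<Longrightarrow> proj i \<zero>\<^bsub>N\<^esub> = \<zero>\<^bsub>R i\<^esub>"
  by (rule linear_maps_zero[OF proj_linear vspace_sum vspace_summand])

lemma emb_zero: "i \<in> I \<Longrightarrow> emb i \<zero>\<^bsub>R i\<^esub> = \<zero>\<^bsub>N\<^esub>"
  by (rule linear_maps_zero[OF emb_linear vspace_summand vspace_sum])

text \<open>Elements with equal coordinates have equal supports, so their decompositions agree term
  by term. Equations in a direct sum are reduced to coordinates by this rule.\<close>

lemma eq_if_proj_eq: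
  assumes "x \<in> carrier N" "y \<in> carrier N" "\<And>i. i \<in> I \<Longrightarrow> proj i x = proj i y"
  shows "x = y"
proof -
  have "x = finsum N (\<lambda>i. emb i (proj i x)) {i \<in> I. proj i x \<noteq> \<zero>\<^bsub>R i\<^esub>}" by (rule decomposition) fact
  also have "\<dots> = finsum N (\<lambda>i. emb i (proj i y)) {i \<in> I. proj i y \<noteq> \<zero>\<^bsub>R i\<^esub>}"
    using assms by (intro sum.finsum_cong') (auto simp: emb_closed proj_closed)
  also have "\<dots> = y" by (rule decomposition[symmetric]) fact
  finally show ?thesis .
qed

lemma decomposition_superset:
  assumes "y \<in> carrier N" "finite F" "F \<subseteq> I" "\<And>i. i \<in> I - F \<Longrightarrow> proj i y = \<zero>\<^bsub>R i\<^esub>"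
  shows "y = finsum N (\<lambda>i. emb i (proj i y)) F"
proof -
  have "finsum N (\<lambda>i. emb i (proj i y)) F = finsum N (\<lambda>i. emb i (proj i y)) {i \<in> I. proj i y \<noteq> \<zero>\<^bsub>R i\<^esub>}"
    using assms by (intro sum.finsum_superset) (auto simp: emb_closed proj_closed emb_zero)
  then show ?thesis using decomposition[OF assms(1)] by simp
qed

lemma proj_finsum_emb:
  assumes "finite F" "F \<subseteq> I" "\<And>i. i \<in> F \<Longrightarrow> y i \<in> carrier (R i)" "j \<in> I"
  shows "proj j (finsum N (\<lambda>i. emb i (y i)) F) = (if j \<in> F then y j else \<zero>\<^bsub>R j\<^esub>)"
proof -
  interpret Rj: vect "R j" by (rule vect.intro) (rule vspace_summand, fact)
  have "proj j (finsum N (\<lambda>i. emb i (y i)) F) = finsum (R j) (\<lambda>i. proj j (emb i (y i))) F"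
    using assms emb_closed by (intro linear_maps_finsum[OF proj_linear vspace_sum vspace_summand]) auto
  also have "\<dots> = finsum (R j) (\<lambda>i. proj j (emb i (y i))) (F \<inter> {j})"
    using assms emb_closed by (intro Rj.finsum_superset) (auto simp: proj_closed proj_emb_other subset_iff)
  also have "\<dots> = (if j \<in> F then y j else \<zero>\<^bsub>R j\<^esub>)"
    using assms emb_closed by (auto simp: proj_closed proj_emb)
  finally show ?thesis .
qed

text \<open>The grading is taken coordinatewise. Spanning holds because the sums of homogeneous
  elements are closed under addition and contain every embedded summand; independence is checked in
  each coordinate.\<close>

lemma int_graded_sum:
  fixes D :: "'i \<Rightarrow> int \<Rightarrow> 'u set"
  assumes "\<And>i. i \<in> I \<Longrightarrow> int_graded (R i) (D i)"
  shows "int_graded N (\<lambda>n. {x \<in> carrier N. \<forall>i\<in>I. proj i x \<in> D i n})" (is "int_graded N ?G")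
proof -
  have sub: "submodule (D i n) (scalar_field :: 'f ring) (R i)"
    and ex: "x \<in> carrier (R i) \<Longrightarrow> \<exists>S c. finite S \<and> (\<forall>n\<in>S. c n \<in> D i n) \<and> x = finsum (R i) c S"
    and ind: "\<lbrakk>finite S; \<forall>n\<in>S. c n \<in> D i n; finsum (R i) c S = \<zero>\<^bsub>R i\<^esub>; n \<in> S\<rbrakk> \<Longrightarrow> c n = \<zero>\<^bsub>R i\<^esub>"
    if "i \<in> I" for i n x S c
    using assms[OF that] unfolding int_graded_iff[OF vspace_summand[OF that]] by blast+
  have D: "D i n \<subseteq> carrier (R i)" "\<zero>\<^bsub>R i\<^esub> \<in> D i n"
    "\<lbrakk>x \<in> D i n; y \<in> D i n\<rbrakk> \<Longrightarrow> x \<oplus>\<^bsub>R i\<^esub> y \<in> D i n" "x \<in> D i n \<Longrightarrow> c \<odot>\<^bsub>R i\<^esub> x \<in> D i n"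
    if "i \<in> I" for i n x y c
    using vect.submodule_vspaceD[OF vect.intro[OF vspace_summand[OF that]] sub[OF that]] by blast+
  have subG: "submodule (?G n) (scalar_field :: 'f ring) N" for n
    by (rule sum.submodule_vspaceI)
      (auto simp: proj_zero D linear_maps_add[OF proj_linear] linear_maps_smult[OF proj_linear])
  \<comment> \<open>The finite sums of homogeneous elements, which turn out to be all of
    \<open>N\<close>.\<close>
  let ?H = "{x \<in> carrier N. \<exists>S c. finite S \<and> (\<forall>n\<in>S. c n \<in> ?G n) \<and> x = finsum N c S}"
  note G = sum.submodule_vspaceD[OF subG]
  have H0: "\<zero>\<^bsub>N\<^esub> \<in> ?H" by (auto intro!: exI[of _ "{}"])
  have Gn: "?G n \<subseteq> ?H" for n
  proof
    fix x assume x: "x \<in> ?G n"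
    then have "finsum N (\<lambda>_. x) {n} = x" by simp
    with x show "x \<in> ?H" by (auto intro!: exI[of _ "{n}"] exI[of _ "\<lambda>_. x"])
  qed
  have Hadd: "x \<oplus>\<^bsub>N\<^esub> y \<in> ?H" if xy: "x \<in> ?H" "y \<in> ?H" for x y
  proof -
    obtain S c where S: "finite S" "\<forall>n\<in>S. c n \<in> ?G n" "x = finsum N c S" using xy by blast
    obtain T d where T: "finite T" "\<forall>n\<in>T. d n \<in> ?G n" "y = finsum N d T" using xy by blast
    \<comment> \<open>Both families are extended by zero to the union of their index sets, so that
      they can be added degree by degree.\<close>
    let ?c = "\<lambda>n. if n \<in> S then c n else \<zero>\<^bsub>N\<^esub>" and ?d = "\<lambda>n. if n \<in> T then d n else \<zero>\<^bsub>N\<^esub>"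
    have c: "?c n \<in> ?G n" "?d n \<in> ?G n" for n using S T G(2)[of n] by auto
    then have carr: "?c n \<in> carrier N" "?d n \<in> carrier N" for n using G(1)[of n] by blast+
    have "finsum N ?c (S \<union> T) = finsum N ?c S" "finsum N ?d (S \<union> T) = finsum N ?d T"
      using S T carr by (auto intro!: sum.finsum_superset)
    moreover have "finsum N ?c S = x" "finsum N ?d T = y"
      unfolding S(3) T(3) using S(2) T(2) by (auto intro!: sum.finsum_cong')
    ultimately have eq: "x \<oplus>\<^bsub>N\<^esub> y = finsum N (\<lambda>n. ?c n \<oplus>\<^bsub>N\<^esub> ?d n) (S \<union> T)"
      using carr by (subst sum.finsum_addf) auto
    have cd: "?c n \<oplus>\<^bsub>N\<^esub> ?d n \<in> ?G n" for n by (rule G(3)[OF c])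
    show ?thesis
    proof (rule CollectI, intro conjI exI)
      show "x \<oplus>\<^bsub>N\<^esub> y \<in> carrier N" using xy by simp
      show "finite (S \<union> T)" using S(1) T(1) by simp
      show "\<forall>n\<in>S \<union> T. ?c n \<oplus>\<^bsub>N\<^esub> ?d n \<in> ?G n" using cd by (rule ballI)
      show "x \<oplus>\<^bsub>N\<^esub> y = finsum N (\<lambda>n. ?c n \<oplus>\<^bsub>N\<^esub> ?d n) (S \<union> T)" by (rule eq)
    qed
  qed
  have Hsub: "?H \<subseteq> carrier N" by (rule Collect_restrict)
  have emb: "emb i x \<in> ?H" if i: "i \<in> I" and x: "x \<in> carrier (R i)" for i x
  proof -
    from ex[OF i x] obtain S c where S: "finite S" "\<forall>n\<in>S. c n \<in> D i n" "x = finsum (R i) c S" by blast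
    have c: "c n \<in> carrier (R i)" if "n \<in> S" for n using S(2) that D(1)[OF i] by blast
    have "emb i x = finsum N (\<lambda>n. emb i (c n)) S"
      unfolding S(3) by (rule linear_maps_finsum[OF emb_linear[OF i] vspace_summand[OF i] vspace_sum S(1) c])
    also have "\<dots> \<in> ?H"
    proof (rule sum.finsum_mem[OF S(1) H0 Hsub Hadd])
      fix n assume n: "n \<in> S"
      \<comment> \<open>Away from \<open>i\<close> the coordinate is zero, and zero has every
        degree.\<close>
      have "proj j (emb i (c n)) \<in> D j n" if "j \<in> I" for j
        using S(2) n c[OF n] i that D(2)[OF that]
        by (cases "j = i") (auto simp: proj_emb proj_emb_other)
      then have "emb i (c n) \<in> ?G n" using emb_closed[OF i c[OF n]] by blast
      then show "emb i (c n) \<in> ?H" using Gn by blast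
    qed
    finally show ?thesis .
  qed
  show ?thesis
    unfolding int_graded_iff[OF vspace_sum]
  proof (intro conjI allI ballI impI)
    show "submodule (?G n) (scalar_field :: 'f ring) N" for n by (rule subG)
  next
    fix x assume x: "x \<in> carrier N"
    have "finsum N (\<lambda>i. emb i (proj i x)) {i \<in> I. proj i x \<noteq> \<zero>\<^bsub>R i\<^esub>} \<in> ?H"
    proof (rule sum.finsum_mem[OF finite_support[OF x] H0 Hsub])
      show "a \<oplus>\<^bsub>N\<^esub> b \<in> ?H" if "a \<in> ?H" "b \<in> ?H" for a b using that by (rule Hadd)
      fix i assume "i \<in> {i \<in> I. proj i x \<noteq> \<zero>\<^bsub>R i\<^esub>}"
      then have i: "i \<in> I" by simp
      show "emb i (proj i x) \<in> ?H" by (rule emb[OF i proj_closed[OF i x]])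
    qed
    then have "x \<in> ?H" unfolding decomposition[OF x, symmetric] .
    then show "\<exists>S c. finite S \<and> (\<forall>n\<in>S. c n \<in> ?G n) \<and> x = finsum N c S" by (rule CollectE) (rule conjunct2)
  next
    fix S c n assume S: "finite S" "\<forall>n\<in>S. c n \<in> ?G n" "finsum N c S = \<zero>\<^bsub>N\<^esub>" "n \<in> S"
    show "c n = \<zero>\<^bsub>N\<^esub>"
    proof (rule eq_if_proj_eq)
      fix i assume i: "i \<in> I"
      have "finsum (R i) (\<lambda>n. proj i (c n)) S = proj i (finsum N c S)"
        using S by (intro linear_maps_finsum[OF proj_linear[OF i] vspace_sum vspace_summand[OF i], symmetric]) auto
      then have "finsum (R i) (\<lambda>n. proj i (c n)) S = \<zero>\<^bsub>R i\<^esub>" using S(3) proj_zero[OF i] by simp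
      then show "proj i (c n) = proj i \<zero>\<^bsub>N\<^esub>"
        using ind[OF i S(1) _ _ S(4), of "\<lambda>n. proj i (c n)"] S(2) i by (simp add: proj_zero)
    qed (use S in auto)
  qed
qed

end

text \<open>The direct sum of the maps \<open>\<phi> i\<close>. It is enough to sum over the support
  of \<open>x\<close> since every \<open>\<phi> i\<close> preserves zero; linearity is read off from
  the formula for the coordinates.\<close>

lemma biproduct_map:
  assumes B: "biproduct I R N emb proj" and B': "biproduct I R' N' emb' proj'"
    and \<phi>: "\<And>i. i \<in> I \<Longrightarrow> \<phi> i \<in> linear_maps (R i) (R' i)"
  defines "f \<equiv> (\<lambda>x\<in>carrier N. finsum N' (\<lambda>i. emb' i (\<phi> i (proj i x))) {i \<in> I. proj i x \<noteq> \<zero>\<^bsub>R i\<^esub>})"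
  shows "f \<in> linear_maps N N'"
    and "\<lbrakk>x \<in> carrier N; i \<in> I\<rbrakk> \<Longrightarrow> proj' i (f x) = \<phi> i (proj i x)"
proof -
  interpret B: biproduct I R N emb proj by fact
  interpret B': biproduct I R' N' emb' proj' by fact
  have \<phi>_closed: "\<phi> i x \<in> carrier (R' i)" if "i \<in> I" "x \<in> carrier (R i)" for i x
    using linear_maps_closed[OF \<phi>] that .
  have f_closed: "f x \<in> carrier N'" if "x \<in> carrier N" for x
    unfolding f_def using that by (auto intro!: B'.sum.finsum_closed B'.emb_closed \<phi>_closed B.proj_closed)
  show proj_f: "proj' i (f x) = \<phi> i (proj i x)" if x: "x \<in> carrier N" and i: "i \<in> I" for x i
  proof -
    have "proj' i (f x) = (if i \<in> {i \<in> I. proj i x \<noteq> \<zero>\<^bsub>R i\<^esub>} then \<phi> i (proj i x) else \<zero>\<^bsub>R' i\<^esub>)"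
      unfolding f_def restrict_apply' [OF x]
      using x i by (intro B'.proj_finsum_emb B.finite_support) (auto intro!: \<phi>_closed B.proj_closed)
    also have "\<dots> = \<phi> i (proj i x)"
      using i linear_maps_zero[OF \<phi>[OF i] B.vspace_summand[OF i] B'.vspace_summand[OF i]] by auto
    finally show ?thesis .
  qed
  show "f \<in> linear_maps N N'"
  proof (rule linear_mapsI)
    show "f \<in> carrier N \<rightarrow>\<^sub>E carrier N'" using f_closed by (auto simp: f_def)
    fix x assume x: "x \<in> carrier N"
    show "f (x \<oplus>\<^bsub>N\<^esub> y) = f x \<oplus>\<^bsub>N'\<^esub> f y" if y: "y \<in> carrier N" for y
      using x y by (intro B'.eq_if_proj_eq)
        (simp_all add: f_closed proj_f linear_maps_add[OF B.proj_linear] linear_maps_add[OF B'.proj_linear]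
          linear_maps_add[OF \<phi>] B.proj_closed)
    show "f (c \<odot>\<^bsub>N\<^esub> x) = c \<odot>\<^bsub>N'\<^esub> f x" for c
      using x by (intro B'.eq_if_proj_eq)
        (simp_all add: f_closed proj_f linear_maps_smult[OF B.proj_linear] linear_maps_smult[OF B'.proj_linear]
          linear_maps_smult[OF \<phi>] B.proj_closed)
  qed
qed

section \<open>The free algebra\<close>

lemma letters_zero [simp]: "letters 0 = []"
  by (simp add: zero_free_monoid_def)

lemma letters_add [simp]: "letters (u + w) = letters u @ letters w"
  by (simp add: plus_free_monoid_def)

lemma Wrd_eq_0_iff [simp]: "Wrd xs = 0 \<longleftrightarrow> xs = []"
  by (simp add: zero_free_monoid_def)

lemma add_eq_0_free_monoid [simp]: "u + w = 0 \<longleftrightarrow> u = 0 \<and> w = (0 :: 'a free_monoid)"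
  by (cases u; cases w) (simp add: plus_free_monoid_def)

lemma free_algebra_simps [simp]:
  "mult (free_algebra G) = (*)" "one (free_algebra G) = 1" "ring.zero (free_algebra G) = 0"
  "add (free_algebra G) = (+)"
  by (simp_all add: free_algebra_def)

lemma carrier_free_algebra:
  "p \<in> carrier (free_algebra G) \<longleftrightarrow> (\<forall>w\<in>Poly_Mapping.keys p. set (letters w) \<subseteq> G)"
  by (simp add: free_algebra_def)

lemma free_algebra_closed [simp]:
  fixes p q :: "('g, 'f::field) ncpoly"
  shows "0 \<in> carrier (free_algebra G :: ('g, 'f) ncpoly ring)" "1 \<in> carrier (free_algebra G :: ('g, 'f) ncpoly ring)"
  "Poly_Mapping.single 0 (c :: 'f) \<in> carrier (free_algebra G :: ('g, 'f) ncpoly ring)"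
  "p \<in> carrier (free_algebra G) \<Longrightarrow> - p \<in> carrier (free_algebra G)"
  "\<lbrakk>p \<in> carrier (free_algebra G); q \<in> carrier (free_algebra G)\<rbrakk> \<Longrightarrow> p + q \<in> carrier (free_algebra G)"
  "\<lbrakk>p \<in> carrier (free_algebra G); q \<in> carrier (free_algebra G)\<rbrakk> \<Longrightarrow> p - q \<in> carrier (free_algebra G)"
  "\<lbrakk>p \<in> carrier (free_algebra G); q \<in> carrier (free_algebra G)\<rbrakk> \<Longrightarrow> p * q \<in> carrier (free_algebra G)"
  "g \<in> G \<Longrightarrow> gen g \<in> carrier (free_algebra G :: ('g, 'f) ncpoly ring)"
proof -
  show "0 \<in> carrier (free_algebra G :: ('g, 'f) ncpoly ring)" "1 \<in> carrier (free_algebra G :: ('g, 'f) ncpoly ring)"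
    "Poly_Mapping.single 0 (c :: 'f) \<in> carrier (free_algebra G :: ('g, 'f) ncpoly ring)" "g \<in> G \<Longrightarrow> gen g \<in> carrier (free_algebra G :: ('g, 'f) ncpoly ring)"
    by (simp_all add: carrier_free_algebra gen_def)
  show neg: "- p \<in> carrier (free_algebra G)" if "p \<in> carrier (free_algebra G)" for p :: "('g, 'f) ncpoly"
    using that by (auto simp: carrier_free_algebra in_keys_iff)
  show add: "p + q \<in> carrier (free_algebra G)"
    if "p \<in> carrier (free_algebra G)" "q \<in> carrier (free_algebra G)" for p q :: "('g, 'f) ncpoly"
    using that keys_add[of p q] by (auto simp: carrier_free_algebra)
  show "p - q \<in> carrier (free_algebra G)"
    if "p \<in> carrier (free_algebra G)" "q \<in> carrier (free_algebra G)"
    using add[OF that(1) neg[OF that(2)]] by simp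
  show "p * q \<in> carrier (free_algebra G)"
    if pq: "p \<in> carrier (free_algebra G)" "q \<in> carrier (free_algebra G)"
    unfolding carrier_free_algebra
  proof
    fix w assume "w \<in> Poly_Mapping.keys (p * q)"
    then obtain u u' where "u \<in> Poly_Mapping.keys p" "u' \<in> Poly_Mapping.keys q" "w = u + u'"
      using keys_mult[of p q] by blast
    then show "set (letters w) \<subseteq> G" using pq by (auto simp: carrier_free_algebra)
  qed
qed

lemma free_algebra_sum_closed:
  "(\<And>x. x \<in> X \<Longrightarrow> f x \<in> carrier (free_algebra G)) \<Longrightarrow> sum f X \<in> carrier (free_algebra G)"
  by (induction X rule: infinite_finite_induct) auto

lemma ring_free_algebra: "ring (free_algebra G :: ('g, 'f::field) ncpoly ring)"
proof (rule ringI)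
  show "abelian_group (free_algebra G :: ('g, 'f) ncpoly ring)"
  proof (rule abelian_groupI)
    fix p :: "('g, 'f) ncpoly" assume "p \<in> carrier (free_algebra G)"
    then show "\<exists>q\<in>carrier (free_algebra G). q \<oplus>\<^bsub>free_algebra G\<^esub> p = \<zero>\<^bsub>free_algebra G\<^esub>"
      by (intro bexI[of _ "- p"]) auto
  qed (auto simp: algebra_simps)
  show "Group.monoid (free_algebra G :: ('g, 'f) ncpoly ring)"
    by (rule monoidI) (auto simp: algebra_simps)
qed (auto simp: algebra_simps)

lemma free_algebra_minus:
  assumes "p \<in> carrier (free_algebra G)" "q \<in> carrier (free_algebra G)"
  shows "p \<ominus>\<^bsub>free_algebra G\<^esub> q = p - q"
proof -
  interpret ring "free_algebra G" by (rule ring_free_algebra)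
  have "\<ominus>\<^bsub>free_algebra G\<^esub> q = - q" using assms by (intro minus_equality) auto
  then show ?thesis by (simp add: a_minus_def)
qed

lemma lookup_sum_zero: "(\<And>x. x \<in> X \<Longrightarrow> Poly_Mapping.lookup (f x) w = 0) \<Longrightarrow> Poly_Mapping.lookup (sum f X) w = 0"
  by (simp add: lookup_sum)

text \<open>Induction on the support, splitting off one monomial at a time. The predicate
  \<open>A\<close> restricts the words and later confines polynomials to the generators of the
  digraph.\<close>

lemma ncpoly_induct [consumes 1, case_names zero add single]:
  fixes p :: "('g, 'f::field) ncpoly"
  assumes "\<forall>w\<in>Poly_Mapping.keys p. A w"
    and "Q 0"
    and "\<And>p q. \<lbrakk>\<forall>w\<in>Poly_Mapping.keys p. A w; \<forall>w\<in>Poly_Mapping.keys q. A w; Q p; Q q\<rbrakk> \<Longrightarrow> Q (p + q)"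
    and "\<And>w c. \<lbrakk>A w\<rbrakk> \<Longrightarrow> Q (Poly_Mapping.single w c)"
  shows "Q p"
  using assms(1)
proof (induction "Poly_Mapping.keys p" arbitrary: p rule: infinite_finite_induct)
  case (insert w S)
  let ?c = "Poly_Mapping.lookup p w" and ?q = "p - Poly_Mapping.single w (Poly_Mapping.lookup p w)"
  have keys: "Poly_Mapping.keys ?q = S"
    using insert(2,4) by (auto simp: in_keys_iff lookup_minus lookup_single when_def split: if_splits)
  have "Q ?q" using insert keys by (intro insert(3)) auto
  moreover have "Q (Poly_Mapping.single w ?c)" using insert by (intro assms(4)) auto
  ultimately have "Q (?q + Poly_Mapping.single w ?c)"
    using insert keys by (intro assms(3)) (auto split: if_splits)
  then show ?case by simp
next
  case empty
  then have "p = 0" by (metis keys_eq_empty)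
  then show ?case using assms(2) by simp
qed simp

section \<open>Polynomials without constant term\<close>

definition augmentation_ideal :: "'g set \<Rightarrow> ('g, 'f::field) ncpoly set" where
  "augmentation_ideal G = {p \<in> carrier (free_algebra G). Poly_Mapping.lookup p 0 = 0}"

text \<open>The empty word factors only into two empty words.\<close>

lemma lookup_mult_zero:
  fixes p q :: "('g, 'f::field) ncpoly"
  assumes "Poly_Mapping.lookup q 0 = 0"
  shows "Poly_Mapping.lookup (p * q) 0 = 0"
proof -
  have "0 \<notin> Poly_Mapping.keys (p * q)"
    using keys_mult[of p q] assms by (auto simp: in_keys_iff dest!: subsetD)
  then show ?thesis by (simp add: in_keys_iff)
qed

lemma augmentation_ideal_closed:
  "p \<in> augmentation_ideal G \<Longrightarrow> p \<in> carrier (free_algebra G)"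
  "0 \<in> augmentation_ideal G"
  "\<lbrakk>p \<in> augmentation_ideal G; q \<in> augmentation_ideal G\<rbrakk> \<Longrightarrow> p + q \<in> augmentation_ideal G"
  "\<lbrakk>p \<in> carrier (free_algebra G); q \<in> augmentation_ideal G\<rbrakk> \<Longrightarrow> p * q \<in> augmentation_ideal G"
  "g \<in> G \<Longrightarrow> gen g \<in> augmentation_ideal G"
  by (auto simp: augmentation_ideal_def lookup_add lookup_mult_zero gen_def[of g] lookup_single)
    (simp_all add: carrier_free_algebra)

text \<open>Words grow by appending letters on the right, to match a right action, in which the last
  letter acts last. Scalars enter through words of one letter, as constants do not belong to this
  ideal.\<close>

lemma augmentation_ideal_induct [consumes 1, case_names zero add gen mult_gen]:
  fixes p :: "('g, 'f::field) ncpoly"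
  assumes p: "p \<in> augmentation_ideal G"
    and zero: "Q 0"
    and add: "\<And>p q. \<lbrakk>p \<in> augmentation_ideal G; q \<in> augmentation_ideal G; Q p; Q q\<rbrakk> \<Longrightarrow> Q (p + q)"
    and gen: "\<And>c g. g \<in> G \<Longrightarrow> Q (Poly_Mapping.single 0 c * gen g)"
    and mult_gen: "\<And>p g. \<lbrakk>p \<in> augmentation_ideal G; Q p; g \<in> G\<rbrakk> \<Longrightarrow> Q (p * gen g)"
  shows "Q p"
proof -
  have aug: "p \<in> augmentation_ideal G \<longleftrightarrow> (\<forall>w\<in>Poly_Mapping.keys p. set (letters w) \<subseteq> G \<and> w \<noteq> 0)"
    for p :: "('g, 'f) ncpoly"
    by (auto simp: augmentation_ideal_def carrier_free_algebra in_keys_iff)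
  have word: "Q (Poly_Mapping.single (Wrd xs) c)" if "xs \<noteq> []" "set xs \<subseteq> G" for xs c
    using that
  proof (induction xs rule: rev_nonempty_induct)
    case (single g)
    have "Poly_Mapping.single (Wrd [g]) c = Poly_Mapping.single 0 c * gen g"
      by (simp add: gen_def mult_single)
    then show ?case using single gen by simp
  next
    case (snoc g xs)
    have "Poly_Mapping.single (Wrd (xs @ [g])) c = Poly_Mapping.single (Wrd xs) c * gen g"
      by (simp add: gen_def mult_single plus_free_monoid_def)
    moreover have "Poly_Mapping.single (Wrd xs) c \<in> augmentation_ideal G"
      using snoc by (auto simp: aug)
    ultimately show ?case using snoc mult_gen by auto
  qed
  from p show ?thesis unfolding aug
  proof (induction p rule: ncpoly_induct)
    case (single w c)
    then show ?case using word[of "letters w" c] assms by (cases w) auto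
  qed (use zero add aug in auto)
qed

section \<open>The Leavitt path algebra and its generators acting on a vector space\<close>

context finitely_separated_digraph
begin

lemma part_arcs: "\<lbrakk>X \<in> P; e \<in> X\<rbrakk> \<Longrightarrow> e \<in> arcs \<Gamma>"
  using partition_onD1[OF partition] by blast

lemma part_source_eq: "\<lbrakk>X \<in> P; e \<in> X\<rbrakk> \<Longrightarrow> part_source \<Gamma> X = tail \<Gamma> e"
  using same_source[of X] unfolding part_source_def by (metis (no_types, lifting) image_cong image_constant the_elem_eq ex_in_conv image_constant_conv)

lemma part_nonempty: "X \<in> P \<Longrightarrow> X \<noteq> {}"
  using partition_onD3[OF partition] by blast

lemma part_source_vert: "X \<in> P \<Longrightarrow> part_source \<Gamma> X \<in> verts \<Gamma>"
  using part_nonempty part_arcs part_source_eq by (metis ex_in_conv tail_in_verts)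

lemma part_exists: "e \<in> arcs \<Gamma> \<Longrightarrow> \<exists>X\<in>P. e \<in> X"
  using partition_onD1[OF partition] by blast

lemma part_unique: "\<lbrakk>X \<in> P; Y \<in> P; e \<in> X; e \<in> Y\<rbrakk> \<Longrightarrow> X = Y"
  using partition_onD2[OF partition] by (auto simp: disjoint_def)

lemma lpa_gens_simps [simp]:
  "Vertex v \<in> lpa_gens \<Gamma> \<longleftrightarrow> v \<in> verts \<Gamma>"
  "Arrow e \<in> lpa_gens \<Gamma> \<longleftrightarrow> e \<in> arcs \<Gamma>"
  "Ghost e \<in> lpa_gens \<Gamma> \<longleftrightarrow> e \<in> arcs \<Gamma>"
  by (auto simp: lpa_gens_def)

lemma lpa_relations_carrier:
  "(lpa_relations \<Gamma> P :: (('a, 'b) lpa_gen, 'f::field) ncpoly set) \<subseteq> carrier (free_algebra (lpa_gens \<Gamma>))"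
  by (auto simp: lpa_relations_def part_arcs part_source_vert intro!: free_algebra_closed free_algebra_sum_closed)

lemma lpa_ideal: "ideal (lpa_ideal \<Gamma> P :: (('a, 'b) lpa_gen, 'f::field) ncpoly set) (free_algebra (lpa_gens \<Gamma>))"
  unfolding lpa_ideal_def using ring_free_algebra lpa_relations_carrier by (rule ring.genideal_ideal)

lemma lpa_relations_ideal:
  "(r :: (('a, 'b) lpa_gen, 'f::field) ncpoly) \<in> lpa_relations \<Gamma> P \<Longrightarrow> r \<in> lpa_ideal \<Gamma> P"
  unfolding lpa_ideal_def
  using ring.genideal_self[OF ring_free_algebra lpa_relations_carrier] by blast

lemma lpa_coset_eq_iff:
  fixes p q :: "(('a, 'b) lpa_gen, 'f::field) ncpoly"
  assumes "p \<in> carrier (free_algebra (lpa_gens \<Gamma>))" "q \<in> carrier (free_algebra (lpa_gens \<Gamma>))"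
  shows "lpa_coset \<Gamma> P p = lpa_coset \<Gamma> P q \<longleftrightarrow> p - q \<in> lpa_ideal \<Gamma> P"
  using ring.quotient_eq_iff_same_a_r_cos[OF ring_free_algebra lpa_ideal assms]
  by (simp add: lpa_coset_def free_algebra_minus[OF assms])

lemma lpa_carrier:
  "carrier (leavitt_path_algebra \<Gamma> P :: ('f::field, ('a, 'b, 'f) lpa_elem) module) =
    lpa_coset \<Gamma> P ` augmentation_ideal (lpa_gens \<Gamma>)"
  by (auto simp: leavitt_path_algebra_def augmentation_ideal_def Let_def)

lemma lpa_ops:
  fixes p q :: "(('a, 'b) lpa_gen, 'f::field) ncpoly"
  assumes "p \<in> carrier (free_algebra (lpa_gens \<Gamma>))" "q \<in> carrier (free_algebra (lpa_gens \<Gamma>))"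
  shows "lpa_coset \<Gamma> P p \<oplus>\<^bsub>leavitt_path_algebra \<Gamma> P\<^esub> lpa_coset \<Gamma> P q = lpa_coset \<Gamma> P (p + q)"
    and "lpa_coset \<Gamma> P p \<otimes>\<^bsub>leavitt_path_algebra \<Gamma> P\<^esub> lpa_coset \<Gamma> P q = lpa_coset \<Gamma> P (p * q)"
proof -
  interpret ideal "lpa_ideal \<Gamma> P :: (('a, 'b) lpa_gen, 'f::field) ncpoly set" "free_algebra (lpa_gens \<Gamma>)"
    by (rule lpa_ideal)
  show "lpa_coset \<Gamma> P p \<oplus>\<^bsub>leavitt_path_algebra \<Gamma> P\<^esub> lpa_coset \<Gamma> P q = lpa_coset \<Gamma> P (p + q)"
    using a_rcos_sum[OF assms] by (simp add: leavitt_path_algebra_def Let_def FactRing_def lpa_coset_def)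
  show "lpa_coset \<Gamma> P p \<otimes>\<^bsub>leavitt_path_algebra \<Gamma> P\<^esub> lpa_coset \<Gamma> P q = lpa_coset \<Gamma> P (p * q)"
    using rcoset_mult_add[OF assms] by (simp add: leavitt_path_algebra_def Let_def FactRing_def lpa_coset_def)
qed

lemma lpa_smult:
  fixes p :: "(('a, 'b) lpa_gen, 'f::field) ncpoly"
  assumes "p \<in> carrier (free_algebra (lpa_gens \<Gamma>))"
  shows "c \<odot>\<^bsub>leavitt_path_algebra \<Gamma> P\<^esub> lpa_coset \<Gamma> P p = lpa_coset \<Gamma> P (Poly_Mapping.single 0 c * p)"
proof -
  interpret ideal "lpa_ideal \<Gamma> P :: (('a, 'b) lpa_gen, 'f::field) ncpoly set" "free_algebra (lpa_gens \<Gamma>)"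
    by (rule lpa_ideal)
  show ?thesis
    using rcoset_mult_add[OF free_algebra_closed(3) assms]
    by (simp add: leavitt_path_algebra_def Let_def FactRing_def lpa_coset_def)
qed

lemma lpa_coset_gen [simp, intro]:
  "g \<in> lpa_gens \<Gamma> \<Longrightarrow> lpa_coset \<Gamma> P (gen g) \<in> carrier (leavitt_path_algebra \<Gamma> P)"
  unfolding lpa_carrier by (auto intro: augmentation_ideal_closed)

text \<open>Tailored to the axioms of a right module: each case is met by the rule for sums, scalar
  multiples or products of the acting element, so a property of all products \<open>x a\<close> is
  reduced to generators.\<close>

lemma lpa_induct [consumes 1, case_names zero add gen mult_gen]:
  fixes a :: "('a, 'b, 'f::field) lpa_elem"
  assumes "a \<in> carrier (leavitt_path_algebra \<Gamma> P)"
    and zero: "Q (lpa_coset \<Gamma> P 0)"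
    and add: "\<And>a b. \<lbrakk>a \<in> carrier (leavitt_path_algebra \<Gamma> P); b \<in> carrier (leavitt_path_algebra \<Gamma> P); Q a; Q b\<rbrakk>
      \<Longrightarrow> Q (a \<oplus>\<^bsub>leavitt_path_algebra \<Gamma> P\<^esub> b)"
    and gen: "\<And>c g. g \<in> lpa_gens \<Gamma> \<Longrightarrow> Q (c \<odot>\<^bsub>leavitt_path_algebra \<Gamma> P\<^esub> lpa_coset \<Gamma> P (gen g))"
    and mult_gen: "\<And>a g. \<lbrakk>a \<in> carrier (leavitt_path_algebra \<Gamma> P); Q a; g \<in> lpa_gens \<Gamma>\<rbrakk>
      \<Longrightarrow> Q (a \<otimes>\<^bsub>leavitt_path_algebra \<Gamma> P\<^esub> lpa_coset \<Gamma> P (gen g))"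
  shows "Q a"
proof -
  obtain p where "a = lpa_coset \<Gamma> P p" and p: "p \<in> augmentation_ideal (lpa_gens \<Gamma>)"
    using assms(1) by (auto simp: lpa_carrier)
  from p have "Q (lpa_coset \<Gamma> P p)"
  proof (induction rule: augmentation_ideal_induct)
    case zero
    show ?case by (rule assms(2))
  next
    case (add p q)
    then show ?case
      using assms(3)[of "lpa_coset \<Gamma> P p" "lpa_coset \<Gamma> P q"]
        augmentation_ideal_closed(1)[OF add(1)] augmentation_ideal_closed(1)[OF add(2)]
      by (simp add: lpa_carrier lpa_ops)
  next
    case (gen c g)
    then show ?case using assms(4)[of g c] by (simp add: lpa_smult)
  next
    case (mult_gen p g)
    then show ?case using assms(5)[of "lpa_coset \<Gamma> P p" g] augmentation_ideal_closed(1)[OF mult_gen(1)]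
      by (simp add: lpa_carrier lpa_ops)
  qed
  then show ?thesis by (simp add: \<open>a = _\<close>)
qed

end

text \<open>Right actions are written inside out: \<open>act h (act g x)\<close> stands for
  \<open>x g h\<close>. Thus the assumption for (SCK1) applies \<open>Ghost e\<close> before
  \<open>Arrow f\<close>, and the one for (SCK2) applies \<open>Arrow e\<close> before
  \<open>Ghost e\<close>. The identities are the defining relations read as equations between
  operators, with no reference to the quotient algebra.\<close>

locale generator_module = finitely_separated_digraph \<Gamma> P + vect N
  for \<Gamma> :: "('v, 'e) pre_digraph" and P :: "'e set set"
    and N :: "('f::field, 'u, 'z) module_scheme" (structure) +
  fixes act :: "('v, 'e) lpa_gen \<Rightarrow> 'u \<Rightarrow> 'u"
  assumes act_closed: "\<lbrakk>g \<in> lpa_gens \<Gamma>; x \<in> carrier N\<rbrakk> \<Longrightarrow> act g x \<in> carrier N"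
    and act_add: "\<lbrakk>g \<in> lpa_gens \<Gamma>; x \<in> carrier N; y \<in> carrier N\<rbrakk> \<Longrightarrow> act g (x \<oplus> y) = act g x \<oplus> act g y"
    and act_smult: "\<lbrakk>g \<in> lpa_gens \<Gamma>; x \<in> carrier N\<rbrakk> \<Longrightarrow> act g (c \<odot> x) = c \<odot> act g x"
    and act_vertex_vertex: "\<lbrakk>v \<in> verts \<Gamma>; w \<in> verts \<Gamma>; x \<in> carrier N\<rbrakk>
      \<Longrightarrow> act (Vertex w) (act (Vertex v) x) = (if v = w then act (Vertex v) x else \<zero>)"
    and act_tail_arrow: "\<lbrakk>e \<in> arcs \<Gamma>; x \<in> carrier N\<rbrakk>
      \<Longrightarrow> act (Arrow e) (act (Vertex (tail \<Gamma> e)) x) = act (Arrow e) x"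
    and act_arrow_head: "\<lbrakk>e \<in> arcs \<Gamma>; x \<in> carrier N\<rbrakk>
      \<Longrightarrow> act (Vertex (head \<Gamma> e)) (act (Arrow e) x) = act (Arrow e) x"
    and act_head_ghost: "\<lbrakk>e \<in> arcs \<Gamma>; x \<in> carrier N\<rbrakk>
      \<Longrightarrow> act (Ghost e) (act (Vertex (head \<Gamma> e)) x) = act (Ghost e) x"
    and act_ghost_tail: "\<lbrakk>e \<in> arcs \<Gamma>; x \<in> carrier N\<rbrakk>
      \<Longrightarrow> act (Vertex (tail \<Gamma> e)) (act (Ghost e) x) = act (Ghost e) x"
    and act_ghost_arrow: "\<lbrakk>X \<in> P; e \<in> X; f \<in> X; x \<in> carrier N\<rbrakk>
      \<Longrightarrow> act (Arrow f) (act (Ghost e) x) = (if e = f then act (Vertex (head \<Gamma> e)) x else \<zero>)"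
    and act_arrow_ghost: "\<lbrakk>X \<in> P; x \<in> carrier N\<rbrakk>
      \<Longrightarrow> act (Vertex (part_source \<Gamma> X)) x = (\<Oplus>e\<in>X. act (Ghost e) (act (Arrow e) x))"

context right_module
begin

sublocale vect M by (rule vect.intro) (rule vspace)

end

text \<open>Polynomials that differ by a relation have the same coset and hence act alike, so each
  family of relations becomes one assumption of the locale.\<close>

lemma (in finitely_separated_digraph) generator_module_right_module:
  fixes M :: "('f::field, 'u, ('a, 'b, 'f) lpa_elem, 'z) rmod_scheme"
  assumes "right_module (leavitt_path_algebra \<Gamma> P) M"
  shows "generator_module \<Gamma> P M (\<lambda>g x. ract M x (lpa_coset \<Gamma> P (gen g)))"
proof -
  let ?L = "leavitt_path_algebra \<Gamma> P :: ('f, ('a, 'b, 'f) lpa_elem) module"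
  interpret M: right_module ?L M by fact
  let ?A = "free_algebra (lpa_gens \<Gamma>) :: (('a, 'b) lpa_gen, 'f) ncpoly ring"
  let ?c = "lpa_coset \<Gamma> P :: (('a, 'b) lpa_gen, 'f) ncpoly \<Rightarrow> _"
  let ?act = "\<lambda>g x. ract M x (?c (gen g))"
  note aug = augmentation_ideal_closed
  have mem: "?c p \<in> carrier ?L" if "p \<in> augmentation_ideal (lpa_gens \<Gamma>)" for p
    using that by (simp add: lpa_carrier)
  \<comment> \<open>The coset of 0 is its own multiple by the scalar 0.\<close>
  have zero: "ract M x (?c 0) = \<zero>\<^bsub>M\<^esub>" if x: "x \<in> carrier M" for x
    using M.ract_smult_right[OF x mem[OF aug(2)], of 0] M.ract_closed[OF x mem[OF aug(2)]]
    by (simp add: lpa_smult)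
  have two: "ract M x (?c (gen g * gen h)) = ?act h (?act g x)"
    if "x \<in> carrier M" "g \<in> lpa_gens \<Gamma>" "h \<in> lpa_gens \<Gamma>" for x g h
    using M.ract_mult[OF that(1) mem[OF aug(5)[OF that(2)]] mem[OF aug(5)[OF that(3)]]] that
    by (simp add: lpa_ops)
  \<comment> \<open>The sum in (SCK2) is formed among polynomials and passed to cosets afterwards,
    where additivity of the action handles one term at a time.\<close>
  have sum: "?c (sum p X) \<in> carrier ?L \<and> ract M x (?c (sum p X)) = finsum M (\<lambda>e. ract M x (?c (p e))) X"
    if x: "x \<in> carrier M" and X: "finite X" and p: "\<And>e. e \<in> X \<Longrightarrow> p e \<in> augmentation_ideal (lpa_gens \<Gamma>)" for x X p
    using X p
  proof (induction X rule: finite_induct)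
    case empty
    then show ?case using x mem[OF aug(2)] by (simp add: zero)
  next
    case (insert e X)
    then have e: "p e \<in> augmentation_ideal (lpa_gens \<Gamma>)" by simp
    have s: "sum p X \<in> augmentation_ideal (lpa_gens \<Gamma>)"
      using insert by (auto simp: augmentation_ideal_def intro!: free_algebra_sum_closed lookup_sum_zero)
    have "ract M x (?c (p e + sum p X)) = ract M x (?c (p e)) \<oplus>\<^bsub>M\<^esub> ract M x (?c (sum p X))"
      using M.ract_add_right[OF x mem[OF e] mem[OF s]] aug(1)[OF e] aug(1)[OF s] by (simp add: lpa_ops)
    moreover have "(\<lambda>e. ract M x (?c (p e))) \<in> X \<rightarrow> carrier M"
      using insert x mem by (auto intro!: M.ract_closed)
    moreover have "ract M x (?c (p e)) \<in> carrier M" using x mem e by (intro M.ract_closed)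
    ultimately show ?case using insert mem[OF aug(3)[OF e s]] by simp
  qed
  have eq: "?c p = ?c q" if "p - q \<in> lpa_relations \<Gamma> P" "p \<in> carrier ?A" "q \<in> carrier ?A" for p q
    using lpa_coset_eq_iff[OF that(2,3)] lpa_relations_ideal[OF that(1)] by simp
  show ?thesis
  proof (intro generator_module.intro generator_module_axioms.intro)
    show "finitely_separated_digraph \<Gamma> P" by unfold_locales
    show "vect M" by (rule M.vect_axioms)
  next
    fix g :: "('a, 'b) lpa_gen" and x y c assume g: "g \<in> lpa_gens \<Gamma>" and x: "x \<in> carrier M"
    show "?act g x \<in> carrier M" using x g by (simp add: M.ract_closed)
    show "?act g (c \<odot>\<^bsub>M\<^esub> x) = c \<odot>\<^bsub>M\<^esub> ?act g x" using x g by (simp add: M.ract_smult_left)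
    assume "y \<in> carrier M"
    then show "?act g (x \<oplus>\<^bsub>M\<^esub> y) = ?act g x \<oplus>\<^bsub>M\<^esub> ?act g y" using x g by (simp add: M.ract_add_left)
  next
    fix v w x assume v: "v \<in> verts \<Gamma>" "w \<in> verts \<Gamma>" and x: "x \<in> carrier M"
    have "?c (vtx v * vtx w) = ?c (if v = w then vtx v else 0)"
      using v by (intro eq) (auto simp: lpa_relations_def)
    then show "?act (Vertex w) (?act (Vertex v) x) = (if v = w then ?act (Vertex v) x else \<zero>\<^bsub>M\<^esub>)"
      using v x two[of x "Vertex v" "Vertex w"] by (auto simp: zero)
  next
    fix e x assume e: "e \<in> arcs \<Gamma>" and x: "x \<in> carrier M"
    have "?c (vtx (tail \<Gamma> e) * arr e) = ?c (arr e)" using e by (intro eq) (auto simp: lpa_relations_def)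
    then show "?act (Arrow e) (?act (Vertex (tail \<Gamma> e)) x) = ?act (Arrow e) x"
      using e x two[of x "Vertex (tail \<Gamma> e)" "Arrow e"] by simp
    have "?c (arr e * vtx (head \<Gamma> e)) = ?c (arr e)" using e by (intro eq) (auto simp: lpa_relations_def)
    then show "?act (Vertex (head \<Gamma> e)) (?act (Arrow e) x) = ?act (Arrow e) x"
      using e x two[of x "Arrow e" "Vertex (head \<Gamma> e)"] by simp
    have "?c (vtx (head \<Gamma> e) * gho e) = ?c (gho e)" using e by (intro eq) (auto simp: lpa_relations_def)
    then show "?act (Ghost e) (?act (Vertex (head \<Gamma> e)) x) = ?act (Ghost e) x"
      using e x two[of x "Vertex (head \<Gamma> e)" "Ghost e"] by simp
    have "?c (gho e * vtx (tail \<Gamma> e)) = ?c (gho e)" using e by (intro eq) (auto simp: lpa_relations_def)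
    then show "?act (Vertex (tail \<Gamma> e)) (?act (Ghost e) x) = ?act (Ghost e) x"
      using e x two[of x "Ghost e" "Vertex (tail \<Gamma> e)"] by simp
  next
    fix X e f x assume X: "X \<in> P" "e \<in> X" "f \<in> X" and x: "x \<in> carrier M"
    then have e: "e \<in> arcs \<Gamma>" "f \<in> arcs \<Gamma>" using part_arcs by auto
    have "?c (gho e * arr f) = ?c (if e = f then vtx (head \<Gamma> e) else 0)"
      using X e unfolding lpa_relations_def by (intro eq) (auto simp: lpa_relations_def)
    then show "?act (Arrow f) (?act (Ghost e) x) = (if e = f then ?act (Vertex (head \<Gamma> e)) x else \<zero>\<^bsub>M\<^esub>)"
      using e x two[of x "Ghost e" "Arrow f"] by (auto simp: zero)
  next
    fix X x assume X: "X \<in> P" and x: "x \<in> carrier M"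
    have e: "e \<in> arcs \<Gamma>" if "e \<in> X" for e using X that part_arcs by auto
    have fin: "finite X" using X by (rule finite_part)
    have mem2: "arr e * gho e \<in> augmentation_ideal (lpa_gens \<Gamma>)" if "e \<in> X" for e
      using e[OF that] by (intro aug) auto
    have "?c (vtx (part_source \<Gamma> X)) = ?c (\<Sum>e\<in>X. arr e * gho e)"
    proof (rule eq)
      show "vtx (part_source \<Gamma> X) - (\<Sum>e\<in>X. arr e * gho e) \<in> lpa_relations \<Gamma> P"
        using X fin unfolding lpa_relations_def by blast
      show "(\<Sum>e\<in>X. arr e * gho e) \<in> carrier ?A"
        using aug(1)[OF mem2] by (rule free_algebra_sum_closed)
      show "vtx (part_source \<Gamma> X) \<in> carrier ?A" using part_source_vert[OF X] by simp
    qed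
    then have "?act (Vertex (part_source \<Gamma> X)) x = (\<Oplus>\<^bsub>M\<^esub>e\<in>X. ract M x (?c (arr e * gho e)))"
      using sum[OF x fin mem2] by simp
    also have "\<dots> = (\<Oplus>\<^bsub>M\<^esub>e\<in>X. ?act (Ghost e) (?act (Arrow e) x))"
      using e x by (intro M.finsum_cong') (auto simp: two intro!: M.ract_closed)
    finally show "?act (Vertex (part_source \<Gamma> X)) x = (\<Oplus>\<^bsub>M\<^esub>e\<in>X. ?act (Ghost e) (?act (Arrow e) x))" .
  qed
qed

section \<open>From generators to modules\<close>

context generator_module
begin

text \<open>\<open>foldl\<close> makes the leftmost letter act before the others, as a right action
  demands.\<close>

definition word_act :: "('v, 'e) lpa_gen free_monoid \<Rightarrow> 'u \<Rightarrow> 'u" where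
  "word_act w x = foldl (\<lambda>y g. act g y) x (letters w)"

lemma word_act_0 [simp]: "word_act 0 x = x"
  by (simp add: word_act_def)

lemma word_act_gen [simp]: "word_act (Wrd [g]) x = act g x"
  by (simp add: word_act_def)

lemma word_act_plus: "word_act (u + w) x = word_act w (word_act u x)"
  by (simp add: word_act_def)

lemma word_act_linear:
  assumes "set (letters w) \<subseteq> lpa_gens \<Gamma>" "x \<in> carrier N"
  shows "word_act w x \<in> carrier N"
    and "word_act w (c \<odot> x) = c \<odot> word_act w x"
    and "y \<in> carrier N \<Longrightarrow> word_act w (x \<oplus> y) = word_act w x \<oplus> word_act w y"
proof -
  \<comment> \<open>The three claims share one induction with \<open>x\<close> and \<open>y\<close>
    generalised, because each letter replaces the elements acted upon.\<close>
  have "foldl (\<lambda>y g. act g y) x gs \<in> carrier N \<and>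
      foldl (\<lambda>y g. act g y) (c \<odot> x) gs = c \<odot> foldl (\<lambda>y g. act g y) x gs \<and>
      (y \<in> carrier N \<longrightarrow> foldl (\<lambda>y g. act g y) (x \<oplus> y) gs =
        foldl (\<lambda>y g. act g y) x gs \<oplus> foldl (\<lambda>y g. act g y) y gs)"
    if "set gs \<subseteq> lpa_gens \<Gamma>" for gs
    using assms(2) that
  proof (induction gs arbitrary: x y)
    case (Cons g gs)
    then show ?case by (simp add: act_closed act_smult act_add)
  qed simp
  from this[OF assms(1)] show "word_act w x \<in> carrier N"
    and "word_act w (c \<odot> x) = c \<odot> word_act w x"
    and "y \<in> carrier N \<Longrightarrow> word_act w (x \<oplus> y) = word_act w x \<oplus> word_act w y"
    by (auto simp: word_act_def)
qed

definition poly_act :: "(('v, 'e) lpa_gen, 'f) ncpoly \<Rightarrow> 'u \<Rightarrow> 'u" where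
  "poly_act p x = (\<Oplus>w\<in>Poly_Mapping.keys p. Poly_Mapping.lookup p w \<odot> word_act w x)"

abbreviation polys :: "(('v, 'e) lpa_gen, 'f) ncpoly set" where
  "polys \<equiv> carrier (free_algebra (lpa_gens \<Gamma>))"

lemma polys_word_act: "\<lbrakk>p \<in> polys; w \<in> Poly_Mapping.keys p; x \<in> carrier N\<rbrakk> \<Longrightarrow> word_act w x \<in> carrier N"
  by (auto simp: carrier_free_algebra intro: word_act_linear)

text \<open>Lets the sums for \<open>p\<close>, \<open>q\<close> and \<open>p + q\<close> run over
  one finite set, although cancellation may shrink the support of \<open>p + q\<close>.\<close>

lemma poly_act_superset:
  assumes "p \<in> polys" "x \<in> carrier N" "finite S" "Poly_Mapping.keys p \<subseteq> S"
  and "\<And>w. w \<in> S \<Longrightarrow> set (letters w) \<subseteq> lpa_gens \<Gamma>"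
  shows "poly_act p x = (\<Oplus>w\<in>S. Poly_Mapping.lookup p w \<odot> word_act w x)"
  unfolding poly_act_def
  using assms by (intro finsum_superset[symmetric]) (auto simp: word_act_linear in_keys_iff)

lemma poly_act_closed: "\<lbrakk>p \<in> polys; x \<in> carrier N\<rbrakk> \<Longrightarrow> poly_act p x \<in> carrier N"
  unfolding poly_act_def by (rule finsum_closed) (auto intro: polys_word_act)

lemma poly_act_zero [simp]: "poly_act 0 x = \<zero>"
  by (simp add: poly_act_def)

lemma poly_act_single:
  assumes "set (letters w) \<subseteq> lpa_gens \<Gamma>" "x \<in> carrier N"
  shows "poly_act (Poly_Mapping.single w c) x = c \<odot> word_act w x"
  using assms poly_act_superset[of "Poly_Mapping.single w c" x "{w}"]
  by (auto simp: carrier_free_algebra word_act_linear)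

lemma poly_act_plus:
  assumes "p \<in> polys" "q \<in> polys" "x \<in> carrier N"
  shows "poly_act (p + q) x = poly_act p x \<oplus> poly_act q x"
proof -
  let ?S = "Poly_Mapping.keys p \<union> Poly_Mapping.keys q"
  have S: "set (letters w) \<subseteq> lpa_gens \<Gamma>" if "w \<in> ?S" for w
    using assms that by (auto simp: carrier_free_algebra)
  have "poly_act (p + q) x = (\<Oplus>w\<in>?S. Poly_Mapping.lookup (p + q) w \<odot> word_act w x)"
    using assms S keys_add[of p q] by (intro poly_act_superset) auto
  also have "\<dots> = (\<Oplus>w\<in>?S. Poly_Mapping.lookup p w \<odot> word_act w x \<oplus> Poly_Mapping.lookup q w \<odot> word_act w x)"
    using S assms(3) by (intro finsum_cong') (auto simp: lookup_add smult_add_left word_act_linear)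
  also have "\<dots> = (\<Oplus>w\<in>?S. Poly_Mapping.lookup p w \<odot> word_act w x) \<oplus> (\<Oplus>w\<in>?S. Poly_Mapping.lookup q w \<odot> word_act w x)"
    using S assms(3) by (intro finsum_addf) (auto simp: word_act_linear)
  also have "\<dots> = poly_act p x \<oplus> poly_act q x"
    using assms S poly_act_superset[of p x ?S] poly_act_superset[of q x ?S] by simp
  finally show ?thesis .
qed

lemma polys_induct [consumes 1, case_names zero add single]:
  assumes "p \<in> polys" "Q 0"
    and "\<And>p q. \<lbrakk>p \<in> polys; q \<in> polys; Q p; Q q\<rbrakk> \<Longrightarrow> Q (p + q)"
    and "\<And>w c. set (letters w) \<subseteq> lpa_gens \<Gamma> \<Longrightarrow> Q (Poly_Mapping.single w c)"
  shows "Q p"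
proof (rule ncpoly_induct[where A = "\<lambda>w. set (letters w) \<subseteq> lpa_gens \<Gamma>"])
  show "\<forall>w\<in>Poly_Mapping.keys p. set (letters w) \<subseteq> lpa_gens \<Gamma>"
    using assms(1) by (simp add: carrier_free_algebra)
  show "Q (p + q)" if "\<forall>w\<in>Poly_Mapping.keys p. set (letters w) \<subseteq> lpa_gens \<Gamma>"
    "\<forall>w\<in>Poly_Mapping.keys q. set (letters w) \<subseteq> lpa_gens \<Gamma>" "Q p" "Q q" for p q
    using that by (intro assms(3)) (simp_all add: carrier_free_algebra)
qed (use assms in auto)

lemma poly_act_add:
  assumes "p \<in> polys" "x \<in> carrier N" "y \<in> carrier N"
  shows "poly_act p (x \<oplus> y) = poly_act p x \<oplus> poly_act p y"
  using assms(1)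
proof (induction p rule: polys_induct)
  case (add p q)
  have "poly_act p x \<in> carrier N" "poly_act p y \<in> carrier N" "poly_act q x \<in> carrier N" "poly_act q y \<in> carrier N"
    using add assms by (auto intro: poly_act_closed)
  then show ?case using add assms by (simp add: poly_act_plus a_ac)
qed (use assms in \<open>simp_all add: poly_act_single word_act_linear smult_add_right\<close>)

lemma poly_act_smult:
  assumes "p \<in> polys" "x \<in> carrier N"
  shows "poly_act p (c \<odot> x) = c \<odot> poly_act p x"
  using assms(1)
proof (induction p rule: polys_induct)
  case (add p q)
  then show ?case using assms by (simp add: poly_act_plus poly_act_closed smult_add_right)
qed (use assms in \<open>simp_all add: poly_act_single word_act_linear smult_smult mult.commute\<close>)

text \<open>Linearity in either factor reduces the claim to two monomials, where concatenating words
  means composing their actions, the left factor acting before the right one.\<close>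

lemma poly_act_mult:
  assumes "p \<in> polys" "q \<in> polys" "x \<in> carrier N"
  shows "poly_act (p * q) x = poly_act q (poly_act p x)"
  using assms(1)
proof (induction p rule: polys_induct)
  case zero
  show ?case using poly_act_smult[OF assms(2,3), of 0] poly_act_closed[OF assms(2,3)] assms(3) by simp
next
  case (add p r)
  then show ?case using assms
    by (simp add: distrib_right poly_act_plus poly_act_add poly_act_closed)
next
  case (single u c)
  have u: "Poly_Mapping.single u c \<in> polys" using single by (auto simp: carrier_free_algebra)
  from assms(2) show ?case
  proof (induction q rule: polys_induct)
    case (add q r)
    then show ?case using assms u by (simp add: distrib_left poly_act_plus poly_act_closed)
  next
    case (single w d)
    then show ?case using \<open>set (letters u) \<subseteq> _\<close> assms(3)
      by (simp add: mult_single poly_act_single word_act_plus word_act_linear smult_smult mult.commute)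
  qed simp
qed

lemma poly_act_gen: "\<lbrakk>g \<in> lpa_gens \<Gamma>; x \<in> carrier N\<rbrakk> \<Longrightarrow> poly_act (gen g) x = act g x"
  by (simp add: gen_def poly_act_single act_closed)

lemma poly_act_gen_gen:
  "\<lbrakk>g \<in> lpa_gens \<Gamma>; h \<in> lpa_gens \<Gamma>; x \<in> carrier N\<rbrakk> \<Longrightarrow> poly_act (gen g * gen h) x = act h (act g x)"
  by (simp add: poly_act_mult poly_act_gen act_closed)

lemma poly_act_uminus:
  assumes "p \<in> polys" "x \<in> carrier N"
  shows "poly_act (- p) x = \<ominus> poly_act p x"
  using poly_act_plus[of "- p" p x] assms by (intro minus_equality[symmetric]) (simp_all add: poly_act_closed)

lemma poly_act_minus:
  assumes "p \<in> polys" "q \<in> polys" "x \<in> carrier N"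
  shows "poly_act (p - q) x = poly_act p x \<oplus> \<ominus> poly_act q x"
  using poly_act_plus[of p "- q" x] assms by (simp add: poly_act_uminus)

lemma poly_act_diff_eqI:
  assumes "p \<in> polys" "q \<in> polys" "x \<in> carrier N" "poly_act p x = poly_act q x"
  shows "poly_act (p - q) x = \<zero>"
  using assms by (simp add: poly_act_minus poly_act_closed r_neg)

lemma poly_act_diff_eqD:
  assumes "p \<in> polys" "q \<in> polys" "x \<in> carrier N" "poly_act (p - q) x = \<zero>"
  shows "poly_act p x = poly_act q x"
  using poly_act_plus[of "p - q" q x] assms by (simp add: poly_act_closed)

lemma poly_act_sum:
  assumes "finite X" "\<And>e. e \<in> X \<Longrightarrow> p e \<in> polys" "x \<in> carrier N"
  shows "poly_act (sum p X) x = (\<Oplus>e\<in>X. poly_act (p e) x)"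
  using assms(1,2)
proof (induction X rule: finite_induct)
  case (insert e X)
  then show ?case using assms(3)
    by (auto simp: poly_act_plus free_algebra_sum_closed poly_act_closed Pi_def)
qed simp

lemma poly_act_relations:
  assumes "r \<in> lpa_relations \<Gamma> P" "x \<in> carrier N"
  shows "poly_act r x = \<zero>"
proof -
  note [simp] = poly_act_gen poly_act_gen_gen act_closed
  show ?thesis
    using assms(1) unfolding lpa_relations_def
  proof (elim UnE; (elim CollectE exE conjE)?)
    fix v w assume "r = vtx v * vtx w - (if v = w then vtx v else 0)" "v \<in> verts \<Gamma>" "w \<in> verts \<Gamma>"
    then show ?thesis using assms(2) by (auto intro!: poly_act_diff_eqI simp: act_vertex_vertex)
  next
    fix e assume "r = vtx (tail \<Gamma> e) * arr e - arr e" "e \<in> arcs \<Gamma>"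
    then show ?thesis using assms(2) by (auto intro!: poly_act_diff_eqI simp: act_tail_arrow)
  next
    fix e assume "r = arr e * vtx (head \<Gamma> e) - arr e" "e \<in> arcs \<Gamma>"
    then show ?thesis using assms(2) by (auto intro!: poly_act_diff_eqI simp: act_arrow_head)
  next
    fix e assume "r = vtx (head \<Gamma> e) * gho e - gho e" "e \<in> arcs \<Gamma>"
    then show ?thesis using assms(2) by (auto intro!: poly_act_diff_eqI simp: act_head_ghost)
  next
    fix e assume "r = gho e * vtx (tail \<Gamma> e) - gho e" "e \<in> arcs \<Gamma>"
    then show ?thesis using assms(2) by (auto intro!: poly_act_diff_eqI simp: act_ghost_tail)
  next
    fix e f X assume "r = gho e * arr f - (if e = f then vtx (head \<Gamma> e) else 0)" "X \<in> P" "e \<in> X" "f \<in> X"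
    then show ?thesis using assms(2) part_arcs[of X]
      by (auto intro!: poly_act_diff_eqI simp: act_ghost_arrow[of X])
  next
    fix X assume r: "r = vtx (part_source \<Gamma> X) - (\<Sum>e\<in>X. arr e * gho e)" "X \<in> P" "finite X"
    have arr: "e \<in> arcs \<Gamma>" if "e \<in> X" for e using r that part_arcs by blast
    have "poly_act (\<Sum>e\<in>X. arr e * gho e) x = (\<Oplus>e\<in>X. poly_act (arr e * gho e) x)"
      using r arr assms(2) by (intro poly_act_sum) auto
    also have "\<dots> = (\<Oplus>e\<in>X. act (Ghost e) (act (Arrow e) x))"
      using arr assms(2) by (intro finsum_cong') auto
    finally show ?thesis unfolding r(1) using r arr assms(2) part_source_vert
      by (intro poly_act_diff_eqI free_algebra_sum_closed) (auto simp: act_arrow_ghost)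
  qed
qed

text \<open>The polynomials that annihilate \<open>N\<close> form a two-sided ideal containing the
  relations, hence also the ideal that the relations generate.\<close>

lemma poly_act_ideal:
  assumes "p \<in> lpa_ideal \<Gamma> P" "x \<in> carrier N"
  shows "poly_act p x = \<zero>"
proof -
  let ?J = "{p \<in> polys. \<forall>x\<in>carrier N. poly_act p x = \<zero>}"
  interpret A: ring "free_algebra (lpa_gens \<Gamma>) :: (('v, 'e) lpa_gen, 'f) ncpoly ring" by (rule ring_free_algebra)
  have act_zero: "poly_act q \<zero> = \<zero>" if "q \<in> polys" for q
    using poly_act_smult[OF that zero_closed, of 0] poly_act_closed[OF that zero_closed] by simp
  have "ideal ?J (free_algebra (lpa_gens \<Gamma>))"
  proof (rule idealI)
    show "ring (free_algebra (lpa_gens \<Gamma>) :: (('v, 'e) lpa_gen, 'f) ncpoly ring)" by (rule ring_free_algebra)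
    show "subgroup ?J (add_monoid (free_algebra (lpa_gens \<Gamma>)))"
    proof (rule A.add.subgroupI)
      show "?J \<subseteq> carrier (free_algebra (lpa_gens \<Gamma>))" by blast
      have "0 \<in> ?J" by simp
      then show "?J \<noteq> {}" by blast
    next
      fix p assume p: "p \<in> ?J"
      then have "\<ominus>\<^bsub>free_algebra (lpa_gens \<Gamma>)\<^esub> p = - p"
        by (intro A.minus_equality) auto
      then show "\<ominus>\<^bsub>free_algebra (lpa_gens \<Gamma>)\<^esub> p \<in> ?J" using p by (simp add: poly_act_uminus)
    next
      fix p q assume "p \<in> ?J" "q \<in> ?J"
      then show "p \<oplus>\<^bsub>free_algebra (lpa_gens \<Gamma>)\<^esub> q \<in> ?J" by (simp add: poly_act_plus)
    qed
  next
    fix p q assume "p \<in> ?J" "q \<in> polys"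
    then show "q \<otimes>\<^bsub>free_algebra (lpa_gens \<Gamma>)\<^esub> p \<in> ?J" "p \<otimes>\<^bsub>free_algebra (lpa_gens \<Gamma>)\<^esub> q \<in> ?J"
      by (simp_all add: poly_act_mult act_zero poly_act_closed)
  qed
  moreover have "lpa_relations \<Gamma> P \<subseteq> ?J"
    using lpa_relations_carrier poly_act_relations by blast
  ultimately have "lpa_ideal \<Gamma> P \<subseteq> ?J"
    unfolding lpa_ideal_def by (rule A.genideal_minimal)
  then show ?thesis using assms by blast
qed

text \<open>An arbitrary representative is chosen; \<open>lpa_coset_eq_iff\<close> and
  \<open>poly_act_ideal\<close> make the choice immaterial.\<close>

definition coset_act :: "'u \<Rightarrow> ('v, 'e, 'f) lpa_elem \<Rightarrow> 'u" where
  "coset_act x a = poly_act (SOME p. p \<in> polys \<and> a = lpa_coset \<Gamma> P p) x"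

lemma coset_act:
  assumes "p \<in> polys" "x \<in> carrier N"
  shows "coset_act x (lpa_coset \<Gamma> P p) = poly_act p x"
proof -
  define q where "q = (SOME q. q \<in> polys \<and> lpa_coset \<Gamma> P p = lpa_coset \<Gamma> P q)"
  have q: "q \<in> polys \<and> lpa_coset \<Gamma> P p = lpa_coset \<Gamma> P q"
    unfolding q_def
    by (rule someI[of "\<lambda>q. q \<in> polys \<and> lpa_coset \<Gamma> P p = lpa_coset \<Gamma> P q" p]) (use assms(1) in simp)
  then have "q - p \<in> lpa_ideal \<Gamma> P" using lpa_coset_eq_iff[of q p] assms(1) by simp
  then have "poly_act q x = poly_act p x"
    using q assms by (intro poly_act_diff_eqD poly_act_ideal) auto
  then show ?thesis unfolding coset_act_def q_def .
qed

text \<open>Only fields of the record \<open>M\<close> are prescribed, so that one proof serves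
  modules with and without a grading.\<close>

lemma right_module_coset_act:
  fixes M :: "('f, 'u, ('v, 'e, 'f) lpa_elem, 'y) rmod_scheme"
  assumes "vspace M" "carrier M = carrier N" "add M = add N" "smult M = smult N" "ract M = coset_act"
  shows "right_module (leavitt_path_algebra \<Gamma> P) M"
proof (rule right_module.intro)
  show "vspace M" by (rule assms)
next
  fix x a assume "x \<in> carrier M" "a \<in> carrier (leavitt_path_algebra \<Gamma> P :: ('f, ('v, 'e, 'f) lpa_elem) module)"
  then obtain p where x: "x \<in> carrier N" and p: "p \<in> polys" "a = lpa_coset \<Gamma> P p"
    using assms(2) by (auto simp: lpa_carrier dest: augmentation_ideal_closed(1))
  have [simp]: "poly_act (Poly_Mapping.single 0 c) y = c \<odot> y" if "y \<in> carrier N" for c y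
    using that by (simp add: poly_act_single)
  show "ract M x a \<in> carrier M" using x p assms by (simp add: coset_act poly_act_closed)
  show "ract M (c \<odot>\<^bsub>M\<^esub> x) a = c \<odot>\<^bsub>M\<^esub> ract M x a" for c
    using x p assms by (simp add: coset_act poly_act_smult)
  show "ract M x (c \<odot>\<^bsub>leavitt_path_algebra \<Gamma> P\<^esub> a) = c \<odot>\<^bsub>M\<^esub> ract M x a" for c
    using x p assms by (simp add: coset_act lpa_smult poly_act_mult poly_act_smult)
  show "ract M (x \<oplus>\<^bsub>M\<^esub> y) a = ract M x a \<oplus>\<^bsub>M\<^esub> ract M y a" if "y \<in> carrier M" for y
    using x p assms that by (simp add: coset_act poly_act_add)
  fix b assume "b \<in> carrier (leavitt_path_algebra \<Gamma> P :: ('f, ('v, 'e, 'f) lpa_elem) module)"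
  then obtain q where q: "q \<in> polys" "b = lpa_coset \<Gamma> P q"
    by (auto simp: lpa_carrier dest: augmentation_ideal_closed(1))
  show "ract M x (a \<oplus>\<^bsub>leavitt_path_algebra \<Gamma> P\<^esub> b) = ract M x a \<oplus>\<^bsub>M\<^esub> ract M x b"
    using x p q assms by (simp add: coset_act lpa_ops poly_act_plus)
  show "ract M x (a \<otimes>\<^bsub>leavitt_path_algebra \<Gamma> P\<^esub> b) = ract M (ract M x a) b"
    using x p q assms by (simp add: coset_act lpa_ops poly_act_mult poly_act_closed)
qed

end

section \<open>Corners and condition (I)\<close>

text \<open>The subspace \<open>N v\<close>. A vertex acts idempotently, so its image is its set of
  fixed points, and the fixed-point equation gives a membership condition without an existential
  quantifier.\<close>

definition corner :: "('f::field, 'u, 'z) module_scheme \<Rightarrow> (('v, 'e) lpa_gen \<Rightarrow> 'u \<Rightarrow> 'u) \<Rightarrow> 'v \<Rightarrow> ('f, 'u) module" where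
  "corner N act v = \<lparr>carrier = {x \<in> carrier N. act (Vertex v) x = x}, mult = undefined, one = undefined,
     ring.zero = \<zero>\<^bsub>N\<^esub>, add = add N, smult = smult N\<rparr>"

definition corner_map :: "('v, 'e) pre_digraph \<Rightarrow> ('f::field, 'u, 'z) module_scheme \<Rightarrow>
    (('v, 'e) lpa_gen \<Rightarrow> 'u \<Rightarrow> 'u) \<Rightarrow> 'e \<Rightarrow> 'u \<Rightarrow> 'u" where
  "corner_map \<Gamma> N act e = (\<lambda>x\<in>carrier (corner N act (tail \<Gamma> e)). act (Arrow e) x)"

lemma corner_simps [simp]:
  "x \<in> carrier (corner N act v) \<longleftrightarrow> x \<in> carrier N \<and> act (Vertex v) x = x"
  "\<zero>\<^bsub>corner N act v\<^esub> = \<zero>\<^bsub>N\<^esub>" "add (corner N act v) = add N" "smult (corner N act v) = smult N"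
  by (simp_all add: corner_def)

context generator_module
begin

lemma act_zero: "g \<in> lpa_gens \<Gamma> \<Longrightarrow> act g \<zero> = \<zero>"
  using act_smult[of g \<zero> 0] act_closed[of g \<zero>] by simp

lemma act_finsum:
  assumes "g \<in> lpa_gens \<Gamma>" "finite A" "\<And>a. a \<in> A \<Longrightarrow> f a \<in> carrier N"
  shows "act g (finsum N f A) = (\<Oplus>a\<in>A. act g (f a))"
  using assms(2,3)
proof (induction A rule: finite_induct)
  case (insert a A)
  then have "f \<in> A \<rightarrow> carrier N" "(\<lambda>a. act g (f a)) \<in> A \<rightarrow> carrier N"
    using assms(1) by (auto simp: act_closed)
  with insert assms(1) show ?case by (simp add: act_add act_closed)
qed (use assms in \<open>simp add: act_zero\<close>)

lemma act_vertex_corner: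
  "\<lbrakk>v \<in> verts \<Gamma>; x \<in> carrier N\<rbrakk> \<Longrightarrow> act (Vertex v) x \<in> carrier (corner N act v)"
  by (simp add: act_closed act_vertex_vertex)

lemma act_arrow_corner:
  "\<lbrakk>e \<in> arcs \<Gamma>; x \<in> carrier N\<rbrakk> \<Longrightarrow> act (Arrow e) x \<in> carrier (corner N act (head \<Gamma> e))"
  by (simp add: act_closed act_arrow_head)

lemma act_ghost_corner:
  "\<lbrakk>e \<in> arcs \<Gamma>; x \<in> carrier N\<rbrakk> \<Longrightarrow> act (Ghost e) x \<in> carrier (corner N act (tail \<Gamma> e))"
  by (simp add: act_closed act_ghost_tail)

text \<open>Every generator ends at a vertex: an arrow at its head, a ghost arrow at the tail of its
  arrow. Hence any product whose last factor is a generator lies in a single corner.\<close>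

lemma act_corner:
  assumes "g \<in> lpa_gens \<Gamma>" "x \<in> carrier N"
  shows "\<exists>v\<in>verts \<Gamma>. act g x \<in> carrier (corner N act v)"
proof (cases g)
  case (Vertex v)
  then show ?thesis using assms act_vertex_corner by auto
next
  case (Arrow e)
  then show ?thesis using assms
    by (intro bexI[of _ "head \<Gamma> e"]) (simp_all add: act_arrow_corner del: corner_simps)
next
  case (Ghost e)
  then show ?thesis using assms
    by (intro bexI[of _ "tail \<Gamma> e"]) (simp_all add: act_ghost_corner del: corner_simps)
qed

lemma act_vertex_other:
  assumes "v \<in> verts \<Gamma>" "w \<in> verts \<Gamma>" "v \<noteq> w" "x \<in> carrier (corner N act v)"
  shows "act (Vertex w) x = \<zero>"
  using act_vertex_vertex[OF assms(1,2), of x] assms(3,4) by simp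

lemma vspace_corner:
  assumes "v \<in> verts \<Gamma>"
  shows "vspace (corner N act v)"
proof (rule vspaceI)
  have mem: "x \<oplus> y \<in> carrier (corner N act v)" "c \<odot> x \<in> carrier (corner N act v)" "\<zero> \<in> carrier (corner N act v)"
    if "x \<in> carrier (corner N act v)" "y \<in> carrier (corner N act v)" for x y c
    using that assms by (simp_all add: act_add act_smult act_zero)
  show "abelian_group (corner N act v)"
  proof (rule abelian_groupI)
    fix x assume x: "x \<in> carrier (corner N act v)"
    then have "(- 1) \<odot> x \<oplus> x = \<zero>" by (simp add: smult_minus_1 l_neg)
    then show "\<exists>y\<in>carrier (corner N act v). y \<oplus>\<^bsub>corner N act v\<^esub> x = \<zero>\<^bsub>corner N act v\<^esub>"
      using mem(2)[OF x x, of "- 1"] by (intro bexI[of _ "(- 1) \<odot> x"]) simp_all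
  qed (use assms in \<open>simp_all add: act_add act_zero a_ac\<close>)
qed (use assms in \<open>simp_all add: act_smult smult_add_left smult_add_right smult_smult\<close>)

lemma corner_inclusion_linear:
  assumes "v \<in> verts \<Gamma>"
  shows "(\<lambda>x\<in>carrier (corner N act v). x) \<in> linear_maps (corner N act v) N"
  using assms by (intro linear_mapsI) (auto simp: act_add act_smult)

text \<open>\<open>finsum\<close> depends on the record, so sums in a corner and in \<open>N\<close>
  have to be compared; the inclusion is linear and fixes each term.\<close>

lemma corner_finsum:
  assumes "v \<in> verts \<Gamma>" "finite A" "\<And>a. a \<in> A \<Longrightarrow> f a \<in> carrier (corner N act v)"
  shows "finsum (corner N act v) f A = finsum N f A"
proof -
  interpret C: vect "corner N act v" by (rule vect.intro) (rule vspace_corner, fact)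
  have "f \<in> A \<rightarrow> carrier (corner N act v)" using assms(3) by blast
  from C.finsum_closed[OF this] have "finsum (corner N act v) f A =
      (\<lambda>x\<in>carrier (corner N act v). x) (finsum (corner N act v) f A)" by simp
  also have "\<dots> = finsum N (\<lambda>a. (\<lambda>x\<in>carrier (corner N act v). x) (f a)) A"
    by (rule linear_maps_finsum[OF corner_inclusion_linear[OF assms(1)] C.vspace vspace assms(2,3)])
  also have "\<dots> = finsum N f A"
    using assms(3) by (intro finsum_cong') auto
  finally show ?thesis .
qed

lemma corner_map_linear:
  assumes "e \<in> arcs \<Gamma>"
  shows "corner_map \<Gamma> N act e \<in> linear_maps (corner N act (tail \<Gamma> e)) (corner N act (head \<Gamma> e))"
  using assms by (intro linear_mapsI)
    (auto simp: corner_map_def act_add act_smult act_closed act_arrow_head)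

lemma is_quiver_rep_corner:
  assumes "rspace \<rho> = corner N act" "rmap \<rho> = corner_map \<Gamma> N act"
  shows "is_quiver_rep \<Gamma> \<rho>"
  using assms vspace_corner corner_map_linear by (simp add: is_quiver_rep_def)

end

section \<open>Inverses of the map in (I)\<close>

context finitely_separated_digraph
begin

text \<open>The maps \<open>k e\<close> are the components of a two-sided inverse:
  \<open>right\<close> supplies preimages and \<open>left\<close> gives injectivity.\<close>

lemma condition_I_if_inverse:
  assumes \<rho>: "is_quiver_rep \<Gamma> \<rho>"
    and closed: "\<And>e y. \<lbrakk>e \<in> arcs \<Gamma>; y \<in> carrier (rspace \<rho> (head \<Gamma> e))\<rbrakk> \<Longrightarrow> k e y \<in> carrier (rspace \<rho> (tail \<Gamma> e))"
    and right: "\<And>X e f y. \<lbrakk>X \<in> P; e \<in> X; f \<in> X; y \<in> carrier (rspace \<rho> (head \<Gamma> e))\<rbrakk>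
      \<Longrightarrow> rmap \<rho> f (k e y) = (if e = f then y else \<zero>\<^bsub>rspace \<rho> (head \<Gamma> f)\<^esub>)"
    and left: "\<And>X x. \<lbrakk>X \<in> P; x \<in> carrier (rspace \<rho> (part_source \<Gamma> X))\<rbrakk>
      \<Longrightarrow> x = finsum (rspace \<rho> (part_source \<Gamma> X)) (\<lambda>e. k e (rmap \<rho> e x)) X"
  shows "condition_I \<Gamma> P \<rho>"
  unfolding condition_I_def Let_def
proof (intro ballI conjI)
  fix X assume X: "X \<in> P"
  let ?S = "rspace \<rho> (part_source \<Gamma> X)" and ?T = "direct_sum X (\<lambda>e. rspace \<rho> (head \<Gamma> e))"
  let ?\<theta> = "\<lambda>x\<in>carrier ?S. \<lambda>e\<in>X. rmap \<rho> e x"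
  have fin: "finite X" using X by (rule finite_part)
  have arc: "e \<in> arcs \<Gamma>" "tail \<Gamma> e = part_source \<Gamma> X" if "e \<in> X" for e
    using part_arcs part_source_eq X that by auto
  have V: "vspace (rspace \<rho> v)" if "v \<in> verts \<Gamma>" for v using \<rho> that by (simp add: is_quiver_rep_def)
  interpret S: vect ?S by (rule vect.intro[OF V[OF part_source_vert[OF X]]])
  have lin: "rmap \<rho> e \<in> linear_maps ?S (rspace \<rho> (head \<Gamma> e))" if "e \<in> X" for e
    using \<rho> arc[OF that] by (auto simp: is_quiver_rep_def)
  have k_closed: "k e z \<in> carrier ?S" if "e \<in> X" "z \<in> carrier (rspace \<rho> (head \<Gamma> e))" for e z
    using closed[of e z] arc[OF that(1)] that(2) by simp
  show "?\<theta> \<in> linear_maps ?S ?T"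
    using fin linear_maps_closed[OF lin] by (intro linear_mapsI)
      (auto simp: direct_sum_def linear_maps_add[OF lin] linear_maps_smult[OF lin] restrict_def fun_eq_iff)
  show "bij_betw ?\<theta> (carrier ?S) (carrier ?T)"
  proof (rule bij_betw_imageI)
    show "inj_on ?\<theta> (carrier ?S)"
    proof (rule inj_onI)
      fix x y assume xy: "x \<in> carrier ?S" "y \<in> carrier ?S" "?\<theta> x = ?\<theta> y"
      then have eq: "rmap \<rho> e x = rmap \<rho> e y" if "e \<in> X" for e using that by (auto dest: fun_cong[of _ _ e])
      have "x = finsum ?S (\<lambda>e. k e (rmap \<rho> e x)) X" by (rule left[OF X xy(1)])
      also have "\<dots> = finsum ?S (\<lambda>e. k e (rmap \<rho> e y)) X"
        using eq k_closed linear_maps_closed[OF lin xy(2)] by (intro S.finsum_cong') auto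
      also have "\<dots> = y" by (rule left[OF X xy(2), symmetric])
      finally show "x = y" .
    qed
    show "?\<theta> ` carrier ?S = carrier ?T"
    proof
      show "?\<theta> ` carrier ?S \<subseteq> carrier ?T"
        by (rule image_subsetI) (rule linear_maps_closed[OF \<open>?\<theta> \<in> linear_maps ?S ?T\<close>])
      show "carrier ?T \<subseteq> ?\<theta> ` carrier ?S"
      proof
        fix y assume y: "y \<in> carrier ?T"
        then have ye: "y e \<in> carrier (rspace \<rho> (head \<Gamma> e))" if "e \<in> X" for e
          using that by (auto simp: direct_sum_def)
        have ky: "k e (y e) \<in> carrier ?S" if "e \<in> X" for e by (rule k_closed[OF that ye[OF that]])
        \<comment> \<open>The preimage collects the contributions of all coordinates of
          \<open>y\<close>; by \<open>right\<close>, applying \<open>rmap \<rho> f\<close> keeps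
          only the contribution of \<open>f\<close>.\<close>
        let ?x = "finsum ?S (\<lambda>e. k e (y e)) X"
        have x: "?x \<in> carrier ?S" using ky by (intro S.finsum_closed) auto
        have "rmap \<rho> f ?x = y f" if f: "f \<in> X" for f
        proof -
          interpret T: vect "rspace \<rho> (head \<Gamma> f)" by (rule vect.intro) (rule V[OF head_in_verts[OF arc(1)[OF f]]])
          have "rmap \<rho> f ?x = finsum (rspace \<rho> (head \<Gamma> f)) (\<lambda>e. rmap \<rho> f (k e (y e))) X"
            using ky by (intro linear_maps_finsum[OF lin[OF f] S.vspace T.vspace fin])
          also have "\<dots> = finsum (rspace \<rho> (head \<Gamma> f)) (\<lambda>e. rmap \<rho> f (k e (y e))) {f}"
            using fin f right[OF X] ye by (intro T.finsum_superset) auto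
          also have "\<dots> = y f" using right[OF X f f ye[OF f]] ye[OF f] by simp
          finally show ?thesis .
        qed
        then have "?\<theta> ?x = y" using x y by (auto simp: direct_sum_def intro!: PiE_ext[of _ X])
        from this[symmetric] x show "y \<in> ?\<theta> ` carrier ?S" by (rule image_eqI)
      qed
    qed
  qed
qed

text \<open>The map for \<open>e\<close> is the injection of the summand \<open>e\<close> into the
  direct sum followed by the inverse of the map in (I). Evaluation at \<open>f\<close> yields the
  second property, and splitting the image of \<open>x\<close> into its coordinates yields the
  third.\<close>

lemma condition_I_inverse:
  assumes \<rho>: "is_quiver_rep \<Gamma> \<rho>" and I: "condition_I \<Gamma> P \<rho>"
  obtains k where
    "\<And>e. e \<in> arcs \<Gamma> \<Longrightarrow> k e \<in> linear_maps (rspace \<rho> (head \<Gamma> e)) (rspace \<rho> (tail \<Gamma> e))"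
    and "\<And>X e f y. \<lbrakk>X \<in> P; e \<in> X; f \<in> X; y \<in> carrier (rspace \<rho> (head \<Gamma> e))\<rbrakk>
      \<Longrightarrow> rmap \<rho> f (k e y) = (if e = f then y else \<zero>\<^bsub>rspace \<rho> (head \<Gamma> f)\<^esub>)"
    and "\<And>X x. \<lbrakk>X \<in> P; x \<in> carrier (rspace \<rho> (part_source \<Gamma> X))\<rbrakk>
      \<Longrightarrow> x = finsum (rspace \<rho> (part_source \<Gamma> X)) (\<lambda>e. k e (rmap \<rho> e x)) X"
proof -
  let ?S = "\<lambda>X. rspace \<rho> (part_source \<Gamma> X)" and ?R = "\<lambda>e. rspace \<rho> (head \<Gamma> e)"
  let ?\<theta> = "\<lambda>X. \<lambda>x\<in>carrier (?S X). \<lambda>e\<in>X. rmap \<rho> e x"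
  let ?g = "\<lambda>X. \<lambda>y\<in>carrier (direct_sum X ?R). the_inv_into (carrier (?S X)) (?\<theta> X) y"
  let ?s = "\<lambda>X. single_family X ?R"
  \<comment> \<open>Each arrow lies in exactly one part, which decides the isomorphism to be
    inverted.\<close>
  define part where "part e = (THE X. X \<in> P \<and> e \<in> X)" for e
  define k where "k e = compose (carrier (?R e)) (?g (part e)) (?s (part e) e)" for e
  have part: "part e = X" if "X \<in> P" "e \<in> X" for e X
    unfolding part_def
  proof (rule the_equality)
    show "X \<in> P \<and> e \<in> X" using that ..
    show "Y = X" if "Y \<in> P \<and> e \<in> Y" for Y
      by (rule part_unique[OF conjunct1[OF that] \<open>X \<in> P\<close> conjunct2[OF that] \<open>e \<in> X\<close>])
  qed
  have V: "vspace (rspace \<rho> v)" if "v \<in> verts \<Gamma>" for v using \<rho> that by (simp add: is_quiver_rep_def)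
  have R: "vspace (?R e)" if "X \<in> P" "e \<in> X" for X e
    by (rule V[OF head_in_verts[OF part_arcs[OF that]]])
  have S: "vspace (?S X)" if "X \<in> P" for X by (rule V[OF part_source_vert[OF that]])
  have T: "vspace (direct_sum X ?R)" if "X \<in> P" for X
    by (rule vspace_direct_sum[OF R[OF that]])
  have \<theta>: "?\<theta> X \<in> linear_maps (?S X) (direct_sum X ?R)" "bij_betw (?\<theta> X) (carrier (?S X)) (carrier (direct_sum X ?R))"
    if "X \<in> P" for X
    using I that by (simp_all add: condition_I_def Let_def)
  have g: "?g X \<in> linear_maps (direct_sum X ?R) (?S X)" if "X \<in> P" for X
    by (rule linear_maps_inverse[OF \<theta>[OF that] S[OF that] T[OF that]])
  have \<theta>g: "?\<theta> X (?g X y) = y" if "X \<in> P" "y \<in> carrier (direct_sum X ?R)" for X y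
    unfolding restrict_apply'[OF that(2)] by (rule f_the_inv_into_f_bij_betw[OF \<theta>(2)[OF that(1)]]) (use that in simp)
  have g\<theta>: "?g X (?\<theta> X x) = x" if "X \<in> P" "x \<in> carrier (?S X)" for X x
    unfolding restrict_apply'[OF linear_maps_closed[OF \<theta>(1)[OF that(1)] that(2)]]
    by (rule the_inv_into_f_f[OF bij_betw_imp_inj_on[OF \<theta>(2)[OF that(1)]] that(2)])
  have B: "biproduct X ?R (direct_sum X ?R) (?s X) (\<lambda>i. \<lambda>x\<in>carrier (direct_sum X ?R). x i)" if "X \<in> P" for X
    using R[OF that] by (rule biproduct_direct_sum)
  show thesis
  proof (rule that[of k])
    fix e assume "e \<in> arcs \<Gamma>"
    then obtain X where X: "X \<in> P" "e \<in> X" using part_exists by blast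
    show "k e \<in> linear_maps (rspace \<rho> (head \<Gamma> e)) (rspace \<rho> (tail \<Gamma> e))"
      unfolding k_def part[OF X] part_source_eq[OF X, symmetric]
      using biproduct.emb_linear[OF B[OF X(1)] X(2)] g[OF X(1)] R[OF X] by (rule linear_maps_compose)
  next
    fix X e f y assume X: "X \<in> P" "e \<in> X" "f \<in> X" and y: "y \<in> carrier (?R e)"
    have s: "?s X e y \<in> carrier (direct_sum X ?R)" by (rule biproduct.emb_closed[OF B[OF X(1)] X(2) y])
    have k: "k e y = ?g X (?s X e y)" unfolding k_def part[OF X(1,2)] by (rule compose_eq[OF y])
    have gs: "?g X (?s X e y) \<in> carrier (?S X)" by (rule linear_maps_closed[OF g[OF X(1)] s])
    \<comment> \<open>\<open>rmap \<rho> f\<close> is coordinate \<open>f\<close> of the map in (I),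
      and that map cancels against its inverse.\<close>
    have "rmap \<rho> f (k e y) = ?\<theta> X (?g X (?s X e y)) f"
      unfolding k restrict_apply'[OF gs] restrict_apply'[OF X(3)] ..
    also have "\<dots> = ?s X e y f" unfolding \<theta>g[OF X(1) s] ..
    also have "\<dots> = (if e = f then y else \<zero>\<^bsub>rspace \<rho> (head \<Gamma> f)\<^esub>)"
      using y X by (auto simp: single_family_def)
    finally show "rmap \<rho> f (k e y) = (if e = f then y else \<zero>\<^bsub>rspace \<rho> (head \<Gamma> f)\<^esub>)" .
  next
    fix X x assume X: "X \<in> P" and x: "x \<in> carrier (?S X)"
    interpret S: vect "?S X" by (rule vect.intro) (rule S, fact)
    interpret B: biproduct X ?R "direct_sum X ?R" "?s X" "\<lambda>i. \<lambda>x\<in>carrier (direct_sum X ?R). x i" by (rule B[OF X])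
    have \<theta>x: "?\<theta> X x \<in> carrier (direct_sum X ?R)" by (rule linear_maps_closed[OF \<theta>(1)[OF X] x])
    have rm: "rmap \<rho> e x \<in> carrier (?R e)" if "e \<in> X" for e
      using \<rho> part_arcs[OF X that] part_source_eq[OF X that] x by (auto simp: is_quiver_rep_def intro: linear_maps_closed)
    have ev: "(\<lambda>x\<in>carrier (direct_sum X ?R). x e) (?\<theta> X x) = rmap \<rho> e x" if "e \<in> X" for e
      by (rule trans[OF restrict_apply'[OF \<theta>x]]) (simp only: restrict_apply'[OF x] restrict_apply'[OF that])
    have "x = ?g X (?\<theta> X x)" by (rule g\<theta>[OF X x, symmetric])
    \<comment> \<open>The image of \<open>x\<close> is split into its coordinates; as the part is
      finite, the sum may run over all of it instead of a support.\<close>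
    also have "\<dots> = ?g X (finsum (direct_sum X ?R) (\<lambda>e. ?s X e ((\<lambda>x\<in>carrier (direct_sum X ?R). x e) (?\<theta> X x))) X)"
      by (rule arg_cong[OF B.decomposition_superset[OF \<theta>x finite_part[OF X]], of "?g X"]) auto
    also have "\<dots> = finsum (?S X) (\<lambda>e. ?g X (?s X e ((\<lambda>x\<in>carrier (direct_sum X ?R). x e) (?\<theta> X x)))) X"
      by (rule linear_maps_finsum[OF g[OF X] T[OF X] S[OF X] finite_part[OF X]])
        (intro B.emb_closed B.proj_closed \<theta>x)
    also have "\<dots> = finsum (?S X) (\<lambda>e. k e (rmap \<rho> e x)) X"
    proof (rule S.finsum_cong')
      fix e assume e: "e \<in> X"
      show "?g X (?s X e ((\<lambda>x\<in>carrier (direct_sum X ?R). x e) (?\<theta> X x))) = k e (rmap \<rho> e x)"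
        unfolding ev[OF e] k_def part[OF X e] by (rule compose_eq[OF rm[OF e], symmetric])
    next
      show "(\<lambda>e. k e (rmap \<rho> e x)) \<in> X \<rightarrow> carrier (?S X)"
      proof
        fix e assume e: "e \<in> X"
        show "k e (rmap \<rho> e x) \<in> carrier (?S X)"
          unfolding k_def part[OF X e] compose_eq[OF rm[OF e]]
          by (rule linear_maps_closed[OF g[OF X] B.emb_closed[OF e rm[OF e]]])
      qed
    qed simp
    finally show "x = finsum (?S X) (\<lambda>e. k e (rmap \<rho> e x)) X" .
  qed
qed

end

section \<open>Unital modules and their corner representations\<close>

text \<open>Finite sums of vertices act as local units. For the operators on a module this is the
  content of \<open>M L = M\<close>, also when there are infinitely many vertices and the algebra
  has no unit.\<close>

locale unital_generator_module = generator_module +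
  assumes vertex_decomposition: "x \<in> carrier N \<Longrightarrow>
    \<exists>F. finite F \<and> F \<subseteq> verts \<Gamma> \<and> x = (\<Oplus>v\<in>F. act (Vertex v) x)"

section \<open>Elements supported on finitely many vertices\<close>

context generator_module
begin

definition supported :: "'u set" where
  "supported = {x \<in> carrier N. \<exists>F. finite F \<and> F \<subseteq> verts \<Gamma> \<and> x = (\<Oplus>v\<in>F. act (Vertex v) x)}"

text \<open>Distinct vertices act as orthogonal idempotents, so \<open>w\<close> kills every term of
  the given decomposition.\<close>

lemma vertex_act_outside:
  assumes "finite F" "F \<subseteq> verts \<Gamma>" "x \<in> carrier N" "x = (\<Oplus>v\<in>F. act (Vertex v) x)" "w \<in> verts \<Gamma> - F"
  shows "act (Vertex w) x = \<zero>"
proof -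
  have "act (Vertex w) x = act (Vertex w) (\<Oplus>v\<in>F. act (Vertex v) x)"
    using assms(4) by simp
  also have "\<dots> = (\<Oplus>v\<in>F. act (Vertex w) (act (Vertex v) x))"
    using assms by (intro act_finsum) (auto intro!: act_closed)
  also have "\<dots> = (\<Oplus>v\<in>F. \<zero>)"
    using assms by (intro finsum_cong') (auto simp: act_vertex_vertex)
  finally show ?thesis by simp
qed

text \<open>Allows two elements to be decomposed over one common finite set of vertices.\<close>

lemma vertex_decomposition_superset:
  assumes "finite F" "F \<subseteq> verts \<Gamma>" "x \<in> carrier N" "x = (\<Oplus>v\<in>F. act (Vertex v) x)"
    and "finite F'" "F \<subseteq> F'" "F' \<subseteq> verts \<Gamma>"
  shows "x = (\<Oplus>v\<in>F'. act (Vertex v) x)"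
proof -
  have "(\<Oplus>v\<in>F'. act (Vertex v) x) = (\<Oplus>v\<in>F. act (Vertex v) x)"
    using assms vertex_act_outside[OF assms(1-4)] by (intro finsum_superset) (auto intro!: act_closed)
  with assms(4) show ?thesis by simp
qed

lemma supported_corner: "\<lbrakk>v \<in> verts \<Gamma>; x \<in> carrier (corner N act v)\<rbrakk> \<Longrightarrow> x \<in> supported"
  unfolding supported_def by (auto intro!: exI[of _ "{v}"])

text \<open>A subgroup that contains all products \<open>x a\<close> contains the subgroup they
  generate; this is how unitality of a module will be exploited.\<close>

lemma submodule_supported: "submodule supported (scalar_field :: 'f ring) N"
proof (rule submodule_vspaceI)
  show "supported \<subseteq> carrier N" by (auto simp: supported_def)
  show "\<zero> \<in> supported" unfolding supported_def by (auto intro!: exI[of _ "{}"])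
  fix x assume "x \<in> supported"
  then obtain F where x: "x \<in> carrier N" and F: "finite F" "F \<subseteq> verts \<Gamma>" "x = (\<Oplus>v\<in>F. act (Vertex v) x)"
    by (auto simp: supported_def)
  have mem: "act (Vertex v) z \<in> carrier N" if "v \<in> verts \<Gamma>" "z \<in> carrier N" for v z
    using that by (intro act_closed) auto
  show "c \<odot> x \<in> supported" for c
  proof -
    have "c \<odot> x = c \<odot> (\<Oplus>v\<in>F. act (Vertex v) x)" using F(3) by simp
    also have "\<dots> = (\<Oplus>v\<in>F. c \<odot> act (Vertex v) x)"
      using F(1,2) x mem by (intro finsum_smult_ldistr) auto
    also have "\<dots> = (\<Oplus>v\<in>F. act (Vertex v) (c \<odot> x))"
      using F(2) x mem by (intro finsum_cong') (auto simp: act_smult subset_iff)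
    finally show ?thesis using x F(1,2) by (auto simp: supported_def)
  qed
  fix y assume "y \<in> supported"
  then obtain E where y: "y \<in> carrier N" and E: "finite E" "E \<subseteq> verts \<Gamma>" "y = (\<Oplus>v\<in>E. act (Vertex v) y)"
    by (auto simp: supported_def)
  have FE: "finite (F \<union> E)" "F \<union> E \<subseteq> verts \<Gamma>" using F E by auto
  have "x = (\<Oplus>v\<in>F \<union> E. act (Vertex v) x)"
    by (rule vertex_decomposition_superset[OF F(1,2) x F(3) FE(1) Un_upper1 FE(2)])
  moreover have "y = (\<Oplus>v\<in>F \<union> E. act (Vertex v) y)"
    by (rule vertex_decomposition_superset[OF E(1,2) y E(3) FE(1) Un_upper2 FE(2)])
  ultimately have "x \<oplus> y = (\<Oplus>v\<in>F \<union> E. act (Vertex v) x) \<oplus> (\<Oplus>v\<in>F \<union> E. act (Vertex v) y)"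
    by (rule arg_cong2)
  also have "\<dots> = (\<Oplus>v\<in>F \<union> E. act (Vertex v) x \<oplus> act (Vertex v) y)"
    using FE x y mem by (intro finsum_addf[symmetric]) auto
  also have "\<dots> = (\<Oplus>v\<in>F \<union> E. act (Vertex v) (x \<oplus> y))"
    using FE x y mem by (intro finsum_cong') (auto simp: act_add subset_iff)
  finally show "x \<oplus> y \<in> supported" using x y FE by (auto simp: supported_def)
qed

lemma supported_act:
  assumes "g \<in> lpa_gens \<Gamma>" "x \<in> carrier N"
  shows "act g x \<in> supported"
proof -
  obtain v where "v \<in> verts \<Gamma>" "act g x \<in> carrier (corner N act v)"
    using act_corner[OF assms] by (elim bexE)
  then show ?thesis by (rule supported_corner)
qed

lemma condition_I_corner:
  assumes "rspace \<rho> = corner N act" "rmap \<rho> = corner_map \<Gamma> N act"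
  shows "condition_I \<Gamma> P \<rho>"
proof (rule condition_I_if_inverse[where k = "\<lambda>e. act (Ghost e)"])
  show "is_quiver_rep \<Gamma> \<rho>" using assms by (rule is_quiver_rep_corner)
  show "act (Ghost e) y \<in> carrier (rspace \<rho> (tail \<Gamma> e))"
    if "e \<in> arcs \<Gamma>" "y \<in> carrier (rspace \<rho> (head \<Gamma> e))" for e y
    unfolding assms(1) by (rule act_ghost_corner) (use that assms(1) in simp_all)
next
  fix X e f y assume X: "X \<in> P" "e \<in> X" "f \<in> X" and "y \<in> carrier (rspace \<rho> (head \<Gamma> e))"
  then have y: "y \<in> carrier N" "act (Vertex (head \<Gamma> e)) y = y" by (simp_all add: assms)
  have e: "e \<in> arcs \<Gamma>" "tail \<Gamma> e = tail \<Gamma> f" using part_arcs[OF X(1,2)] same_source[OF X] by simp_all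
  then have "act (Ghost e) y \<in> carrier (corner N act (tail \<Gamma> f))"
    using act_ghost_corner[of e y] y by simp
  then have "rmap \<rho> f (act (Ghost e) y) = act (Arrow f) (act (Ghost e) y)"
    by (simp only: assms corner_map_def restrict_apply')
  then show "rmap \<rho> f (act (Ghost e) y) = (if e = f then y else \<zero>\<^bsub>rspace \<rho> (head \<Gamma> f)\<^esub>)"
    using act_ghost_arrow[OF X y(1)] y(2) by (cases "e = f") (simp_all add: assms)
next
  fix X x assume X: "X \<in> P" and "x \<in> carrier (rspace \<rho> (part_source \<Gamma> X))"
  then have x: "x \<in> carrier (corner N act (part_source \<Gamma> X))" by (simp only: assms)
  have e: "e \<in> arcs \<Gamma>" "tail \<Gamma> e = part_source \<Gamma> X" if "e \<in> X" for e
    using X that part_arcs part_source_eq by auto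
  have rm: "rmap \<rho> e x = act (Arrow e) x" if "e \<in> X" for e
    using x by (simp only: assms corner_map_def e(2)[OF that] restrict_apply')
  have mem: "act (Ghost e) (act (Arrow e) x) \<in> carrier (corner N act (part_source \<Gamma> X))" if "e \<in> X" for e
    using act_ghost_corner[OF e(1)[OF that] act_closed[of "Arrow e" x]] e[OF that] x by simp
  \<comment> \<open>The source vertex of \<open>X\<close> fixes \<open>x\<close>, so (SCK2) expands
    \<open>x\<close> itself.\<close>
  have "x = (\<Oplus>e\<in>X. act (Ghost e) (act (Arrow e) x))"
    using act_arrow_ghost[OF X, of x] x by simp
  also have "\<dots> = (\<Oplus>\<^bsub>corner N act (part_source \<Gamma> X)\<^esub>e\<in>X. act (Ghost e) (act (Arrow e) x))"
    by (rule corner_finsum[symmetric]) (use X part_source_vert finite_part mem in auto)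
  also have "\<dots> = (\<Oplus>\<^bsub>corner N act (part_source \<Gamma> X)\<^esub>e\<in>X. act (Ghost e) (rmap \<rho> e x))"
  proof (rule abelian_monoid.finsum_cong')
    show "abelian_monoid (corner N act (part_source \<Gamma> X))"
      using vspace_corner[OF part_source_vert[OF X]] by (simp add: Module.module_def abelian_group_def)
  qed (use mem rm in auto)
  finally show "x = finsum (rspace \<rho> (part_source \<Gamma> X)) (\<lambda>e. act (Ghost e) (rmap \<rho> e x)) X"
    by (simp only: assms)
qed

end

text \<open>The Peirce decomposition for orthogonal idempotents: vertices project onto the corners,
  and the local units make the corners exhaust \<open>N\<close>.\<close>

lemma (in unital_generator_module) biproduct_corners:
  "biproduct (verts \<Gamma>) (corner N act) N (\<lambda>v. \<lambda>x\<in>carrier (corner N act v). x)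
    (\<lambda>v. \<lambda>x\<in>carrier N. act (Vertex v) x)"
proof (rule biproduct.intro)
  show "vspace N" by (rule vspace)
  fix v assume v: "v \<in> verts \<Gamma>"
  then show "vspace (corner N act v)" by (rule vspace_corner)
  show "(\<lambda>x\<in>carrier (corner N act v). x) \<in> linear_maps (corner N act v) N"
    using v by (rule corner_inclusion_linear)
  show "(\<lambda>x\<in>carrier N. act (Vertex v) x) \<in> linear_maps N (corner N act v)"
    using v by (intro linear_mapsI) (auto simp: act_closed act_vertex_vertex act_add act_smult)
  fix x assume x: "x \<in> carrier (corner N act v)"
  show "(\<lambda>x\<in>carrier N. act (Vertex v) x) ((\<lambda>x\<in>carrier (corner N act v). x) x) = x"
    using x by simp
  fix w assume "w \<in> verts \<Gamma>" "v \<noteq> w"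
  then show "(\<lambda>x\<in>carrier N. act (Vertex w) x) ((\<lambda>x\<in>carrier (corner N act v). x) x) = \<zero>\<^bsub>corner N act w\<^esub>"
    using act_vertex_other[OF v _ _ x] x by simp
next
  fix x assume x: "x \<in> carrier N"
  obtain F where F: "finite F" "F \<subseteq> verts \<Gamma>" "x = (\<Oplus>v\<in>F. act (Vertex v) x)"
    using vertex_decomposition[OF x] by blast
  let ?S = "{v \<in> verts \<Gamma>. act (Vertex v) x \<noteq> \<zero>}"
  have eq: "{v \<in> verts \<Gamma>. (\<lambda>x\<in>carrier N. act (Vertex v) x) x \<noteq> \<zero>\<^bsub>corner N act v\<^esub>} = ?S"
    using x by simp
  have sub: "?S \<subseteq> F" using vertex_act_outside[OF F(1,2) x F(3)] by blast
  show "finite {v \<in> verts \<Gamma>. (\<lambda>x\<in>carrier N. act (Vertex v) x) x \<noteq> \<zero>\<^bsub>corner N act v\<^esub>}"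
    unfolding eq by (rule finite_subset[OF sub F(1)])
  have "x = (\<Oplus>v\<in>F. act (Vertex v) x)" by (rule F(3))
  also have "\<dots> = (\<Oplus>v\<in>?S. act (Vertex v) x)"
    using F(1,2) sub x by (intro finsum_superset) (auto intro!: act_closed)
  also have "\<dots> = (\<Oplus>v\<in>?S. (\<lambda>y\<in>carrier (corner N act v). y) ((\<lambda>x\<in>carrier N. act (Vertex v) x) x))"
    using x by (intro finsum_cong') (auto simp: act_closed act_vertex_vertex)
  finally show "x = finsum N (\<lambda>v. (\<lambda>y\<in>carrier (corner N act v). y) ((\<lambda>x\<in>carrier N. act (Vertex v) x) x))
      {v \<in> verts \<Gamma>. (\<lambda>x\<in>carrier N. act (Vertex v) x) x \<noteq> \<zero>\<^bsub>corner N act v\<^esub>}"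
    unfolding eq .
qed

section \<open>Unitality and homomorphisms in terms of generators\<close>

definition gen_act :: "('v, 'e) pre_digraph \<Rightarrow> 'e set set \<Rightarrow>
    ('f::field, 'u, ('v, 'e, 'f) lpa_elem, 'z) rmod_scheme \<Rightarrow> ('v, 'e) lpa_gen \<Rightarrow> 'u \<Rightarrow> 'u" where
  "gen_act \<Gamma> P M g x = ract M x (lpa_coset \<Gamma> P (gen g))"

context finitely_separated_digraph
begin

lemma generator_module_gen_act:
  fixes M :: "('f::field, 'u, ('a, 'b, 'f) lpa_elem, 'z) rmod_scheme"
  assumes "right_module (leavitt_path_algebra \<Gamma> P) M"
  shows "generator_module \<Gamma> P M (gen_act \<Gamma> P M)"
  using generator_module_right_module[OF assms] by (simp add: gen_act_def[abs_def])

lemma ract_lpa_zero: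
  fixes M :: "('f::field, 'u, ('a, 'b, 'f) lpa_elem, 'z) rmod_scheme"
  assumes "right_module (leavitt_path_algebra \<Gamma> P) M" "x \<in> carrier M"
  shows "ract M x (lpa_coset \<Gamma> P 0) = \<zero>\<^bsub>M\<^esub>"
proof -
  interpret M: right_module "leavitt_path_algebra \<Gamma> P :: ('f, ('a, 'b, 'f) lpa_elem) module" M by fact
  have c: "lpa_coset \<Gamma> P 0 \<in> carrier (leavitt_path_algebra \<Gamma> P :: ('f, ('a, 'b, 'f) lpa_elem) module)"
    by (auto simp: lpa_carrier intro: augmentation_ideal_closed)
  show ?thesis
    using M.ract_smult_right[OF assms(2) c, of 0] M.ract_closed[OF assms(2) c]
    by (simp add: lpa_smult)
qed

text \<open>A product \<open>x a\<close> is built by sums and scalars from elements on which a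
  generator has acted last, and such elements lie in a corner. So all products are supported on
  finitely many vertices, and with them the subgroup they generate, which is the whole
  module.\<close>

lemma unital_generator_module_gen_act:
  fixes M :: "('f::field, 'u, ('a, 'b, 'f) lpa_elem, 'z) rmod_scheme"
  assumes "unital_right_module (leavitt_path_algebra \<Gamma> P) M"
  shows "unital_generator_module \<Gamma> P M (gen_act \<Gamma> P M)"
proof -
  let ?L = "leavitt_path_algebra \<Gamma> P :: ('f, ('a, 'b, 'f) lpa_elem) module"
  interpret M: unital_right_module ?L M by fact
  have rm: "right_module ?L M" by (rule M.right_module_axioms)
  interpret N: generator_module \<Gamma> P M "gen_act \<Gamma> P M" by (rule generator_module_gen_act[OF rm])
  note S = M.submodule_vspaceD[OF N.submodule_supported]
  have ract: "ract M x a \<in> N.supported" if "a \<in> carrier ?L" "x \<in> carrier M" for x a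
    using that
  proof (induction a rule: lpa_induct)
    case zero
    then show ?case using ract_lpa_zero[OF rm] S(2) by simp
  next
    case (add a b)
    then show ?case by (simp add: M.ract_add_right S(3))
  next
    case (gen c g)
    have "ract M x (lpa_coset \<Gamma> P (gen g)) \<in> N.supported"
      using N.supported_act[OF gen(1,2)] by (simp add: gen_act_def)
    then show ?case using gen by (simp add: M.ract_smult_right S(4))
  next
    case (mult_gen a g)
    have "ract M (ract M x a) (lpa_coset \<Gamma> P (gen g)) \<in> N.supported"
      using N.supported_act[OF mult_gen(2) M.ract_closed[OF mult_gen(4,1)]] by (simp add: gen_act_def)
    then show ?case using mult_gen by (simp add: M.ract_mult)
  qed
  have "generate (add_monoid M) {ract M x a | x a. x \<in> carrier M \<and> a \<in> carrier ?L} \<subseteq> N.supported"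
    by (rule group.generate_subgroup_incl[OF M.a_group _ submodule.axioms(1)[OF N.submodule_supported]])
      (use ract in blast)
  then have "carrier M \<subseteq> N.supported" unfolding M.unital .
  then show ?thesis
    by unfold_locales (auto simp: N.supported_def)
qed

text \<open>Each term \<open>x v\<close> of a vertex decomposition is one of the products that
  generate \<open>M L\<close>.\<close>

lemma unital_right_module_if_unital_generator_module:
  fixes M :: "('f::field, 'u, ('a, 'b, 'f) lpa_elem, 'z) rmod_scheme"
  assumes rm: "right_module (leavitt_path_algebra \<Gamma> P) M"
    and un: "unital_generator_module \<Gamma> P M (gen_act \<Gamma> P M)"
  shows "unital_right_module (leavitt_path_algebra \<Gamma> P) M"
proof -
  let ?L = "leavitt_path_algebra \<Gamma> P :: ('f, ('a, 'b, 'f) lpa_elem) module"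
  interpret M: right_module ?L M by fact
  interpret N: unital_generator_module \<Gamma> P M "gen_act \<Gamma> P M" by fact
  let ?K = "{ract M x a | x a. x \<in> carrier M \<and> a \<in> carrier ?L}"
  let ?G = "generate (add_monoid M) ?K"
  have K: "?K \<subseteq> carrier (add_monoid M)" using M.ract_closed by auto
  have G: "?G \<subseteq> carrier M" using group.generate_in_carrier[OF M.a_group K] by auto
  have "x \<in> ?G" if x: "x \<in> carrier M" for x
  proof -
    obtain F where F: "finite F" "F \<subseteq> verts \<Gamma>" "x = finsum M (\<lambda>v. gen_act \<Gamma> P M (Vertex v) x) F"
      using N.vertex_decomposition[OF x] by blast
    have "finsum M (\<lambda>v. gen_act \<Gamma> P M (Vertex v) x) F \<in> ?G"
    proof (rule M.finsum_mem[OF F(1) _ G])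
      show "\<zero>\<^bsub>M\<^esub> \<in> ?G" using generate.one[of "add_monoid M" ?K] by simp
      show "y \<oplus>\<^bsub>M\<^esub> z \<in> ?G" if "y \<in> ?G" "z \<in> ?G" for y z
        using generate.eng[OF that] by simp
      fix v assume "v \<in> F"
      then have "gen_act \<Gamma> P M (Vertex v) x \<in> ?K"
        using F(2) x unfolding gen_act_def
        by (intro CollectI exI[of _ x] exI[of _ "lpa_coset \<Gamma> P (gen (Vertex v))"] conjI refl lpa_coset_gen) auto
      then show "gen_act \<Gamma> P M (Vertex v) x \<in> ?G" by (rule generate.incl)
    qed
    then show ?thesis using F(3) by simp
  qed
  then have "?G = carrier M" using G by blast
  then show ?thesis by (intro unital_right_module.intro unital_right_module_axioms.intro rm)
qed

text \<open>Compatibility with the action propagates along sums, scalar multiples and products of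
  algebra elements, so it may be tested on generators.\<close>

lemma rmod_homs_iff:
  fixes M M' :: "('f::field, 'u, ('a, 'b, 'f) lpa_elem, 'z) rmod_scheme"
  assumes M: "right_module (leavitt_path_algebra \<Gamma> P) M" and M': "right_module (leavitt_path_algebra \<Gamma> P) M'"
  shows "f \<in> rmod_homs (leavitt_path_algebra \<Gamma> P) M M' \<longleftrightarrow> f \<in> linear_maps M M' \<and>
    (\<forall>g\<in>lpa_gens \<Gamma>. \<forall>x\<in>carrier M. f (gen_act \<Gamma> P M g x) = gen_act \<Gamma> P M' g (f x))"
proof
  let ?L = "leavitt_path_algebra \<Gamma> P :: ('f, ('a, 'b, 'f) lpa_elem) module"
  interpret M: right_module ?L M by fact
  interpret M': right_module ?L M' by fact
  show "f \<in> rmod_homs ?L M M' \<Longrightarrow> f \<in> linear_maps M M' \<and>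
    (\<forall>g\<in>lpa_gens \<Gamma>. \<forall>x\<in>carrier M. f (gen_act \<Gamma> P M g x) = gen_act \<Gamma> P M' g (f x))"
    by (simp add: rmod_homs_def gen_act_def)
  assume R: "f \<in> linear_maps M M' \<and>
    (\<forall>g\<in>lpa_gens \<Gamma>. \<forall>x\<in>carrier M. f (gen_act \<Gamma> P M g x) = gen_act \<Gamma> P M' g (f x))"
  then have f: "f \<in> linear_maps M M'" by blast
  note fc = linear_maps_closed[OF f]
  have g: "f (ract M x (lpa_coset \<Gamma> P (gen g))) = ract M' (f x) (lpa_coset \<Gamma> P (gen g))"
    if "x \<in> carrier M" "g \<in> lpa_gens \<Gamma>" for x g
    using R that by (simp add: gen_act_def)
  have "f (ract M x a) = ract M' (f x) a" if "a \<in> carrier ?L" "x \<in> carrier M" for a x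
    using that
  proof (induction a rule: lpa_induct)
    case zero
    then show ?case
      using ract_lpa_zero[OF M] ract_lpa_zero[OF M'] linear_maps_zero[OF f M.vspace M'.vspace] fc by simp
  next
    case (add a b)
    then show ?case
      by (simp add: M.ract_add_right M'.ract_add_right fc M.ract_closed linear_maps_add[OF f])
  next
    case (gen c h)
    then show ?case
      by (simp add: M.ract_smult_right M'.ract_smult_right fc M.ract_closed linear_maps_smult[OF f] g)
  next
    case (mult_gen a h)
    then show ?case
      by (simp add: M.ract_mult M'.ract_mult fc M.ract_closed g)
  qed
  with f show "f \<in> rmod_homs ?L M M'" by (simp add: rmod_homs_def)
qed

end

section \<open>Full faithfulness of taking corners\<close>

definition corner_hom :: "('v, 'e) pre_digraph \<Rightarrow> ('f::field, 'u, 'z) module_scheme \<Rightarrow>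
    (('v, 'e) lpa_gen \<Rightarrow> 'u \<Rightarrow> 'u) \<Rightarrow> ('u \<Rightarrow> 'w) \<Rightarrow> 'v \<Rightarrow> 'u \<Rightarrow> 'w" where
  "corner_hom \<Gamma> N act f = (\<lambda>v\<in>verts \<Gamma>. \<lambda>x\<in>carrier (corner N act v). f x)"

text \<open>The representations are specified only by their spaces and maps, with the record
  extension left open, so that plain and graded corner representations both qualify.\<close>

locale two_unital_generator_modules =
  N: unital_generator_module \<Gamma> P N act + N': unital_generator_module \<Gamma> P N' act'
  for \<Gamma> :: "('v, 'e) pre_digraph" and P :: "'e set set"
    and N :: "('f::field, 'u, 'z) module_scheme" and act :: "('v, 'e) lpa_gen \<Rightarrow> 'u \<Rightarrow> 'u"
    and N' :: "('f::field, 'u, 'y) module_scheme" and act' :: "('v, 'e) lpa_gen \<Rightarrow> 'u \<Rightarrow> 'u" +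
  fixes \<rho> \<sigma> :: "('v, 'e, 'f, 'u, 'x) quiver_rep_scheme"
  assumes \<rho>: "rspace \<rho> = corner N act" "rmap \<rho> = corner_map \<Gamma> N act"
    and \<sigma>: "rspace \<sigma> = corner N' act'" "rmap \<sigma> = corner_map \<Gamma> N' act'"
begin

text \<open>For modules over the algebra this is \<open>rmod_homs\<close>, by
  \<open>rmod_homs_iff\<close>; the form with generators is the one that gluing can verify.\<close>

definition gen_homs :: "('u \<Rightarrow> 'u) set" where
  "gen_homs = {f \<in> linear_maps N N'. \<forall>g\<in>lpa_gens \<Gamma>. \<forall>x\<in>carrier N. f (act g x) = act' g (f x)}"

lemma gen_homsD:
  assumes "f \<in> gen_homs"
  shows "f \<in> linear_maps N N'" "\<lbrakk>g \<in> lpa_gens \<Gamma>; x \<in> carrier N\<rbrakk> \<Longrightarrow> f (act g x) = act' g (f x)"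
  using assms by (auto simp: gen_homs_def)

lemma gen_homs_corner:
  assumes "f \<in> gen_homs" "v \<in> verts \<Gamma>" "x \<in> carrier (corner N act v)"
  shows "f x \<in> carrier (corner N' act' v)"
  using assms gen_homsD(2)[OF assms(1), of "Vertex v" x] linear_maps_closed[OF gen_homsD(1)[OF assms(1)]]
  by simp

lemma corner_hom_in_rep_homs:
  assumes f: "f \<in> gen_homs"
  shows "corner_hom \<Gamma> N act f \<in> rep_homs \<Gamma> \<rho> \<sigma>"
proof -
  note lin = gen_homsD(1)[OF f]
  have "(\<lambda>x\<in>carrier (corner N act v). f x) \<in> linear_maps (corner N act v) (corner N' act' v)"
    if v: "v \<in> verts \<Gamma>" for v
  proof (rule linear_mapsI)
    show "(\<lambda>x\<in>carrier (corner N act v). f x) \<in> carrier (corner N act v) \<rightarrow>\<^sub>E carrier (corner N' act' v)"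
      using gen_homs_corner[OF f v] by (simp del: corner_simps)
  qed (use v in \<open>simp_all add: N.act_add N.act_smult linear_maps_add[OF lin] linear_maps_smult[OF lin]\<close>)
  moreover have "corner_hom \<Gamma> N act f (head \<Gamma> e) (rmap \<rho> e x) = rmap \<sigma> e (corner_hom \<Gamma> N act f (tail \<Gamma> e) x)"
    if e: "e \<in> arcs \<Gamma>" and x: "x \<in> carrier (corner N act (tail \<Gamma> e))" for e x
  proof -
    have v: "head \<Gamma> e \<in> verts \<Gamma>" "tail \<Gamma> e \<in> verts \<Gamma>" using e N.head_in_verts N.tail_in_verts by auto
    have xN: "x \<in> carrier N" using x by simp
    have "rmap \<rho> e x = act (Arrow e) x" using x by (simp only: \<rho> corner_map_def restrict_apply')
    then have "corner_hom \<Gamma> N act f (head \<Gamma> e) (rmap \<rho> e x) = f (act (Arrow e) x)"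
      using N.act_arrow_corner[OF e xN] v by (simp only: corner_hom_def restrict_apply')
    moreover have "rmap \<sigma> e (corner_hom \<Gamma> N act f (tail \<Gamma> e) x) = act' (Arrow e) (f x)"
      using gen_homs_corner[OF f v(2) x] x v by (simp only: corner_hom_def \<sigma> corner_map_def restrict_apply')
    ultimately show ?thesis using gen_homsD(2)[OF f _ xN, of "Arrow e"] e by simp
  qed
  ultimately show ?thesis
    unfolding rep_homs_def \<rho>(1) \<sigma>(1) by (auto simp: corner_hom_def simp del: corner_simps)
qed

text \<open>Coordinate \<open>v\<close> of \<open>f x\<close> is the value of \<open>f\<close> at
  \<open>x v\<close>, and this element lies in the corner on which the restriction determines
  \<open>f\<close>.\<close>

lemma corner_hom_inj:
  assumes f: "f \<in> gen_homs" and g: "g \<in> gen_homs" and eq: "corner_hom \<Gamma> N act f = corner_hom \<Gamma> N act g"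
  shows "f = g"
proof (rule linear_maps_eqI[OF gen_homsD(1)[OF f] gen_homsD(1)[OF g]])
  interpret B': biproduct "verts \<Gamma>" "corner N' act'" N' "\<lambda>v. \<lambda>x\<in>carrier (corner N' act' v). x"
    "\<lambda>v. \<lambda>x\<in>carrier N'. act' (Vertex v) x" by (rule N'.biproduct_corners)
  fix x assume x: "x \<in> carrier N"
  show "f x = g x"
  proof (rule B'.eq_if_proj_eq)
    show fx: "f x \<in> carrier N'" "g x \<in> carrier N'" using linear_maps_closed[OF gen_homsD(1)[OF f] x] linear_maps_closed[OF gen_homsD(1)[OF g] x] by auto
    fix v assume v: "v \<in> verts \<Gamma>"
    have c: "act (Vertex v) x \<in> carrier (corner N act v)" by (rule N.act_vertex_corner[OF v x])
    have "corner_hom \<Gamma> N act h v (act (Vertex v) x) = h (act (Vertex v) x)" for h :: "'u \<Rightarrow> 'u"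
      using v c by (simp only: corner_hom_def restrict_apply')
    then have "f (act (Vertex v) x) = g (act (Vertex v) x)" using eq by metis
    then show "(\<lambda>x\<in>carrier N'. act' (Vertex v) x) (f x) = (\<lambda>x\<in>carrier N'. act' (Vertex v) x) (g x)"
      using fx v gen_homsD(2)[OF f _ x, of "Vertex v"] gen_homsD(2)[OF g _ x, of "Vertex v"] by simp
  qed
qed

text \<open>The maps on corners are glued by \<open>biproduct_map\<close>. The glued map restricts
  to the given ones, and compatibility with a generator is checked on the corner where the generator
  starts.\<close>

lemma corner_hom_surj:
  assumes \<phi>: "\<phi> \<in> rep_homs \<Gamma> \<rho> \<sigma>"
  shows "\<exists>f\<in>gen_homs. corner_hom \<Gamma> N act f = \<phi>"
proof -
  interpret B: biproduct "verts \<Gamma>" "corner N act" N "\<lambda>v. \<lambda>x\<in>carrier (corner N act v). x"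
    "\<lambda>v. \<lambda>x\<in>carrier N. act (Vertex v) x" by (rule N.biproduct_corners)
  interpret B': biproduct "verts \<Gamma>" "corner N' act'" N' "\<lambda>v. \<lambda>x\<in>carrier (corner N' act' v). x"
    "\<lambda>v. \<lambda>x\<in>carrier N'. act' (Vertex v) x" by (rule N'.biproduct_corners)
  have lin: "\<phi> v \<in> linear_maps (corner N act v) (corner N' act' v)" if "v \<in> verts \<Gamma>" for v
    using \<phi> that by (auto simp: rep_homs_def \<rho> \<sigma>)
  have arrow: "\<phi> (head \<Gamma> e) (act (Arrow e) x) = act' (Arrow e) (\<phi> (tail \<Gamma> e) x)"
    if e: "e \<in> arcs \<Gamma>" and x: "x \<in> carrier (corner N act (tail \<Gamma> e))" for e x
  proof -
    have "\<phi> (head \<Gamma> e) (rmap \<rho> e x) = rmap \<sigma> e (\<phi> (tail \<Gamma> e) x)"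
      using \<phi> e x by (auto simp: rep_homs_def \<rho>(1) simp del: corner_simps)
    moreover have "\<phi> (tail \<Gamma> e) x \<in> carrier (corner N' act' (tail \<Gamma> e))"
      by (rule linear_maps_closed[OF lin[OF N.tail_in_verts[OF e]] x])
    ultimately show ?thesis using x by (simp only: \<rho> \<sigma> corner_map_def restrict_apply')
  qed
  obtain f where f: "f \<in> linear_maps N N'"
    and proj: "\<And>x v. \<lbrakk>x \<in> carrier N; v \<in> verts \<Gamma>\<rbrakk> \<Longrightarrow>
      (\<lambda>x\<in>carrier N'. act' (Vertex v) x) (f x) = \<phi> v ((\<lambda>x\<in>carrier N. act (Vertex v) x) x)"
    using biproduct_map[OF N.biproduct_corners N'.biproduct_corners lin] by meson
  note fc = linear_maps_closed[OF f]
  have vertex: "act' (Vertex v) (f x) = \<phi> v (act (Vertex v) x)" if "x \<in> carrier N" "v \<in> verts \<Gamma>" for x v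
    using proj[OF that] fc that by simp
  have zero: "\<phi> v \<zero>\<^bsub>N\<^esub> = \<zero>\<^bsub>N'\<^esub>" if "v \<in> verts \<Gamma>" for v
    using linear_maps_zero[OF lin[OF that] N.vspace_corner[OF that] N'.vspace_corner[OF that]] by simp
  \<comment> \<open>For \<open>x\<close> in the corner at \<open>v\<close>, only the coordinate at
    \<open>v\<close> survives on either side; the others vanish by orthogonality.\<close>
  have on_corner: "f x = \<phi> v x" if v: "v \<in> verts \<Gamma>" and x: "x \<in> carrier (corner N act v)" for v x
  proof (rule B'.eq_if_proj_eq)
    have \<phi>x: "\<phi> v x \<in> carrier (corner N' act' v)" by (rule linear_maps_closed[OF lin[OF v] x])
    show "f x \<in> carrier N'" "\<phi> v x \<in> carrier N'" using fc x \<phi>x by auto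
    fix w assume w: "w \<in> verts \<Gamma>"
    have "\<phi> w (act (Vertex w) x) = act' (Vertex w) (\<phi> v x)"
    proof (cases "v = w")
      case True
      then show ?thesis using x \<phi>x by simp
    next
      case False
      then show ?thesis using N.act_vertex_other[OF v w False x] N'.act_vertex_other[OF v w False \<phi>x] zero[OF w] by simp
    qed
    then show "(\<lambda>x\<in>carrier N'. act' (Vertex w) x) (f x) = (\<lambda>x\<in>carrier N'. act' (Vertex w) x) (\<phi> v x)"
      using vertex[of x w] w x \<phi>x fc by simp
  qed
  \<comment> \<open>(SCK2) recovers the value of \<open>\<phi>\<close> at \<open>y e\<^sup>*\<close>
    from its images under the arrows \<open>h\<close> of the part of \<open>e\<close>. These images
    are known: \<open>\<phi>\<close> respects arrows, and (SCK1) evaluates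
    \<open>y e\<^sup>* h\<close>.\<close>
  have ghost: "\<phi> (tail \<Gamma> e) (act (Ghost e) y) = act' (Ghost e) (\<phi> (head \<Gamma> e) y)"
    if e: "e \<in> arcs \<Gamma>" and y: "y \<in> carrier (corner N act (head \<Gamma> e))" for e y
  proof -
    obtain X where X: "X \<in> P" "e \<in> X" using N.part_exists[OF e] by blast
    have h: "h \<in> arcs \<Gamma>" "tail \<Gamma> h = tail \<Gamma> e" if "h \<in> X" for h
      using N.part_arcs[OF X(1) that] N.same_source[OF X(1) that X(2)] by auto
    let ?z = "act (Ghost e) y"
    have z: "?z \<in> carrier (corner N act (tail \<Gamma> e))" using N.act_ghost_corner[OF e] y by simp
    have \<phi>z: "\<phi> (tail \<Gamma> e) ?z \<in> carrier (corner N' act' (tail \<Gamma> e))"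
      by (rule linear_maps_closed[OF lin[OF N.tail_in_verts[OF e]] z])
    have \<phi>y: "\<phi> (head \<Gamma> e) y \<in> carrier (corner N' act' (head \<Gamma> e))"
      by (rule linear_maps_closed[OF lin[OF N.head_in_verts[OF e]] y])
    have arrow_z: "act' (Arrow h) (\<phi> (tail \<Gamma> e) ?z) = (if h = e then \<phi> (head \<Gamma> e) y else \<zero>\<^bsub>N'\<^esub>)" if "h \<in> X" for h
    proof -
      have "act' (Arrow h) (\<phi> (tail \<Gamma> e) ?z) = \<phi> (head \<Gamma> h) (act (Arrow h) ?z)"
        using arrow[OF h(1)[OF that]] z h(2)[OF that] by simp
      then show ?thesis
        using N.act_ghost_arrow[OF X that] y zero[OF N.head_in_verts[OF h(1)[OF that]]] by auto
    qed
    have "\<phi> (tail \<Gamma> e) ?z = act' (Vertex (part_source \<Gamma> X)) (\<phi> (tail \<Gamma> e) ?z)"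
      using \<phi>z N.part_source_eq[OF X] by simp
    also have "\<dots> = finsum N' (\<lambda>h. act' (Ghost h) (act' (Arrow h) (\<phi> (tail \<Gamma> e) ?z))) X"
      using \<phi>z by (intro N'.act_arrow_ghost[OF X(1)]) simp
    \<comment> \<open>By \<open>arrow_z\<close> the terms with \<open>h\<close> different from
      \<open>e\<close> vanish.\<close>
    also have "\<dots> = finsum N' (\<lambda>h. act' (Ghost h) (act' (Arrow h) (\<phi> (tail \<Gamma> e) ?z))) {e}"
    proof (rule N'.finsum_superset[OF N.finite_part[OF X(1)]])
      show "act' (Ghost h) (act' (Arrow h) (\<phi> (tail \<Gamma> e) ?z)) = \<zero>\<^bsub>N'\<^esub>" if "h \<in> X - {e}" for h
        using arrow_z[of h] that N'.act_zero[of "Ghost h"] h(1)[of h] by simp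
      show "act' (Ghost h) (act' (Arrow h) (\<phi> (tail \<Gamma> e) ?z)) \<in> carrier N'" if "h \<in> {e}" for h
        using that arrow_z[OF X(2)] \<phi>y e by (simp add: N'.act_closed)
    qed (use X(2) in simp)
    also have "\<dots> = act' (Ghost e) (\<phi> (head \<Gamma> e) y)"
      using arrow_z[OF X(2)] \<phi>y e by (simp add: N'.act_closed)
    finally show ?thesis .
  qed
  have "f (act g x) = act' g (f x)" if g: "g \<in> lpa_gens \<Gamma>" and x: "x \<in> carrier N" for g x
  proof (cases g)
    case (Vertex v)
    then have v: "v \<in> verts \<Gamma>" using g by simp
    show ?thesis unfolding Vertex vertex[OF x v] by (rule on_corner[OF v N.act_vertex_corner[OF v x]])
  next
    case (Arrow e)
    then have e: "e \<in> arcs \<Gamma>" using g by simp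
    note v = N.tail_in_verts[OF e] N.head_in_verts[OF e]
    have "f (act (Arrow e) x) = \<phi> (head \<Gamma> e) (act (Arrow e) x)"
      by (rule on_corner[OF v(2) N.act_arrow_corner[OF e x]])
    \<comment> \<open>Inserting the tail vertex moves the argument into the corner to which
      \<open>arrow\<close> applies.\<close>
    also have "\<dots> = \<phi> (head \<Gamma> e) (act (Arrow e) (act (Vertex (tail \<Gamma> e)) x))"
      using N.act_tail_arrow[OF e x] by simp
    also have "\<dots> = act' (Arrow e) (act' (Vertex (tail \<Gamma> e)) (f x))"
      using arrow[OF e N.act_vertex_corner[OF v(1) x]] vertex[OF x v(1)] by simp
    also have "\<dots> = act' (Arrow e) (f x)" by (rule N'.act_tail_arrow[OF e fc[OF x]])
    finally show ?thesis unfolding Arrow .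
  next
    case (Ghost e)
    then have e: "e \<in> arcs \<Gamma>" using g by simp
    note v = N.tail_in_verts[OF e] N.head_in_verts[OF e]
    have "f (act (Ghost e) x) = \<phi> (tail \<Gamma> e) (act (Ghost e) x)"
      by (rule on_corner[OF v(1) N.act_ghost_corner[OF e x]])
    also have "\<dots> = \<phi> (tail \<Gamma> e) (act (Ghost e) (act (Vertex (head \<Gamma> e)) x))"
      using N.act_head_ghost[OF e x] by simp
    also have "\<dots> = act' (Ghost e) (act' (Vertex (head \<Gamma> e)) (f x))"
      using ghost[OF e N.act_vertex_corner[OF v(2) x]] vertex[OF x v(2)] by simp
    also have "\<dots> = act' (Ghost e) (f x)" by (rule N'.act_head_ghost[OF e fc[OF x]])
    finally show ?thesis unfolding Ghost .
  qed
  with f have "f \<in> gen_homs" by (simp add: gen_homs_def)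
  moreover have "corner_hom \<Gamma> N act f = \<phi>"
  proof (rule PiE_ext)
    show "corner_hom \<Gamma> N act f \<in> (\<Pi>\<^sub>E v\<in>verts \<Gamma>. linear_maps (rspace \<rho> v) (rspace \<sigma> v))"
      using corner_hom_in_rep_homs[OF \<open>f \<in> gen_homs\<close>] by (simp add: rep_homs_def)
    show "\<phi> \<in> (\<Pi>\<^sub>E v\<in>verts \<Gamma>. linear_maps (rspace \<rho> v) (rspace \<sigma> v))"
      using \<phi> by (simp add: rep_homs_def)
    fix v assume v: "v \<in> verts \<Gamma>"
    show "corner_hom \<Gamma> N act f v = \<phi> v"
    proof (rule PiE_ext[OF _ linear_maps_extensional[OF lin[OF v]]])
      show "corner_hom \<Gamma> N act f v \<in> carrier (corner N act v) \<rightarrow>\<^sub>E carrier (corner N' act' v)"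
        using gen_homs_corner[OF \<open>f \<in> gen_homs\<close> v] v by (simp add: corner_hom_def del: corner_simps)
      fix x assume x: "x \<in> carrier (corner N act v)"
      show "corner_hom \<Gamma> N act f v x = \<phi> v x"
        using on_corner[OF v x] v x by (simp only: corner_hom_def restrict_apply')
    qed
  qed
  ultimately show ?thesis by blast
qed

lemma bij_betw_corner_hom: "bij_betw (corner_hom \<Gamma> N act) gen_homs (rep_homs \<Gamma> \<rho> \<sigma>)"
proof (rule bij_betw_imageI)
  show "inj_on (corner_hom \<Gamma> N act) gen_homs"
    by (rule inj_onI) (rule corner_hom_inj)
  show "corner_hom \<Gamma> N act ` gen_homs = rep_homs \<Gamma> \<rho> \<sigma>"
  proof
    show "corner_hom \<Gamma> N act ` gen_homs \<subseteq> rep_homs \<Gamma> \<rho> \<sigma>"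
      by (rule image_subsetI) (rule corner_hom_in_rep_homs)
    show "rep_homs \<Gamma> \<rho> \<sigma> \<subseteq> corner_hom \<Gamma> N act ` gen_homs"
      using corner_hom_surj by (auto simp: image_iff)
  qed
qed

end

section \<open>The module of a representation\<close>

text \<open>\<open>M\<close> and \<open>N\<close> may have different record types, so agreement is
  expressed field by field instead of by an equation \<open>M = N\<close>.\<close>

lemma vspace_cong:
  fixes N :: "('f::field, 'u, 'z) module_scheme" and M :: "('f, 'u, 'y) module_scheme"
  assumes "vspace N" "carrier M = carrier N" "add M = add N" "\<zero>\<^bsub>M\<^esub> = \<zero>\<^bsub>N\<^esub>" "smult M = smult N"
  shows "vspace M"
proof -
  interpret N: vect N by (rule vect.intro) fact
  have "abelian_group M"
  proof (rule abelian_groupI)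
    fix x assume "x \<in> carrier M"
    then show "\<exists>y\<in>carrier M. y \<oplus>\<^bsub>M\<^esub> x = \<zero>\<^bsub>M\<^esub>"
      using assms by (intro bexI[of _ "\<ominus>\<^bsub>N\<^esub> x"]) (simp_all add: N.l_neg)
  qed (use assms in \<open>simp_all add: N.a_ac\<close>)
  then show ?thesis
    by (rule vspaceI) (use assms in \<open>simp_all add: N.smult_add_left N.smult_add_right N.smult_smult\<close>)
qed

text \<open>\<open>finsum\<close> takes the whole record as argument; agreement of fields is
  exploited through the identity map, which is linear from one record to the other.\<close>

lemma finsum_cong_record:
  assumes "vspace N" "carrier M = carrier N" "add M = add N" "\<zero>\<^bsub>M\<^esub> = \<zero>\<^bsub>N\<^esub>" "smult M = smult N"
    and "finite A" "\<And>a. a \<in> A \<Longrightarrow> f a \<in> carrier N"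
  shows "finsum M f A = finsum N f A"
proof -
  interpret N: vect N by (rule vect.intro) fact
  interpret M: vect M using vspace_cong[OF assms(1-5)] by (rule vect.intro)
  have lin: "(\<lambda>x\<in>carrier N. x) \<in> linear_maps N M"
    using assms(2-5) by (intro linear_mapsI) auto
  have "finsum N f A = (\<lambda>x\<in>carrier N. x) (finsum N f A)"
    using assms(7) N.finsum_closed[of f A] by (simp add: Pi_def)
  also have "\<dots> = finsum M (\<lambda>a. (\<lambda>x\<in>carrier N. x) (f a)) A"
    by (rule linear_maps_finsum[OF lin N.vspace M.vspace assms(6,7)])
  also have "\<dots> = finsum M f A"
    using assms(2,7) by (intro M.finsum_cong') auto
  finally show ?thesis by simp
qed

lemma biproduct_cong:
  assumes "biproduct I R N emb proj"
    and M: "carrier M = carrier N" "add M = add N" "\<zero>\<^bsub>M\<^esub> = \<zero>\<^bsub>N\<^esub>" "smult M = smult N"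
  shows "biproduct I R M emb proj"
proof -
  interpret B: biproduct I R N emb proj by fact
  show ?thesis
  proof (rule biproduct.intro)
    show "vspace M" by (rule vspace_cong[OF B.vspace_sum M])
    fix i assume i: "i \<in> I"
    show "emb i \<in> linear_maps (R i) M" using B.emb_linear[OF i] M by (simp add: linear_maps_def)
    show "proj i \<in> linear_maps M (R i)" using B.proj_linear[OF i] M by (simp add: linear_maps_def)
  next
    fix y assume "y \<in> carrier M"
    then have y: "y \<in> carrier N" using M by simp
    have "finsum M (\<lambda>i. emb i (proj i y)) {i \<in> I. proj i y \<noteq> \<zero>\<^bsub>R i\<^esub>} =
        finsum N (\<lambda>i. emb i (proj i y)) {i \<in> I. proj i y \<noteq> \<zero>\<^bsub>R i\<^esub>}"
      using y by (intro finsum_cong_record[OF B.vspace_sum M B.finite_support])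
        (auto intro: B.emb_closed B.proj_closed)
    then show "y = finsum M (\<lambda>i. emb i (proj i y)) {i \<in> I. proj i y \<noteq> \<zero>\<^bsub>R i\<^esub>}"
      using B.decomposition[OF y] by simp
  qed (use M in \<open>simp_all add: B.vspace_summand B.proj_emb B.proj_emb_other B.finite_support\<close>)
qed

text \<open>\<open>k\<close> plays the part of the ghost arrows; its assumptions are exactly what
  \<open>condition_I_inverse\<close> delivers from (I).\<close>

locale rep_biproduct = finitely_separated_digraph \<Gamma> P + biproduct "verts \<Gamma>" "rspace \<rho>" N emb proj
  for \<Gamma> :: "('v, 'e) pre_digraph" and P :: "'e set set"
    and \<rho> :: "('v, 'e, 'f::field, 'u, 'x) quiver_rep_scheme"
    and N :: "('f, 'u, 'z) module_scheme"
    and emb :: "'v \<Rightarrow> 'u \<Rightarrow> 'u" and proj :: "'v \<Rightarrow> 'u \<Rightarrow> 'u" +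
  fixes k :: "'e \<Rightarrow> 'u \<Rightarrow> 'u"
  assumes rep: "is_quiver_rep \<Gamma> \<rho>"
    and k_linear: "e \<in> arcs \<Gamma> \<Longrightarrow> k e \<in> linear_maps (rspace \<rho> (head \<Gamma> e)) (rspace \<rho> (tail \<Gamma> e))"
    and rmap_k: "\<lbrakk>X \<in> P; e \<in> X; f \<in> X; y \<in> carrier (rspace \<rho> (head \<Gamma> e))\<rbrakk>
      \<Longrightarrow> rmap \<rho> f (k e y) = (if e = f then y else \<zero>\<^bsub>rspace \<rho> (head \<Gamma> f)\<^esub>)"
    and k_rmap: "\<lbrakk>X \<in> P; x \<in> carrier (rspace \<rho> (part_source \<Gamma> X))\<rbrakk>
      \<Longrightarrow> x = finsum (rspace \<rho> (part_source \<Gamma> X)) (\<lambda>e. k e (rmap \<rho> e x)) X"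
begin

lemma rmap_linear: "e \<in> arcs \<Gamma> \<Longrightarrow> rmap \<rho> e \<in> linear_maps (rspace \<rho> (tail \<Gamma> e)) (rspace \<rho> (head \<Gamma> e))"
  using rep by (simp add: is_quiver_rep_def)

text \<open>Operators on the direct sum with a single nonzero block, leading from the vertex where
  the generator starts to the vertex where it ends; for \<open>Ghost e\<close> these are the head
  and the tail of \<open>e\<close>.\<close>

primrec rep_act :: "('v, 'e) lpa_gen \<Rightarrow> 'u \<Rightarrow> 'u" where
  "rep_act (Vertex v) x = emb v (proj v x)"
| "rep_act (Arrow e) x = emb (head \<Gamma> e) (rmap \<rho> e (proj (tail \<Gamma> e) x))"
| "rep_act (Ghost e) x = emb (tail \<Gamma> e) (k e (proj (head \<Gamma> e) x))"

lemma rmap_closed: "\<lbrakk>e \<in> arcs \<Gamma>; x \<in> carrier (rspace \<rho> (tail \<Gamma> e))\<rbrakk> \<Longrightarrow> rmap \<rho> e x \<in> carrier (rspace \<rho> (head \<Gamma> e))"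
  by (rule linear_maps_closed[OF rmap_linear])

lemma k_closed: "\<lbrakk>e \<in> arcs \<Gamma>; x \<in> carrier (rspace \<rho> (head \<Gamma> e))\<rbrakk> \<Longrightarrow> k e x \<in> carrier (rspace \<rho> (tail \<Gamma> e))"
  by (rule linear_maps_closed[OF k_linear])

text \<open>An embedding followed by a projection is the identity or zero, so consecutive blocks
  multiply when their vertices match, and the relations reduce to those between \<open>rmap\<close>
  and \<open>k\<close>.\<close>

lemma unital_generator_module_rep_act: "unital_generator_module \<Gamma> P N rep_act"
proof (intro unital_generator_module.intro unital_generator_module_axioms.intro
    generator_module.intro generator_module_axioms.intro)
  show "finitely_separated_digraph \<Gamma> P" by unfold_locales
  show "vect N" by (rule sum.vect_axioms)
  fix x assume x: "x \<in> carrier N"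
  then have pr: "proj v x \<in> carrier (rspace \<rho> v)" if "v \<in> verts \<Gamma>" for v
    using that by (simp add: proj_closed)
  note [simp] = x pr emb_closed rmap_closed k_closed proj_emb
  {
    fix g :: "('v, 'e) lpa_gen" assume g: "g \<in> lpa_gens \<Gamma>"
    show "rep_act g x \<in> carrier N" using g by (cases g) simp_all
    show "rep_act g (x \<oplus>\<^bsub>N\<^esub> y) = rep_act g x \<oplus>\<^bsub>N\<^esub> rep_act g y" if y: "y \<in> carrier N" for y
      using g y by (cases g) (simp_all add: proj_closed linear_maps_add[OF proj_linear] linear_maps_add[OF emb_linear]
        linear_maps_add[OF rmap_linear] linear_maps_add[OF k_linear])
    show "rep_act g (c \<odot>\<^bsub>N\<^esub> x) = c \<odot>\<^bsub>N\<^esub> rep_act g x" for c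
      using g by (cases g) (simp_all add: linear_maps_smult[OF proj_linear] linear_maps_smult[OF emb_linear]
        linear_maps_smult[OF rmap_linear] linear_maps_smult[OF k_linear])
  }
  show "rep_act (Vertex w) (rep_act (Vertex v) x) = (if v = w then rep_act (Vertex v) x else \<zero>\<^bsub>N\<^esub>)"
    if "v \<in> verts \<Gamma>" "w \<in> verts \<Gamma>" for v w
    using that by (simp add: proj_emb_other emb_zero)
  {
    fix e assume e: "e \<in> arcs \<Gamma>"
    then show "rep_act (Arrow e) (rep_act (Vertex (tail \<Gamma> e)) x) = rep_act (Arrow e) x"
      "rep_act (Vertex (head \<Gamma> e)) (rep_act (Arrow e) x) = rep_act (Arrow e) x"
      "rep_act (Ghost e) (rep_act (Vertex (head \<Gamma> e)) x) = rep_act (Ghost e) x"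
      "rep_act (Vertex (tail \<Gamma> e)) (rep_act (Ghost e) x) = rep_act (Ghost e) x"
      by simp_all
  }
  show "rep_act (Arrow f) (rep_act (Ghost e) x) = (if e = f then rep_act (Vertex (head \<Gamma> e)) x else \<zero>\<^bsub>N\<^esub>)"
    if X: "X \<in> P" "e \<in> X" "f \<in> X" for X e f
  proof -
    have e: "e \<in> arcs \<Gamma>" "f \<in> arcs \<Gamma>" using part_arcs X by auto
    \<comment> \<open>\<open>e\<close> and \<open>f\<close> share their tail, so the embedding and
      the projection in between cancel.\<close>
    have "rep_act (Arrow f) (rep_act (Ghost e) x) = emb (head \<Gamma> f) (rmap \<rho> f (k e (proj (head \<Gamma> e) x)))"
      using e pr[OF head_in_verts[OF e(1)]] k_closed[OF e(1), of "proj (head \<Gamma> e) x"]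
      by (simp add: same_source[OF X])
    then show ?thesis using e rmap_k[OF X] by (auto simp: emb_zero)
  qed
  show "rep_act (Vertex (part_source \<Gamma> X)) x = finsum N (\<lambda>e. rep_act (Ghost e) (rep_act (Arrow e) x)) X"
    if X: "X \<in> P" for X
  proof -
    let ?s = "part_source \<Gamma> X"
    have e: "e \<in> arcs \<Gamma>" "tail \<Gamma> e = ?s" if "e \<in> X" for e
      using part_arcs[OF X that] part_source_eq[OF X that] by simp_all
    have s: "?s \<in> verts \<Gamma>" by (rule part_source_vert[OF X])
    have mem: "k e (rmap \<rho> e (proj ?s x)) \<in> carrier (rspace \<rho> ?s)" if "e \<in> X" for e
      using k_closed[OF e(1)[OF that] rmap_closed[OF e(1)[OF that]]] pr[OF s] e(2)[OF that] by simp
    have "emb ?s (proj ?s x) = emb ?s (finsum (rspace \<rho> ?s) (\<lambda>e. k e (rmap \<rho> e (proj ?s x))) X)"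
      by (rule arg_cong[OF k_rmap[OF X pr[OF s]]])
    also have "\<dots> = finsum N (\<lambda>e. emb ?s (k e (rmap \<rho> e (proj ?s x)))) X"
      by (rule linear_maps_finsum[OF emb_linear[OF s] vspace_summand[OF s] vspace_sum finite_part[OF X] mem])
    also have "\<dots> = finsum N (\<lambda>e. rep_act (Ghost e) (rep_act (Arrow e) x)) X"
    proof (rule sum.finsum_cong')
      show "emb ?s (k e (rmap \<rho> e (proj ?s x))) = rep_act (Ghost e) (rep_act (Arrow e) x)" if "e \<in> X" for e
        using e[OF that] pr[OF s] rmap_closed[OF e(1)[OF that], of "proj ?s x"] by simp
      then show "(\<lambda>e. rep_act (Ghost e) (rep_act (Arrow e) x)) \<in> X \<rightarrow> carrier N"
        using emb_closed[OF s mem] by (intro Pi_I) metis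
    qed simp
    finally show ?thesis by simp
  qed
  \<comment> \<open>Here the vertex decomposition is the decomposition of the direct sum
    itself.\<close>
  show "\<exists>F. finite F \<and> F \<subseteq> verts \<Gamma> \<and> x = finsum N (\<lambda>v. rep_act (Vertex v) x) F"
    using finite_support[OF x] decomposition[OF x]
    by (intro exI[of _ "{v \<in> verts \<Gamma>. proj v x \<noteq> \<zero>\<^bsub>rspace \<rho> v\<^esub>}"]) auto
qed

end

lemma (in generator_module) gen_act_coset_act:
  fixes M :: "('f, 'u, ('v, 'e, 'f) lpa_elem, 'y) rmod_scheme"
  assumes "ract M = coset_act" "g \<in> lpa_gens \<Gamma>" "x \<in> carrier N"
  shows "gen_act \<Gamma> P M g x = act g x"
  using assms by (simp add: gen_act_def coset_act poly_act_gen)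

context rep_biproduct
begin

text \<open>The extension \<open>z\<close> is \<open>()\<close> for a plain module and carries the
  grading for a graded one.\<close>

definition rep_module :: "'y \<Rightarrow> ('f, 'u, ('v, 'e, 'f) lpa_elem, 'y) rmod_scheme" where
  "rep_module z = \<lparr>carrier = carrier N, mult = undefined, one = undefined, ring.zero = \<zero>\<^bsub>N\<^esub>,
     add = add N, smult = smult N, ract = generator_module.coset_act \<Gamma> P N rep_act, \<dots> = z\<rparr>"

lemma rep_module_simps [simp]:
  "carrier (rep_module z) = carrier N" "add (rep_module z) = add N" "\<zero>\<^bsub>rep_module z\<^esub> = \<zero>\<^bsub>N\<^esub>"
  "smult (rep_module z) = smult N" "ract (rep_module z) = generator_module.coset_act \<Gamma> P N rep_act"
  by (simp_all add: rep_module_def)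

lemma biproduct_rep_module: "biproduct (verts \<Gamma>) (rspace \<rho>) (rep_module z) emb proj"
  by (rule biproduct_cong[OF biproduct_axioms]) simp_all

lemma gen_act_rep_module:
  "\<lbrakk>g \<in> lpa_gens \<Gamma>; x \<in> carrier N\<rbrakk> \<Longrightarrow> gen_act \<Gamma> P (rep_module z) g x = rep_act g x"
  by (rule generator_module.gen_act_coset_act[OF unital_generator_module.axioms(1)[OF unital_generator_module_rep_act]])
    simp_all

lemma unital_right_module_rep_module:
  "unital_right_module (leavitt_path_algebra \<Gamma> P) (rep_module z)"
proof (rule unital_right_module_if_unital_generator_module)
  interpret U: unital_generator_module \<Gamma> P N rep_act by (rule unital_generator_module_rep_act)
  have "vspace (rep_module z)" by (rule vspace_cong[OF vspace_sum]) simp_all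
  then show rm: "right_module (leavitt_path_algebra \<Gamma> P) (rep_module z)"
    by (rule U.right_module_coset_act) simp_all
  show "unital_generator_module \<Gamma> P (rep_module z) (gen_act \<Gamma> P (rep_module z))"
  proof (intro unital_generator_module.intro unital_generator_module_axioms.intro)
    show "generator_module \<Gamma> P (rep_module z) (gen_act \<Gamma> P (rep_module z))"
      by (rule generator_module_gen_act[OF rm])
    fix x assume "x \<in> carrier (rep_module z)"
    then have x: "x \<in> carrier N" by simp
    obtain F where F: "finite F" "F \<subseteq> verts \<Gamma>" "x = finsum N (\<lambda>v. rep_act (Vertex v) x) F"
      using U.vertex_decomposition[OF x] by blast
    have eqv: "gen_act \<Gamma> P (rep_module z) (Vertex v) x = rep_act (Vertex v) x" if "v \<in> F" for v
      using that F(2) x by (intro gen_act_rep_module) auto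
    have memv: "rep_act (Vertex v) x \<in> carrier N" if "v \<in> F" for v
      using that F(2) x by (intro U.act_closed) auto
    have "finsum (rep_module z) (\<lambda>v. gen_act \<Gamma> P (rep_module z) (Vertex v) x) F =
        finsum N (\<lambda>v. gen_act \<Gamma> P (rep_module z) (Vertex v) x) F"
      by (rule finsum_cong_record[OF vspace_sum _ _ _ _ F(1)]) (simp_all only: rep_module_simps eqv memv)
    also have "\<dots> = finsum N (\<lambda>v. rep_act (Vertex v) x) F"
      using eqv memv by (intro sum.finsum_cong' Pi_I) auto
    finally have "x = finsum (rep_module z) (\<lambda>v. gen_act \<Gamma> P (rep_module z) (Vertex v) x) F" using F(3) by simp
    with F(1,2) show "\<exists>F. finite F \<and> F \<subseteq> verts \<Gamma> \<and>
        x = finsum (rep_module z) (\<lambda>v. gen_act \<Gamma> P (rep_module z) (Vertex v) x) F" by blast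
  qed
qed

lemma corner_rep_module:
  assumes v: "v \<in> verts \<Gamma>"
  shows "carrier (corner (rep_module z) (gen_act \<Gamma> P (rep_module z)) v) = {x \<in> carrier N. emb v (proj v x) = x}"
  using v by (auto simp: gen_act_rep_module)

lemma emb_corner:
  assumes v: "v \<in> verts \<Gamma>" and "x \<in> carrier (rspace \<rho> v)"
  shows "emb v x \<in> carrier (corner (rep_module z) (gen_act \<Gamma> P (rep_module z)) v)"
  unfolding corner_rep_module[OF v] using assms by (simp add: emb_closed proj_emb)

section \<open>Comparison of the corners with the given representation\<close>

context
  fixes \<sigma> :: "('v, 'e, 'f, 'u, 'x) quiver_rep_scheme" and z :: 'y
  assumes \<sigma>: "rspace \<sigma> = corner (rep_module z) (gen_act \<Gamma> P (rep_module z))"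
    "rmap \<sigma> = corner_map \<Gamma> (rep_module z) (gen_act \<Gamma> P (rep_module z))"
begin

text \<open>The corner at \<open>v\<close> is the image of \<open>emb v\<close> inside the direct
  sum, so \<open>proj v\<close> restricted to it is inverse to \<open>emb v\<close>. The restriction
  also makes the map extensional, as morphisms have to be.\<close>

definition proj_hom :: "'v \<Rightarrow> 'u \<Rightarrow> 'u" where
  "proj_hom = (\<lambda>v\<in>verts \<Gamma>. \<lambda>x\<in>carrier (rspace \<sigma> v). proj v x)"

definition emb_hom :: "'v \<Rightarrow> 'u \<Rightarrow> 'u" where
  "emb_hom = restrict emb (verts \<Gamma>)"

lemma carrier_\<sigma>: "v \<in> verts \<Gamma> \<Longrightarrow> carrier (rspace \<sigma> v) = {x \<in> carrier N. emb v (proj v x) = x}"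
  unfolding \<sigma> by (rule corner_rep_module)

lemma ops_\<sigma>: "add (rspace \<sigma> v) = add N" "smult (rspace \<sigma> v) = smult N"
  by (simp_all add: \<sigma>)

lemma rmap_\<sigma>: "\<lbrakk>e \<in> arcs \<Gamma>; x \<in> carrier (rspace \<sigma> (tail \<Gamma> e))\<rbrakk>
    \<Longrightarrow> rmap \<sigma> e x = emb (head \<Gamma> e) (rmap \<rho> e (proj (tail \<Gamma> e) x))"
  using gen_act_rep_module[of "Arrow e" x z] carrier_\<sigma>[of "tail \<Gamma> e"]
  unfolding \<sigma> by (auto simp: corner_map_def)

lemma proj_hom: "proj_hom \<in> rep_homs \<Gamma> \<sigma> \<rho>"
proof -
  have "(\<lambda>x\<in>carrier (rspace \<sigma> v). proj v x) \<in> linear_maps (rspace \<sigma> v) (rspace \<rho> v)" if v: "v \<in> verts \<Gamma>" for v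
    using v by (intro linear_mapsI)
      (auto simp: carrier_\<sigma> ops_\<sigma> proj_closed linear_maps_add[OF proj_linear] linear_maps_smult[OF proj_linear]
        linear_maps_add[OF emb_linear] linear_maps_smult[OF emb_linear])
  moreover have "proj_hom (head \<Gamma> e) (rmap \<sigma> e x) = rmap \<rho> e (proj_hom (tail \<Gamma> e) x)"
    if e: "e \<in> arcs \<Gamma>" and x: "x \<in> carrier (rspace \<sigma> (tail \<Gamma> e))" for e x
  proof -
    have xN: "x \<in> carrier N" using x carrier_\<sigma>[of "tail \<Gamma> e"] e by simp
    then have "emb (head \<Gamma> e) (rmap \<rho> e (proj (tail \<Gamma> e) x)) \<in> carrier (rspace \<sigma> (head \<Gamma> e))"
      unfolding \<sigma> using e by (intro emb_corner rmap_closed proj_closed) auto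
    then show ?thesis
      using e x xN by (simp add: proj_hom_def rmap_\<sigma> proj_emb rmap_closed proj_closed)
  qed
  ultimately show ?thesis by (auto simp: rep_homs_def proj_hom_def)
qed

lemma emb_hom: "emb_hom \<in> rep_homs \<Gamma> \<rho> \<sigma>"
proof -
  have "emb v \<in> linear_maps (rspace \<rho> v) (rspace \<sigma> v)" if v: "v \<in> verts \<Gamma>" for v
  proof (rule linear_mapsI)
    show "emb v \<in> carrier (rspace \<rho> v) \<rightarrow>\<^sub>E carrier (rspace \<sigma> v)"
      using linear_maps_extensional[OF emb_linear[OF v]] emb_corner[OF v]
      unfolding \<sigma> by (auto simp: PiE_def simp del: corner_simps)
  qed (use v in \<open>simp_all add: ops_\<sigma> linear_maps_add[OF emb_linear] linear_maps_smult[OF emb_linear]\<close>)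
  moreover have "emb_hom (head \<Gamma> e) (rmap \<rho> e x) = rmap \<sigma> e (emb_hom (tail \<Gamma> e) x)"
    if e: "e \<in> arcs \<Gamma>" and x: "x \<in> carrier (rspace \<rho> (tail \<Gamma> e))" for e x
    using e x rmap_\<sigma>[OF e, of "emb (tail \<Gamma> e) x"] emb_corner[of "tail \<Gamma> e" x z]
    unfolding \<sigma>[symmetric] by (simp add: emb_hom_def proj_emb)
  ultimately show ?thesis by (auto simp: rep_homs_def emb_hom_def)
qed

lemma proj_emb_hom:
  "(\<lambda>v\<in>verts \<Gamma>. compose (carrier (rspace \<sigma> v)) (emb_hom v) (proj_hom v)) =
    (\<lambda>v\<in>verts \<Gamma>. \<lambda>x\<in>carrier (rspace \<sigma> v). x)"
  by (auto simp: fun_eq_iff restrict_def compose_def emb_hom_def proj_hom_def carrier_\<sigma>)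

lemma emb_proj_hom:
  "(\<lambda>v\<in>verts \<Gamma>. compose (carrier (rspace \<rho> v)) (proj_hom v) (emb_hom v)) =
    (\<lambda>v\<in>verts \<Gamma>. \<lambda>x\<in>carrier (rspace \<rho> v). x)"
  by (auto simp: fun_eq_iff restrict_def compose_def emb_hom_def proj_hom_def carrier_\<sigma> proj_emb emb_closed)

end

end

section \<open>Graded representations\<close>

text \<open>Moving the total to the other side puts its negative into degree \<open>m\<close> and
  leaves a vanishing sum of homogeneous terms; independence kills the terms of other degrees. The
  reindexing \<open>h\<close> accommodates the shift of degree along an arrow.\<close>

lemma int_graded_component:
  fixes M :: "('f::field, 'u, 'z) module_scheme"
  assumes "vspace M" "int_graded M D" "finite S" "inj_on h S"
    and c: "\<And>n. n \<in> S \<Longrightarrow> c n \<in> D (h n)" and x: "finsum M c S \<in> D m" and n: "n \<in> S" "h n \<noteq> m"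
  shows "c n = \<zero>\<^bsub>M\<^esub>"
proof -
  interpret M: vect M by (rule vect.intro) fact
  have sub: "submodule (D j) (scalar_field :: 'f ring) M" for j
    using assms(2) by (simp add: int_graded_def)
  note D = M.submodule_vspaceD[OF sub]
  have ind: "d j = \<zero>\<^bsub>M\<^esub>" if "finite T" "\<forall>j\<in>T. d j \<in> D j" "finsum M d T = \<zero>\<^bsub>M\<^esub>" "j \<in> T" for T d j
    using assms(2) that unfolding int_graded_iff[OF assms(1)] by blast
  let ?x = "finsum M c S" and ?T = "insert m (h ` S)"
  \<comment> \<open>\<open>?c\<close> places \<open>c n\<close> in degree \<open>h n\<close>, which
    is possible as \<open>h\<close> is injective on \<open>S\<close>, and \<open>?y\<close> below
    places minus the total in degree \<open>m\<close>.\<close>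
  let ?c = "\<lambda>j. if j \<in> h ` S then c (inv_into S h j) else \<zero>\<^bsub>M\<^esub>"
  let ?y = "\<lambda>j. if j = m then (- 1) \<odot>\<^bsub>M\<^esub> ?x else \<zero>\<^bsub>M\<^esub>"
  have cD: "?c j \<in> D j" and yD: "?y j \<in> D j" for j
    using c[of "inv_into S h j"] D(2) D(4)[OF x] by (auto simp: inv_into_into f_inv_into_f)
  have carr: "?c j \<in> carrier M" "?y j \<in> carrier M" for j
    using cD[of j] yD[of j] D(1)[of j] by blast+
  have cM: "c j \<in> carrier M" if "j \<in> S" for j using c[OF that] D(1) by blast
  have xM: "?x \<in> carrier M" using x D(1) by blast
  have "finsum M ?c ?T = finsum M ?c (h ` S)"
  proof (rule M.finsum_superset)
    show "?c j \<in> carrier M" for j by (rule carr)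
  qed (use assms(3) in auto)
  also have "\<dots> = finsum M (\<lambda>j. ?c (h j)) S"
    using cM assms(4) by (intro M.finsum_reindex) auto
  also have "\<dots> = ?x"
    using cM assms(4) by (intro M.finsum_cong') auto
  finally have "finsum M ?c ?T = ?x" .
  moreover have "finsum M ?y ?T = finsum M ?y {m}"
    using assms(3) xM by (intro M.finsum_superset) auto
  then have "finsum M ?y ?T = (- 1) \<odot>\<^bsub>M\<^esub> ?x"
    using xM by simp
  ultimately have "finsum M (\<lambda>j. ?c j \<oplus>\<^bsub>M\<^esub> ?y j) ?T = \<zero>\<^bsub>M\<^esub>"
    using carr xM by (subst M.finsum_addf) (auto simp: M.smult_minus_1 M.r_neg)
  moreover have "\<forall>j\<in>?T. ?c j \<oplus>\<^bsub>M\<^esub> ?y j \<in> D j"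
    using D(3)[OF cD yD] by (rule ballI)
  moreover have "finite ?T" using assms(3) by simp
  ultimately have "?c (h n) \<oplus>\<^bsub>M\<^esub> ?y (h n) = \<zero>\<^bsub>M\<^esub>"
    using n(1) by (intro ind[of ?T "\<lambda>j. ?c j \<oplus>\<^bsub>M\<^esub> ?y j"]) auto
  then show ?thesis using n cM[OF n(1)] assms(4) by simp
qed

text \<open>Degrees of letters add up along a word, and an element of
  \<open>lpa_grade \<Gamma> P n\<close> has a representative all of whose words have degree
  \<open>n\<close>.\<close>

lemma (in generator_module) coset_act_grade:
  assumes G: "\<And>m. submodule (G m) (scalar_field :: 'f ring) N"
    and act: "\<And>g m x. \<lbrakk>g \<in> lpa_gens \<Gamma>; x \<in> G m\<rbrakk> \<Longrightarrow> act g x \<in> G (m + gen_degree g)"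
    and a: "a \<in> lpa_grade \<Gamma> P n" and x: "x \<in> G m"
  shows "coset_act x a \<in> G (m + n)"
proof -
  note D = submodule_vspaceD[OF G]
  obtain p where p: "p \<in> polys" "a = lpa_coset \<Gamma> P p"
    and deg: "\<And>w. w \<in> Poly_Mapping.keys p \<Longrightarrow> sum_list (map gen_degree (letters w)) = n"
    using a by (auto simp: lpa_grade_def)
  have xN: "x \<in> carrier N" using x D(1) by blast
  have word: "foldl (\<lambda>y g. act g y) x gs \<in> G (m + sum_list (map gen_degree gs))"
    if "set gs \<subseteq> lpa_gens \<Gamma>" for gs
    using that x
  proof (induction gs arbitrary: x m)
    case (Cons g gs)
    then have "act g x \<in> G (m + gen_degree g)" by (intro act) auto
    from Cons.IH[OF _ this] Cons.prems(1) show ?case by (simp add: add.assoc)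
  qed simp
  have "coset_act x a = poly_act p x" unfolding p(2) by (rule coset_act[OF p(1) xN])
  also have "\<dots> \<in> G (m + n)"
    unfolding poly_act_def
  proof (rule finsum_mem[OF _ D(2) D(1) D(3)])
    fix w assume w: "w \<in> Poly_Mapping.keys p"
    have "set (letters w) \<subseteq> lpa_gens \<Gamma>" using p(1) w by (auto simp: carrier_free_algebra)
    then have "word_act w x \<in> G (m + n)" using word[of "letters w"] deg[OF w] by (simp add: word_act_def)
    then show "Poly_Mapping.lookup p w \<odot> word_act w x \<in> G (m + n)" by (rule D(4))
  qed simp
  finally show ?thesis .
qed

locale graded_rep_biproduct = rep_biproduct \<Gamma> P \<rho> N emb proj k
  for \<Gamma> :: "('v, 'e) pre_digraph" and P :: "'e set set"
    and \<rho> :: "('v, 'e, 'f::field, 'u, 'x) quiver_rep_scheme"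
    and N :: "('f, 'u, 'z) module_scheme"
    and emb :: "'v \<Rightarrow> 'u \<Rightarrow> 'u" and proj :: "'v \<Rightarrow> 'u \<Rightarrow> 'u" and k :: "'e \<Rightarrow> 'u \<Rightarrow> 'u" +
  fixes D :: "'v \<Rightarrow> int \<Rightarrow> 'u set"
  assumes rep_graded: "v \<in> verts \<Gamma> \<Longrightarrow> int_graded (rspace \<rho> v) (D v)"
    and rmap_grade: "\<lbrakk>e \<in> arcs \<Gamma>; x \<in> D (tail \<Gamma> e) n\<rbrakk> \<Longrightarrow> rmap \<rho> e x \<in> D (head \<Gamma> e) (n + 1)"
begin

lemma D_submodule:
  assumes "v \<in> verts \<Gamma>"
  shows "D v n \<subseteq> carrier (rspace \<rho> v)" "\<zero>\<^bsub>rspace \<rho> v\<^esub> \<in> D v n"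
    "\<lbrakk>x \<in> D v n; y \<in> D v n\<rbrakk> \<Longrightarrow> x \<oplus>\<^bsub>rspace \<rho> v\<^esub> y \<in> D v n" "x \<in> D v n \<Longrightarrow> c \<odot>\<^bsub>rspace \<rho> v\<^esub> x \<in> D v n"
proof -
  interpret V: vect "rspace \<rho> v" by (rule vect.intro[OF vspace_summand[OF assms]])
  have sub: "submodule (D v n) (scalar_field :: 'f ring) (rspace \<rho> v)"
    using rep_graded[OF assms] by (simp add: int_graded_def)
  show "D v n \<subseteq> carrier (rspace \<rho> v)" "\<zero>\<^bsub>rspace \<rho> v\<^esub> \<in> D v n"
    "\<lbrakk>x \<in> D v n; y \<in> D v n\<rbrakk> \<Longrightarrow> x \<oplus>\<^bsub>rspace \<rho> v\<^esub> y \<in> D v n" "x \<in> D v n \<Longrightarrow> c \<odot>\<^bsub>rspace \<rho> v\<^esub> x \<in> D v n"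
    by (rule V.submodule_vspaceD[OF sub]; assumption)+
qed

text \<open>Arrows send the component of \<open>z\<close> of degree \<open>m\<close> into degree
  \<open>m + 1\<close>. Unless \<open>m + 1 = n\<close>, its image under every arrow of
  \<open>X\<close> is zero, and then \<open>k_rmap\<close>, which embodies injectivity in (I), makes
  the component itself zero.\<close>

lemma grade_if_arrows:
  assumes X: "X \<in> P" and z: "z \<in> carrier (rspace \<rho> (part_source \<Gamma> X))"
    and arrows: "\<And>f. f \<in> X \<Longrightarrow> rmap \<rho> f z \<in> D (head \<Gamma> f) n"
  shows "z \<in> D (part_source \<Gamma> X) (n - 1)"
proof -
  let ?s = "part_source \<Gamma> X"
  have s: "?s \<in> verts \<Gamma>" by (rule part_source_vert[OF X])
  have e: "e \<in> arcs \<Gamma>" "tail \<Gamma> e = ?s" "head \<Gamma> e \<in> verts \<Gamma>" if "e \<in> X" for e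
    using part_arcs[OF X that] part_source_eq[OF X that] head_in_verts by simp_all
  interpret S: vect "rspace \<rho> ?s" by (rule vect.intro[OF vspace_summand[OF s]])
  obtain S c where S: "finite S" and c: "\<forall>m\<in>S. c m \<in> D ?s m" and zc: "z = finsum (rspace \<rho> ?s) c S"
    using rep_graded[OF s] z unfolding int_graded_iff[OF vspace_summand[OF s]] by blast
  have cS: "c m \<in> carrier (rspace \<rho> ?s)" if "m \<in> S" for m using c that D_submodule(1)[OF s] by blast
  have zero: "c m = \<zero>\<^bsub>rspace \<rho> ?s\<^esub>" if m: "m \<in> S" "m \<noteq> n - 1" for m
  proof -
    have f0: "rmap \<rho> f (c m) = \<zero>\<^bsub>rspace \<rho> (head \<Gamma> f)\<^esub>" if f: "f \<in> X" for f
    proof (rule int_graded_component[OF vspace_summand[OF e(3)[OF f]] rep_graded[OF e(3)[OF f]] S,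
          where h = "\<lambda>m. m + 1" and m = n])
      show "rmap \<rho> f (c m) \<in> D (head \<Gamma> f) (m + 1)" if "m \<in> S" for m
        using rmap_grade[OF e(1)[OF f], of "c m" m] e(2)[OF f] c that by simp
      have "rmap \<rho> f z = finsum (rspace \<rho> (head \<Gamma> f)) (\<lambda>m. rmap \<rho> f (c m)) S"
        unfolding zc
        by (rule linear_maps_finsum[OF rmap_linear[OF e(1)[OF f], unfolded e(2)[OF f]]
            vspace_summand[OF s] vspace_summand[OF e(3)[OF f]] S cS])
      then show "finsum (rspace \<rho> (head \<Gamma> f)) (\<lambda>m. rmap \<rho> f (c m)) S \<in> D (head \<Gamma> f) n"
        using arrows[OF f] by simp
    qed (use m in \<open>simp_all add: inj_on_def\<close>)
    have "c m = finsum (rspace \<rho> ?s) (\<lambda>f. k f (rmap \<rho> f (c m))) X" by (rule k_rmap[OF X cS[OF m(1)]])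
    also have "\<dots> = finsum (rspace \<rho> ?s) (\<lambda>f. \<zero>\<^bsub>rspace \<rho> ?s\<^esub>) X"
    proof (rule S.finsum_cong')
      fix f assume f: "f \<in> X"
      show "k f (rmap \<rho> f (c m)) = \<zero>\<^bsub>rspace \<rho> ?s\<^esub>"
        using linear_maps_zero[OF k_linear[OF e(1)[OF f]] vspace_summand[OF e(3)[OF f]]] s e(2)[OF f] vspace_summand[OF s]
        by (simp add: f0[OF f])
    qed auto
    finally show ?thesis by simp
  qed
  \<comment> \<open>Every component outside degree \<open>n - 1\<close> is zero and therefore also
    lies in that degree.\<close>
  show ?thesis unfolding zc
  proof (rule S.finsum_mem[OF S D_submodule(2)[OF s] D_submodule(1)[OF s] D_submodule(3)[OF s]])
    fix m assume "m \<in> S"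
    then show "c m \<in> D ?s (n - 1)" using zero[of m] c D_submodule(2)[OF s] by (cases "m = n - 1") auto
  qed
qed

text \<open>The arrows in the part of \<open>e\<close> send \<open>k e y\<close> to \<open>y\<close>
  or to zero, and zero has every degree.\<close>

lemma k_grade:
  assumes e: "e \<in> arcs \<Gamma>" and y: "y \<in> D (head \<Gamma> e) n"
  shows "k e y \<in> D (tail \<Gamma> e) (n - 1)"
proof -
  obtain X where X: "X \<in> P" "e \<in> X" using part_exists[OF e] by blast
  have yc: "y \<in> carrier (rspace \<rho> (head \<Gamma> e))" using y D_submodule(1)[OF head_in_verts[OF e]] by blast
  have "k e y \<in> D (part_source \<Gamma> X) (n - 1)"
  proof (rule grade_if_arrows[OF X(1)])
    show "k e y \<in> carrier (rspace \<rho> (part_source \<Gamma> X))"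
      using k_closed[OF e yc] part_source_eq[OF X] by simp
    show "rmap \<rho> f (k e y) \<in> D (head \<Gamma> f) n" if f: "f \<in> X" for f
      using rmap_k[OF X f yc] y D_submodule(2)[OF head_in_verts[OF part_arcs[OF X(1) f]]]
      by (cases "e = f") simp_all
  qed
  then show ?thesis using part_source_eq[OF X] by simp
qed

definition sum_grade :: "int \<Rightarrow> 'u set" where
  "sum_grade n = {x \<in> carrier N. \<forall>v\<in>verts \<Gamma>. proj v x \<in> D v n}"

lemma emb_grade: "\<lbrakk>v \<in> verts \<Gamma>; x \<in> D v n\<rbrakk> \<Longrightarrow> emb v x \<in> sum_grade n"
proof -
  assume v: "v \<in> verts \<Gamma>" and x: "x \<in> D v n"
  then have xv: "x \<in> carrier (rspace \<rho> v)" using D_submodule(1) by blast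
  have "proj w (emb v x) \<in> D w n" if "w \<in> verts \<Gamma>" for w
    using that v x xv D_submodule(2)[OF that] by (cases "w = v") (simp_all add: proj_emb proj_emb_other)
  then show ?thesis using emb_closed[OF v xv] by (simp add: sum_grade_def)
qed

lemma rep_act_grade:
  assumes "g \<in> lpa_gens \<Gamma>" "x \<in> sum_grade m"
  shows "rep_act g x \<in> sum_grade (m + gen_degree g)"
proof -
  have p: "proj v x \<in> D v m" if "v \<in> verts \<Gamma>" for v using assms(2) that by (simp add: sum_grade_def)
  show ?thesis
  proof (cases g)
    case (Vertex v)
    then show ?thesis using assms(1) p emb_grade by simp
  next
    case (Arrow e)
    then show ?thesis using assms(1) p emb_grade rmap_grade by simp
  next
    case (Ghost e)
    then show ?thesis using assms(1) p emb_grade k_grade[of e "proj (head \<Gamma> e) x" m] by simp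
  qed
qed

abbreviation graded_rep_module :: "('f, 'u, ('v, 'e, 'f) lpa_elem) graded_rmod" where
  "graded_rep_module \<equiv> rep_module (graded_rmod.fields sum_grade)"

lemma grade_rep_module: "grade graded_rep_module = sum_grade"
  by (simp add: rep_module_def graded_rmod.defs)

lemma graded_unital_right_module_rep_module:
  "graded_unital_right_module (leavitt_path_algebra \<Gamma> P) (lpa_grade \<Gamma> P) graded_rep_module"
proof (intro graded_unital_right_module.intro graded_unital_right_module_axioms.intro)
  interpret U: unital_generator_module \<Gamma> P N rep_act by (rule unital_generator_module_rep_act)
  show "unital_right_module (leavitt_path_algebra \<Gamma> P) graded_rep_module"
    by (rule unital_right_module_rep_module)
  show "int_graded graded_rep_module (grade graded_rep_module)"
    using biproduct.int_graded_sum[OF biproduct_rep_module rep_graded]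
    unfolding grade_rep_module sum_grade_def by simp
  have G: "submodule (sum_grade m) scalar_field N" for m
    using int_graded_sum[OF rep_graded] by (simp add: int_graded_def sum_grade_def)
  fix x m n and a :: "('v, 'e, 'f) lpa_elem" assume "x \<in> grade graded_rep_module m" "a \<in> lpa_grade \<Gamma> P n"
  then show "ract graded_rep_module x a \<in> grade graded_rep_module (m + n)"
    unfolding grade_rep_module using U.coset_act_grade[OF G rep_act_grade] by simp
qed

end

section \<open>The four categories\<close>

lemma quiver_rep_vspace: "\<lbrakk>is_quiver_rep \<Gamma> \<rho>; v \<in> verts \<Gamma>\<rbrakk> \<Longrightarrow> vspace (rspace \<rho> v)"
  by (simp add: is_quiver_rep_def)

lemma rep_homs_linear: "\<lbrakk>\<phi> \<in> rep_homs \<Gamma> \<rho> \<sigma>; v \<in> verts \<Gamma>\<rbrakk> \<Longrightarrow> \<phi> v \<in> linear_maps (rspace \<rho> v) (rspace \<sigma> v)"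
  by (auto simp: rep_homs_def)

lemma rep_homs_extensional: "\<phi> \<in> rep_homs \<Gamma> \<rho> \<sigma> \<Longrightarrow> \<phi> \<in> extensional (verts \<Gamma>)"
  by (auto simp: rep_homs_def PiE_def)

context wf_digraph
begin

lemma quiver_rep_map_closed:
  "\<lbrakk>is_quiver_rep G \<rho>; e \<in> arcs G; x \<in> carrier (rspace \<rho> (tail G e))\<rbrakk> \<Longrightarrow> rmap \<rho> e x \<in> carrier (rspace \<rho> (head G e))"
  by (auto simp: is_quiver_rep_def intro: linear_maps_closed)

lemma rep_homs_id:
  assumes "is_quiver_rep G \<rho>"
  shows "(\<lambda>v\<in>verts G. \<lambda>x\<in>carrier (rspace \<rho> v). x) \<in> rep_homs G \<rho> \<rho>"
  using assms by (auto simp: rep_homs_def quiver_rep_map_closed intro: linear_maps_id quiver_rep_vspace)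

lemma rep_homs_comp:
  assumes \<rho>: "is_quiver_rep G \<rho>" and \<phi>: "\<phi> \<in> rep_homs G \<rho> \<sigma>" and \<psi>: "\<psi> \<in> rep_homs G \<sigma> \<tau>"
  shows "(\<lambda>v\<in>verts G. compose (carrier (rspace \<rho> v)) (\<psi> v) (\<phi> v)) \<in> rep_homs G \<rho> \<tau>"
proof -
  have "compose (carrier (rspace \<rho> v)) (\<psi> v) (\<phi> v) \<in> linear_maps (rspace \<rho> v) (rspace \<tau> v)" if "v \<in> verts G" for v
    by (rule linear_maps_compose[OF rep_homs_linear[OF \<phi> that] rep_homs_linear[OF \<psi> that] quiver_rep_vspace[OF \<rho> that]])
  moreover have "\<psi> (head G e) (\<phi> (head G e) (rmap \<rho> e x)) = rmap \<tau> e (\<psi> (tail G e) (\<phi> (tail G e) x))"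
    if e: "e \<in> arcs G" and x: "x \<in> carrier (rspace \<rho> (tail G e))" for e x
    using \<phi> \<psi> e x linear_maps_closed[OF rep_homs_linear[OF \<phi> tail_in_verts[OF e]] x]
    by (simp add: rep_homs_def)
  ultimately show ?thesis using \<rho> by (auto simp: rep_homs_def compose_eq quiver_rep_map_closed)
qed

lemma rep_homs_Id_comp:
  assumes \<phi>: "\<phi> \<in> rep_homs G \<rho> \<sigma>"
  shows "(\<lambda>v\<in>verts G. compose (carrier (rspace \<rho> v)) (\<phi> v) ((\<lambda>v\<in>verts G. \<lambda>x\<in>carrier (rspace \<rho> v). x) v)) = \<phi>"
    and "(\<lambda>v\<in>verts G. compose (carrier (rspace \<rho> v)) ((\<lambda>v\<in>verts G. \<lambda>x\<in>carrier (rspace \<sigma> v). x) v) (\<phi> v)) = \<phi>"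
proof -
  have "compose (carrier (rspace \<rho> v)) (\<phi> v) (\<lambda>x\<in>carrier (rspace \<rho> v). x) = \<phi> v"
    "compose (carrier (rspace \<rho> v)) (\<lambda>x\<in>carrier (rspace \<sigma> v). x) (\<phi> v) = \<phi> v" if "v \<in> verts G" for v
    using linear_maps_extensional[OF rep_homs_linear[OF \<phi> that]]
    by (auto simp: PiE_def intro: compose_Id Id_compose)
  then show "(\<lambda>v\<in>verts G. compose (carrier (rspace \<rho> v)) (\<phi> v) ((\<lambda>v\<in>verts G. \<lambda>x\<in>carrier (rspace \<rho> v). x) v)) = \<phi>"
    and "(\<lambda>v\<in>verts G. compose (carrier (rspace \<rho> v)) ((\<lambda>v\<in>verts G. \<lambda>x\<in>carrier (rspace \<sigma> v). x) v) (\<phi> v)) = \<phi>"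
    by (auto intro!: extensionalityI[of _ "verts G"] rep_homs_extensional[OF \<phi>])
qed

lemma rep_homs_assoc:
  assumes \<phi>: "\<phi> \<in> rep_homs G \<rho> \<sigma>"
  shows "(\<lambda>v\<in>verts G. compose (carrier (rspace \<rho> v)) (\<chi> v)
      ((\<lambda>v\<in>verts G. compose (carrier (rspace \<rho> v)) (\<psi> v) (\<phi> v)) v)) =
    (\<lambda>v\<in>verts G. compose (carrier (rspace \<rho> v))
      ((\<lambda>v\<in>verts G. compose (carrier (rspace \<sigma> v)) (\<chi> v) (\<psi> v)) v) (\<phi> v))"
proof (rule restrict_ext)
  fix v assume v: "v \<in> verts G"
  have "\<phi> v \<in> carrier (rspace \<rho> v) \<rightarrow> carrier (rspace \<sigma> v)"
    using linear_maps_extensional[OF rep_homs_linear[OF \<phi> v]] by (simp add: PiE_def)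
  then show "compose (carrier (rspace \<rho> v)) (\<chi> v) ((\<lambda>v\<in>verts G. compose (carrier (rspace \<rho> v)) (\<psi> v) (\<phi> v)) v) =
      compose (carrier (rspace \<rho> v)) ((\<lambda>v\<in>verts G. compose (carrier (rspace \<sigma> v)) (\<chi> v) (\<psi> v)) v) (\<phi> v)"
    using v by (simp add: compose_assoc)
qed

lemma category_quiver_reps: "category (quiver_reps G)"
  by (rule category.intro)
    (simp_all add: quiver_reps_def rep_homs_id rep_homs_comp rep_homs_Id_comp rep_homs_assoc del: restrict_apply)

lemma category_graded_quiver_reps: "category (graded_quiver_reps G)"
proof (rule category.intro)
  fix \<rho> :: "('a, 'b, 'c, 'd) graded_quiver_rep"
  assume "\<rho> \<in> Obj (graded_quiver_reps G)"
  then have \<rho>: "is_quiver_rep G \<rho>" and int: "\<And>v. v \<in> verts G \<Longrightarrow> int_graded (rspace \<rho> v) (rgrade \<rho> v)"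
    by (simp_all add: graded_quiver_reps_def is_graded_quiver_rep_def)
  \<comment> \<open>Identities and composites are restricted to carriers; homogeneous elements must
    lie there for these maps to have the expected values on them.\<close>
  have carr: "x \<in> carrier (rspace \<rho> v)" if "v \<in> verts G" "x \<in> rgrade \<rho> v n" for v x n
    using vect.submodule_vspaceD(1)[OF vect.intro[OF quiver_rep_vspace[OF \<rho> that(1)]], of "rgrade \<rho> v n"] int[OF that(1)] that(2)
    by (auto simp: int_graded_def)
  show "Id (graded_quiver_reps G) \<rho> \<in> Hom (graded_quiver_reps G) \<rho> \<rho>"
    using rep_homs_id[OF \<rho>] carr by (auto simp: graded_quiver_reps_def)
  fix \<sigma> \<tau> :: "('a, 'b, 'c, 'd) graded_quiver_rep" and \<phi> \<psi>
  assume h: "\<phi> \<in> Hom (graded_quiver_reps G) \<rho> \<sigma>" "\<psi> \<in> Hom (graded_quiver_reps G) \<sigma> \<tau>"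
  then have "(\<lambda>v\<in>verts G. compose (carrier (rspace \<rho> v)) (\<psi> v) (\<phi> v)) \<in> rep_homs G \<rho> \<tau>"
    by (intro rep_homs_comp[OF \<rho>, of \<phi> \<sigma> \<psi> \<tau>]) (simp_all add: graded_quiver_reps_def)
  then show "Comp (graded_quiver_reps G) \<rho> \<sigma> \<tau> \<phi> \<psi> \<in> Hom (graded_quiver_reps G) \<rho> \<tau>"
    using h carr by (fastforce simp: graded_quiver_reps_def compose_eq image_subset_iff)
next
  fix \<rho> \<sigma> :: "('a, 'b, 'c, 'd) graded_quiver_rep" and \<phi>
  assume "\<phi> \<in> Hom (graded_quiver_reps G) \<rho> \<sigma>"
  then have \<phi>: "\<phi> \<in> rep_homs G \<rho> \<sigma>" by (simp add: graded_quiver_reps_def)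
  show "Comp (graded_quiver_reps G) \<rho> \<rho> \<sigma> (Id (graded_quiver_reps G) \<rho>) \<phi> = \<phi>"
    using rep_homs_Id_comp(1)[OF \<phi>] by (simp add: graded_quiver_reps_def del: restrict_apply)
  show "Comp (graded_quiver_reps G) \<rho> \<sigma> \<sigma> \<phi> (Id (graded_quiver_reps G) \<sigma>) = \<phi>"
    using rep_homs_Id_comp(2)[OF \<phi>] by (simp add: graded_quiver_reps_def del: restrict_apply)
  fix \<tau> \<upsilon> :: "('a, 'b, 'c, 'd) graded_quiver_rep" and \<psi> \<chi>
  show "Comp (graded_quiver_reps G) \<rho> \<tau> \<upsilon> (Comp (graded_quiver_reps G) \<rho> \<sigma> \<tau> \<phi> \<psi>) \<chi> =
      Comp (graded_quiver_reps G) \<rho> \<sigma> \<upsilon> \<phi> (Comp (graded_quiver_reps G) \<sigma> \<tau> \<upsilon> \<psi> \<chi>)"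
    using rep_homs_assoc[OF \<phi>, of \<chi> \<psi>] by (simp add: graded_quiver_reps_def del: restrict_apply)
qed

end

section \<open>Morphisms of right modules\<close>

lemma rmod_homs_id:
  assumes "right_module L M"
  shows "(\<lambda>x\<in>carrier M. x) \<in> rmod_homs L M M"
  using linear_maps_id[OF right_module.vspace[OF assms]] right_module.ract_closed[OF assms]
  by (simp add: rmod_homs_def)

lemma rmod_homs_comp:
  assumes "right_module L M" "f \<in> rmod_homs L M N" "g \<in> rmod_homs L N K"
  shows "compose (carrier M) g f \<in> rmod_homs L M K"
  using assms linear_maps_compose[of f M N g K] right_module.ract_closed[OF assms(1)] right_module.vspace[OF assms(1)]
  by (auto simp: rmod_homs_def compose_eq linear_maps_closed)

lemma rmod_homs_funcset:
  "f \<in> rmod_homs L M N \<Longrightarrow> f \<in> carrier M \<rightarrow> carrier N \<and> f \<in> extensional (carrier M)"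
  by (auto simp: rmod_homs_def linear_maps_def PiE_def)

lemma rmod_homs_Id_comp:
  assumes "f \<in> rmod_homs L M N"
  shows "compose (carrier M) f (\<lambda>x\<in>carrier M. x) = f" "compose (carrier M) (\<lambda>x\<in>carrier N. x) f = f"
  using rmod_homs_funcset[OF assms] by (auto intro: compose_Id Id_compose)

lemma rmod_homs_assoc:
  assumes "f \<in> rmod_homs L M N"
  shows "compose (carrier M) h (compose (carrier M) g f) = compose (carrier M) (compose (carrier N) h g) f"
  using rmod_homs_funcset[OF assms] by (intro compose_assoc) simp

lemma category_unital_modules:
  "category (unital_modules L :: (('f::field, 'u, 'l) rmod, 'u \<Rightarrow> 'u) category)"
proof (rule category.intro)
  fix M N K Q :: "('f, 'u, 'l) rmod" and f g h
  assume "M \<in> Obj (unital_modules L)"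
  then have M: "right_module L M" by (simp add: unital_modules_def unital_right_module_def)
  show "Id (unital_modules L) M \<in> Hom (unital_modules L) M M"
    using rmod_homs_id[OF M] by (simp add: unital_modules_def)
  assume "f \<in> Hom (unital_modules L) M N"
  then have f: "f \<in> rmod_homs L M N" by (simp add: unital_modules_def)
  show "Comp (unital_modules L) M M N (Id (unital_modules L) M) f = f"
    "Comp (unital_modules L) M N N f (Id (unital_modules L) N) = f"
    using rmod_homs_Id_comp[OF f] by (simp_all add: unital_modules_def)
  assume "g \<in> Hom (unital_modules L) N K"
  then show "Comp (unital_modules L) M N K f g \<in> Hom (unital_modules L) M K"
    using rmod_homs_comp[OF M f] by (simp add: unital_modules_def)
  show "Comp (unital_modules L) M K Q (Comp (unital_modules L) M N K f g) h =
      Comp (unital_modules L) M N Q f (Comp (unital_modules L) N K Q g h)"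
    using rmod_homs_assoc[OF f] by (simp add: unital_modules_def)
qed

lemma category_graded_unital_modules:
  "category (graded_unital_modules L G :: (('f::field, 'u, 'l) graded_rmod, 'u \<Rightarrow> 'u) category)"
proof (rule category.intro)
  fix M :: "('f, 'u, 'l) graded_rmod"
  assume "M \<in> Obj (graded_unital_modules L G)"
  then interpret M: graded_unital_right_module L G M by (simp add: graded_unital_modules_def)
  have carr: "x \<in> carrier M" if "x \<in> grade M n" for x n
    using M.submodule_vspaceD(1)[of "grade M n"] M.graded that by (auto simp: int_graded_def)
  show "Id (graded_unital_modules L G) M \<in> Hom (graded_unital_modules L G) M M"
    using rmod_homs_id[OF M.right_module_axioms] carr by (auto simp: graded_unital_modules_def)
  fix N K :: "('f, 'u, 'l) graded_rmod" and f g
  assume h: "f \<in> Hom (graded_unital_modules L G) M N" "g \<in> Hom (graded_unital_modules L G) N K"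
  then have "compose (carrier M) g f \<in> rmod_homs L M K"
    by (intro rmod_homs_comp[OF M.right_module_axioms, of f N g K]) (simp_all add: graded_unital_modules_def)
  then show "Comp (graded_unital_modules L G) M N K f g \<in> Hom (graded_unital_modules L G) M K"
    using h carr by (fastforce simp: graded_unital_modules_def compose_eq image_subset_iff)
next
  fix M N K Q :: "('f, 'u, 'l) graded_rmod" and f g h
  assume "f \<in> Hom (graded_unital_modules L G) M N"
  then have f: "f \<in> rmod_homs L M N" by (simp add: graded_unital_modules_def)
  show "Comp (graded_unital_modules L G) M M N (Id (graded_unital_modules L G) M) f = f"
    "Comp (graded_unital_modules L G) M N N f (Id (graded_unital_modules L G) N) = f"
    using rmod_homs_Id_comp[OF f] by (simp_all add: graded_unital_modules_def)
  show "Comp (graded_unital_modules L G) M K Q (Comp (graded_unital_modules L G) M N K f g) h =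
      Comp (graded_unital_modules L G) M N Q f (Comp (graded_unital_modules L G) N K Q g h)"
    using rmod_homs_assoc[OF f] by (simp add: graded_unital_modules_def)
qed

lemma corner_hom_id: "corner_hom \<Gamma> M act (\<lambda>x\<in>carrier M. x) = (\<lambda>v\<in>verts \<Gamma>. \<lambda>x\<in>carrier (corner M act v). x)"
  by (auto simp: corner_hom_def restrict_def fun_eq_iff)

text \<open>The restriction of \<open>g\<close> to a corner is evaluated at values of
  \<open>f\<close>, so \<open>f\<close> has to send corners to corners.\<close>

lemma corner_hom_comp:
  assumes "\<And>v x. \<lbrakk>v \<in> verts \<Gamma>; x \<in> carrier (corner M act v)\<rbrakk> \<Longrightarrow> f x \<in> carrier (corner N act' v)"
  shows "corner_hom \<Gamma> M act (compose (carrier M) g f) =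
    (\<lambda>v\<in>verts \<Gamma>. compose (carrier (corner M act v)) (corner_hom \<Gamma> N act' g v) (corner_hom \<Gamma> M act f v))"
  using assms by (auto simp: corner_hom_def compose_def restrict_def fun_eq_iff)

context finitely_separated_digraph
begin

lemma two_unital_generator_modules_gen_act:
  fixes M M' :: "('f::field, 'u, ('a, 'b, 'f) lpa_elem, 'z) rmod_scheme"
    and \<rho> \<sigma> :: "('a, 'b, 'f, 'u, 'x) quiver_rep_scheme"
  assumes "unital_right_module (leavitt_path_algebra \<Gamma> P) M" "unital_right_module (leavitt_path_algebra \<Gamma> P) M'"
    and "rspace \<rho> = corner M (gen_act \<Gamma> P M)" "rmap \<rho> = corner_map \<Gamma> M (gen_act \<Gamma> P M)"
    and "rspace \<sigma> = corner M' (gen_act \<Gamma> P M')" "rmap \<sigma> = corner_map \<Gamma> M' (gen_act \<Gamma> P M')"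
  shows "two_unital_generator_modules \<Gamma> P M (gen_act \<Gamma> P M) M' (gen_act \<Gamma> P M') \<rho> \<sigma>"
    and "two_unital_generator_modules.gen_homs \<Gamma> M (gen_act \<Gamma> P M) M' (gen_act \<Gamma> P M') =
      rmod_homs (leavitt_path_algebra \<Gamma> P) M M'"
proof -
  show two: "two_unital_generator_modules \<Gamma> P M (gen_act \<Gamma> P M) M' (gen_act \<Gamma> P M') \<rho> \<sigma>"
    using assms by (intro two_unital_generator_modules.intro two_unital_generator_modules_axioms.intro
      unital_generator_module_gen_act)
  show "two_unital_generator_modules.gen_homs \<Gamma> M (gen_act \<Gamma> P M) M' (gen_act \<Gamma> P M') =
      rmod_homs (leavitt_path_algebra \<Gamma> P) M M'"
    unfolding two_unital_generator_modules.gen_homs_def[OF two]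
    using rmod_homs_iff[OF unital_right_module.axioms(1)[OF assms(1)] unital_right_module.axioms(1)[OF assms(2)]]
    by auto
qed

lemma rmod_homs_corner:
  fixes M M' :: "('f::field, 'u, ('a, 'b, 'f) lpa_elem, 'z) rmod_scheme"
  assumes "f \<in> rmod_homs (leavitt_path_algebra \<Gamma> P) M M'" "v \<in> verts \<Gamma>" "x \<in> carrier (corner M (gen_act \<Gamma> P M) v)"
  shows "f x \<in> carrier (corner M' (gen_act \<Gamma> P M') v)"
proof -
  have x: "x \<in> carrier M" "gen_act \<Gamma> P M (Vertex v) x = x" using assms(3) by simp_all
  have f: "f \<in> linear_maps M M'" using assms(1) by (simp add: rmod_homs_def)
  have "f (gen_act \<Gamma> P M (Vertex v) x) = gen_act \<Gamma> P M' (Vertex v) (f x)"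
    using assms(1,2) x(1) by (simp add: rmod_homs_def gen_act_def)
  then show ?thesis using linear_maps_closed[OF f x(1)] x(2) by simp
qed

lemma lpa_grade_gen:
  "g \<in> lpa_gens \<Gamma> \<Longrightarrow> (lpa_coset \<Gamma> P (gen g) :: ('a, 'b, 'f::field) lpa_elem) \<in> lpa_grade \<Gamma> P (gen_degree g)"
  unfolding lpa_grade_def
  using augmentation_ideal_closed(5)[of g "lpa_gens \<Gamma>"]
  by (auto simp: augmentation_ideal_def gen_def intro!: exI[of _ "gen g"])

end

text \<open>The hypothesis on \<open>act\<close> says that vertices have degree 0. Applying
  \<open>v\<close> to the homogeneous components of a fixed point therefore yields components inside
  the corner; independence is inherited from \<open>N\<close>.\<close>

lemma (in generator_module) int_graded_corner:
  assumes G: "int_graded N G" and v: "v \<in> verts \<Gamma>" and act: "\<And>x n. x \<in> G n \<Longrightarrow> act (Vertex v) x \<in> G n"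
  shows "int_graded (corner N act v) (\<lambda>n. G n \<inter> carrier (corner N act v))"
proof -
  interpret C: vect "corner N act v" by (rule vect.intro[OF vspace_corner[OF v]])
  have sub: "submodule (G n) (scalar_field :: 'f ring) N" for n using G by (simp add: int_graded_def)
  note D = submodule_vspaceD[OF sub]
  show ?thesis
    unfolding int_graded_iff[OF C.vspace]
  proof (intro conjI allI ballI impI)
    show "submodule (G n \<inter> carrier (corner N act v)) (scalar_field :: 'f ring) (corner N act v)" for n
    proof (rule C.submodule_vspaceI)
      show "\<zero>\<^bsub>corner N act v\<^esub> \<in> G n \<inter> carrier (corner N act v)" using D(2) C.zero_closed by simp
      fix x assume x: "x \<in> G n \<inter> carrier (corner N act v)"
      show "c \<odot>\<^bsub>corner N act v\<^esub> x \<in> G n \<inter> carrier (corner N act v)" for c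
        using x D(4)[of x n c] C.smult_mem[of x c] by (simp del: C.smult_mem)
      fix y assume y: "y \<in> G n \<inter> carrier (corner N act v)"
      show "x \<oplus>\<^bsub>corner N act v\<^esub> y \<in> G n \<inter> carrier (corner N act v)"
        using x y D(3)[of x n y] C.a_closed[of x y] by (simp del: C.a_closed)
    qed simp
  next
    fix x assume x: "x \<in> carrier (corner N act v)"
    then obtain S c where S: "finite S" and c: "\<forall>n\<in>S. c n \<in> G n" and eq: "x = finsum N c S"
      using G unfolding int_graded_iff[OF vspace] by (auto 0 4)
    have cN: "c n \<in> carrier N" if "n \<in> S" for n using c that D(1) by blast
    let ?c = "\<lambda>n. act (Vertex v) (c n)"
    have c': "?c n \<in> G n \<inter> carrier (corner N act v)" if "n \<in> S" for n
      using act c that act_vertex_corner[OF v cN[OF that]] by blast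
    have "x = act (Vertex v) (finsum N c S)" using x eq by simp
    also have "\<dots> = finsum N ?c S" using v S cN by (intro act_finsum) auto
    also have "\<dots> = finsum (corner N act v) ?c S" using c' by (intro corner_finsum[OF v S, symmetric]) blast
    finally show "\<exists>S c. finite S \<and> (\<forall>n\<in>S. c n \<in> G n \<inter> carrier (corner N act v)) \<and> x = finsum (corner N act v) c S"
      using S c' by (intro exI[of _ S] exI[of _ ?c]) simp
  next
    fix S c n assume S: "finite S" and c: "\<forall>n\<in>S. c n \<in> G n \<inter> carrier (corner N act v)"
      and zero: "finsum (corner N act v) c S = \<zero>\<^bsub>corner N act v\<^esub>" and n: "n \<in> S"
    have "finsum N c S = \<zero>" using corner_finsum[OF v S, of c] c zero by simp
    then show "c n = \<zero>\<^bsub>corner N act v\<^esub>"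
      using G S c n unfolding int_graded_iff[OF vspace] by simp
  qed
qed

section \<open>The equivalences\<close>

definition corner_rep :: "('v, 'e) pre_digraph \<Rightarrow> 'e set set \<Rightarrow>
    ('f::field, 'u, ('v, 'e, 'f) lpa_elem) rmod \<Rightarrow> ('v, 'e, 'f, 'u) quiver_rep" where
  "corner_rep \<Gamma> P M = \<lparr>rspace = corner M (gen_act \<Gamma> P M), rmap = corner_map \<Gamma> M (gen_act \<Gamma> P M)\<rparr>"

definition graded_corner_rep :: "('v, 'e) pre_digraph \<Rightarrow> 'e set set \<Rightarrow>
    ('f::field, 'u, ('v, 'e, 'f) lpa_elem) graded_rmod \<Rightarrow> ('v, 'e, 'f, 'u) graded_quiver_rep" where
  "graded_corner_rep \<Gamma> P M = \<lparr>rspace = corner M (gen_act \<Gamma> P M), rmap = corner_map \<Gamma> M (gen_act \<Gamma> P M),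
     rgrade = (\<lambda>v n. grade M n \<inter> carrier (corner M (gen_act \<Gamma> P M) v))\<rparr>"

definition corner_functor where
  "corner_functor \<Gamma> P = \<lparr>on_obj = corner_rep \<Gamma> P, on_hom = (\<lambda>M N. corner_hom \<Gamma> M (gen_act \<Gamma> P M))\<rparr>"

definition graded_corner_functor where
  "graded_corner_functor \<Gamma> P =
    \<lparr>on_obj = graded_corner_rep \<Gamma> P, on_hom = (\<lambda>M N. corner_hom \<Gamma> M (gen_act \<Gamma> P M))\<rparr>"

context finitely_separated_digraph
begin

text \<open>The size of the universe enters here: the direct sum of the spaces at all vertices must
  find room in \<open>'u\<close>.\<close>

lemma rep_biproduct_exists:
  fixes \<rho> :: "('a, 'b, 'f::field, 'u, 'x) quiver_rep_scheme"
  assumes "infinite (UNIV :: 'u set)" "verts \<Gamma> \<lesssim> (UNIV :: 'u set)"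
    and \<rho>: "is_quiver_rep \<Gamma> \<rho>" "condition_I \<Gamma> P \<rho>"
  obtains N :: "('f, 'u) module" and emb proj k where "rep_biproduct \<Gamma> P \<rho> N emb proj k"
proof -
  obtain N :: "('f, 'u) module" and emb proj where B: "biproduct (verts \<Gamma>) (rspace \<rho>) N emb proj"
    using biproduct_exists[OF assms(1,2), of "rspace \<rho>"] quiver_rep_vspace[OF \<rho>(1)] by metis
  obtain k where k: "\<And>e. e \<in> arcs \<Gamma> \<Longrightarrow> k e \<in> linear_maps (rspace \<rho> (head \<Gamma> e)) (rspace \<rho> (tail \<Gamma> e))"
    "\<And>X e f y. \<lbrakk>X \<in> P; e \<in> X; f \<in> X; y \<in> carrier (rspace \<rho> (head \<Gamma> e))\<rbrakk>
      \<Longrightarrow> rmap \<rho> f (k e y) = (if e = f then y else \<zero>\<^bsub>rspace \<rho> (head \<Gamma> f)\<^esub>)"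
    "\<And>X x. \<lbrakk>X \<in> P; x \<in> carrier (rspace \<rho> (part_source \<Gamma> X))\<rbrakk>
      \<Longrightarrow> x = finsum (rspace \<rho> (part_source \<Gamma> X)) (\<lambda>e. k e (rmap \<rho> e x)) X"
    using condition_I_inverse[OF \<rho>] by blast
  have "rep_biproduct \<Gamma> P \<rho> N emb proj k"
    by (intro rep_biproduct.intro rep_biproduct_axioms.intro finitely_separated_digraph_axioms B \<rho>(1) k)
  then show thesis by (rule that)
qed

lemma is_functor_corner_functor:
  "is_functor (unital_modules (leavitt_path_algebra \<Gamma> P) :: (('f::field, 'u, ('a, 'b, 'f) lpa_elem) rmod, 'u \<Rightarrow> 'u) category)
    (full_subcategory (quiver_reps \<Gamma>) (condition_I \<Gamma> P)) (corner_functor \<Gamma> P)"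
  unfolding is_functor_def
proof (intro conjI ballI)
  let ?C = "unital_modules (leavitt_path_algebra \<Gamma> P) :: (('f, 'u, ('a, 'b, 'f) lpa_elem) rmod, 'u \<Rightarrow> 'u) category"
  let ?D = "full_subcategory (quiver_reps \<Gamma>) (condition_I \<Gamma> P) :: (('a, 'b, 'f, 'u) quiver_rep, 'a \<Rightarrow> 'u \<Rightarrow> 'u) category"
  let ?F = "corner_functor \<Gamma> P :: (('f, 'u, ('a, 'b, 'f) lpa_elem) rmod, 'u \<Rightarrow> 'u, _, _) funct"
  fix M :: "('f, 'u, ('a, 'b, 'f) lpa_elem) rmod"
  assume "M \<in> Obj ?C"
  then have M: "unital_right_module (leavitt_path_algebra \<Gamma> P) M" by (simp add: unital_modules_def)
  interpret G: generator_module \<Gamma> P M "gen_act \<Gamma> P M"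
    by (rule generator_module_gen_act[OF unital_right_module.axioms(1)[OF M]])
  show "on_obj ?F M \<in> Obj ?D"
    using G.is_quiver_rep_corner[of "corner_rep \<Gamma> P M"] G.condition_I_corner[of "corner_rep \<Gamma> P M"]
    by (simp add: corner_functor_def full_subcategory_def quiver_reps_def corner_rep_def)
  show "on_hom ?F M M (Id ?C M) =
      Id ?D (on_obj ?F M)"
    using corner_hom_id[of \<Gamma> M "gen_act \<Gamma> P M"]
    by (simp add: corner_functor_def full_subcategory_def quiver_reps_def unital_modules_def corner_rep_def)
  fix M' :: "('f, 'u, ('a, 'b, 'f) lpa_elem) rmod" and f
  assume "M' \<in> Obj ?C"
    "f \<in> Hom ?C M M'"
  then have M': "unital_right_module (leavitt_path_algebra \<Gamma> P) M'"
    and f: "f \<in> rmod_homs (leavitt_path_algebra \<Gamma> P) M M'" by (simp_all add: unital_modules_def)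
  note two = two_unital_generator_modules_gen_act[OF M M', of "corner_rep \<Gamma> P M" "corner_rep \<Gamma> P M'"]
  show "on_hom ?F M M' f \<in> Hom ?D
      (on_obj ?F M) (on_obj ?F M')"
    using two_unital_generator_modules.corner_hom_in_rep_homs[OF two(1)] two(2) f
    by (simp add: corner_functor_def full_subcategory_def quiver_reps_def corner_rep_def)
  fix M'' :: "('f, 'u, ('a, 'b, 'f) lpa_elem) rmod" and g
  show "on_hom ?F M M'' (Comp ?C M M' M'' f g) =
      Comp ?D (on_obj ?F M)
        (on_obj ?F M') (on_obj ?F M'')
        (on_hom ?F M M' f) (on_hom ?F M' M'' g)"
    using corner_hom_comp[of \<Gamma> M "gen_act \<Gamma> P M" f M' "gen_act \<Gamma> P M'" g, OF rmod_homs_corner[OF f]]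
    by (simp add: corner_functor_def full_subcategory_def quiver_reps_def unital_modules_def corner_rep_def
        del: corner_simps)
qed

theorem equivalent_modules_reps:
  assumes "infinite (UNIV :: 'u set)" "verts \<Gamma> \<lesssim> (UNIV :: 'u set)"
  shows "equivalent_categories
    (unital_modules (leavitt_path_algebra \<Gamma> P) :: (('f::field, 'u, ('a, 'b, 'f) lpa_elem) rmod, 'u \<Rightarrow> 'u) category)
    (full_subcategory (quiver_reps \<Gamma> :: (('a, 'b, 'f, 'u) quiver_rep, 'a \<Rightarrow> 'u \<Rightarrow> 'u) category) (condition_I \<Gamma> P))"
proof (rule equivalent_categories_if_fully_faithful[OF category_unital_modules
      category_full_subcategory[OF category_quiver_reps] is_functor_corner_functor])
  let ?C = "unital_modules (leavitt_path_algebra \<Gamma> P) :: (('f, 'u, ('a, 'b, 'f) lpa_elem) rmod, 'u \<Rightarrow> 'u) category"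
  let ?D = "full_subcategory (quiver_reps \<Gamma>) (condition_I \<Gamma> P) :: (('a, 'b, 'f, 'u) quiver_rep, 'a \<Rightarrow> 'u \<Rightarrow> 'u) category"
  let ?F = "corner_functor \<Gamma> P :: (('f, 'u, ('a, 'b, 'f) lpa_elem) rmod, 'u \<Rightarrow> 'u, _, _) funct"
  {
    fix M M' :: "('f, 'u, ('a, 'b, 'f) lpa_elem) rmod"
    assume "M \<in> Obj ?C" "M' \<in> Obj ?C"
    then have M: "unital_right_module (leavitt_path_algebra \<Gamma> P) M" "unital_right_module (leavitt_path_algebra \<Gamma> P) M'"
      by (simp_all add: unital_modules_def)
    note two = two_unital_generator_modules_gen_act[OF M, of "corner_rep \<Gamma> P M" "corner_rep \<Gamma> P M'"]
    show "bij_betw (on_hom ?F M M') (Hom ?C M M')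
        (Hom ?D
          (on_obj ?F M) (on_obj ?F M'))"
      using two_unital_generator_modules.bij_betw_corner_hom[OF two(1)] two(2)
      by (simp add: corner_functor_def full_subcategory_def quiver_reps_def unital_modules_def corner_rep_def)
  }
  fix \<rho> :: "('a, 'b, 'f, 'u) quiver_rep"
  assume "\<rho> \<in> Obj ?D"
  then have \<rho>: "is_quiver_rep \<Gamma> \<rho>" "condition_I \<Gamma> P \<rho>" by (simp_all add: full_subcategory_def quiver_reps_def)
  obtain N :: "('f, 'u) module" and emb proj k where "rep_biproduct \<Gamma> P \<rho> N emb proj k"
    by (rule rep_biproduct_exists[OF assms \<rho>])
  then interpret R: rep_biproduct \<Gamma> P \<rho> N emb proj k .
  let ?M = "R.rep_module ()" and ?\<sigma> = "corner_rep \<Gamma> P (R.rep_module ())"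
  have \<sigma>: "rspace ?\<sigma> = corner ?M (gen_act \<Gamma> P ?M)" "rmap ?\<sigma> = corner_map \<Gamma> ?M (gen_act \<Gamma> P ?M)"
    by (simp_all add: corner_rep_def)
  have "?M \<in> Obj ?C"
    using R.unital_right_module_rep_module by (simp add: unital_modules_def)
  \<comment> \<open>Essential surjectivity: the corners of the direct sum are copies of the spaces
    of \<open>\<rho>\<close>, with projection and embedding as mutually inverse morphisms.\<close>
  moreover have "is_iso ?D ?\<sigma> \<rho> (R.proj_hom ?\<sigma>)"
    unfolding is_iso_def
    using R.proj_hom[OF \<sigma>] R.emb_hom[OF \<sigma>] R.proj_emb_hom[OF \<sigma>] R.emb_proj_hom[OF \<sigma>]
    by (auto simp: full_subcategory_def quiver_reps_def simp del: restrict_apply intro!: bexI[of _ R.emb_hom])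
  ultimately show "\<exists>M\<in>Obj ?C.
      \<exists>f. is_iso ?D (on_obj ?F M) \<rho> f"
    by (auto simp: corner_functor_def)
qed

section \<open>The graded equivalence\<close>

lemma graded_gen_act:
  fixes M :: "('f::field, 'u, ('a, 'b, 'f) lpa_elem, 'z) graded_rmod_scheme"
  assumes "graded_unital_right_module (leavitt_path_algebra \<Gamma> P) (lpa_grade \<Gamma> P) M" "g \<in> lpa_gens \<Gamma>" "x \<in> grade M n"
  shows "gen_act \<Gamma> P M g x \<in> grade M (n + gen_degree g)"
  unfolding gen_act_def using assms(1,3) lpa_grade_gen[OF assms(2)]
  by (rule graded_unital_right_module.ract_grade)

text \<open>Vertices have degree 0, so a homogeneous \<open>x\<close> is a finite sum of vertex
  components \<open>x v\<close> of the same degree. Hence preservation of degrees can be tested on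
  corners.\<close>

lemma corner_hom_grade_iff:
  fixes M M' :: "('f::field, 'u, ('a, 'b, 'f) lpa_elem) graded_rmod"
  assumes M: "graded_unital_right_module (leavitt_path_algebra \<Gamma> P) (lpa_grade \<Gamma> P) M"
    and M': "graded_unital_right_module (leavitt_path_algebra \<Gamma> P) (lpa_grade \<Gamma> P) M'"
    and f: "f \<in> rmod_homs (leavitt_path_algebra \<Gamma> P) M M'"
  shows "(\<forall>n. f ` grade M n \<subseteq> grade M' n) \<longleftrightarrow>
    (\<forall>v\<in>verts \<Gamma>. \<forall>n. corner_hom \<Gamma> M (gen_act \<Gamma> P M) f v ` rgrade (graded_corner_rep \<Gamma> P M) v n
      \<subseteq> rgrade (graded_corner_rep \<Gamma> P M') v n)"
proof
  assume L: "\<forall>n. f ` grade M n \<subseteq> grade M' n"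
  show "\<forall>v\<in>verts \<Gamma>. \<forall>n. corner_hom \<Gamma> M (gen_act \<Gamma> P M) f v ` rgrade (graded_corner_rep \<Gamma> P M) v n
      \<subseteq> rgrade (graded_corner_rep \<Gamma> P M') v n"
  proof (intro ballI allI image_subsetI)
    fix v n x assume v: "v \<in> verts \<Gamma>" and "x \<in> rgrade (graded_corner_rep \<Gamma> P M) v n"
    then have x: "x \<in> grade M n" "x \<in> carrier (corner M (gen_act \<Gamma> P M) v)"
      by (simp_all add: graded_corner_rep_def)
    have "f x \<in> grade M' n" using L x(1) by blast
    then show "corner_hom \<Gamma> M (gen_act \<Gamma> P M) f v x \<in> rgrade (graded_corner_rep \<Gamma> P M') v n"
      using rmod_homs_corner[OF f v x(2)] v x(2)
      by (simp add: corner_hom_def graded_corner_rep_def)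
  qed
next
  interpret M: graded_unital_right_module "leavitt_path_algebra \<Gamma> P" "lpa_grade \<Gamma> P" M by fact
  interpret M': graded_unital_right_module "leavitt_path_algebra \<Gamma> P" "lpa_grade \<Gamma> P" M' by fact
  interpret G: unital_generator_module \<Gamma> P M "gen_act \<Gamma> P M"
    by (rule unital_generator_module_gen_act[OF M.unital_right_module_axioms])
  assume R: "\<forall>v\<in>verts \<Gamma>. \<forall>n. corner_hom \<Gamma> M (gen_act \<Gamma> P M) f v ` rgrade (graded_corner_rep \<Gamma> P M) v n
      \<subseteq> rgrade (graded_corner_rep \<Gamma> P M') v n"
  have sub: "submodule (grade M n) (scalar_field :: 'f ring) M" for n using M.graded by (simp add: int_graded_def)
  have sub': "submodule (grade M' n) (scalar_field :: 'f ring) M'" for n using M'.graded by (simp add: int_graded_def)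
  note D' = M'.submodule_vspaceD[OF sub']
  have lin: "f \<in> linear_maps M M'" using f by (simp add: rmod_homs_def)
  show "\<forall>n. f ` grade M n \<subseteq> grade M' n"
  proof (intro allI image_subsetI)
    fix n x assume xn: "x \<in> grade M n"
    then have x: "x \<in> carrier M" using M.submodule_vspaceD(1)[OF sub] by blast
    obtain F where F: "finite F" "F \<subseteq> verts \<Gamma>" "x = finsum M (\<lambda>v. gen_act \<Gamma> P M (Vertex v) x) F"
      using G.vertex_decomposition[OF x] by blast
    let ?x = "\<lambda>v. gen_act \<Gamma> P M (Vertex v) x"
    have xv: "?x v \<in> carrier (corner M (gen_act \<Gamma> P M) v)" if "v \<in> F" for v
      using that F(2) by (intro G.act_vertex_corner x) auto
    have "f x = f (finsum M ?x F)" by (rule arg_cong[OF F(3)])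
    also have "\<dots> = finsum M' (\<lambda>v. f (?x v)) F"
      using xv by (intro linear_maps_finsum[OF lin M.vspace M'.vspace F(1)]) simp
    also have "\<dots> \<in> grade M' n"
    proof (rule M'.finsum_mem[OF F(1) D'(2) D'(1) D'(3)])
      fix v assume vF: "v \<in> F"
      then have v: "v \<in> verts \<Gamma>" using F(2) by blast
      have "?x v \<in> grade M n" using graded_gen_act[OF M _ xn, of "Vertex v"] v by simp
      then have "?x v \<in> rgrade (graded_corner_rep \<Gamma> P M) v n"
        using xv[OF vF] by (simp add: graded_corner_rep_def)
      then have "corner_hom \<Gamma> M (gen_act \<Gamma> P M) f v (?x v) \<in> rgrade (graded_corner_rep \<Gamma> P M') v n"
        using R v by blast
      moreover have "corner_hom \<Gamma> M (gen_act \<Gamma> P M) f v (?x v) = f (?x v)"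
        using v xv[OF vF] by (simp only: corner_hom_def restrict_apply')
      ultimately show "f (?x v) \<in> grade M' n" by (simp add: graded_corner_rep_def)
    qed
    finally show "f x \<in> grade M' n" .
  qed
qed

text \<open>The ungraded bijection restricts to grade-preserving maps, since
  \<open>corner_hom_grade_iff\<close> matches the two subsets.\<close>

lemma bij_betw_graded_corner_hom:
  fixes M M' :: "('f::field, 'u, ('a, 'b, 'f) lpa_elem) graded_rmod"
  assumes M: "graded_unital_right_module (leavitt_path_algebra \<Gamma> P) (lpa_grade \<Gamma> P) M"
    and M': "graded_unital_right_module (leavitt_path_algebra \<Gamma> P) (lpa_grade \<Gamma> P) M'"
  shows "bij_betw (corner_hom \<Gamma> M (gen_act \<Gamma> P M))
    (Hom (graded_unital_modules (leavitt_path_algebra \<Gamma> P) (lpa_grade \<Gamma> P)) M M')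
    (Hom (graded_quiver_reps \<Gamma>) (graded_corner_rep \<Gamma> P M) (graded_corner_rep \<Gamma> P M'))"
proof -
  note two = two_unital_generator_modules_gen_act[OF graded_unital_right_module.axioms(1)[OF M]
      graded_unital_right_module.axioms(1)[OF M'], of "graded_corner_rep \<Gamma> P M" "graded_corner_rep \<Gamma> P M'"]
  let ?h = "corner_hom \<Gamma> M (gen_act \<Gamma> P M)" and ?A = "rmod_homs (leavitt_path_algebra \<Gamma> P) M M'"
    and ?B = "rep_homs \<Gamma> (graded_corner_rep \<Gamma> P M) (graded_corner_rep \<Gamma> P M')"
  have bij: "bij_betw ?h ?A ?B"
    using two_unital_generator_modules.bij_betw_corner_hom[OF two(1)] two(2)
    by (simp add: graded_corner_rep_def)
  note iff = corner_hom_grade_iff[OF M M']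
  show ?thesis
  proof (rule bij_betw_imageI)
    show "inj_on ?h (Hom (graded_unital_modules (leavitt_path_algebra \<Gamma> P) (lpa_grade \<Gamma> P)) M M')"
      using bij_betw_imp_inj_on[OF bij] by (rule inj_on_subset) (simp add: graded_unital_modules_def)
    show "?h ` Hom (graded_unital_modules (leavitt_path_algebra \<Gamma> P) (lpa_grade \<Gamma> P)) M M' =
        Hom (graded_quiver_reps \<Gamma>) (graded_corner_rep \<Gamma> P M) (graded_corner_rep \<Gamma> P M')"
    proof (intro equalityI subsetI)
      fix \<phi> assume "\<phi> \<in> ?h ` Hom (graded_unital_modules (leavitt_path_algebra \<Gamma> P) (lpa_grade \<Gamma> P)) M M'"
      then obtain f where "\<phi> = ?h f" and f: "f \<in> ?A" "\<forall>n. f ` grade M n \<subseteq> grade M' n"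
        by (auto simp: graded_unital_modules_def)
      then show "\<phi> \<in> Hom (graded_quiver_reps \<Gamma>) (graded_corner_rep \<Gamma> P M) (graded_corner_rep \<Gamma> P M')"
        using iff[OF f(1)] bij_betwE[OF bij] by (simp add: graded_quiver_reps_def)
    next
      fix \<phi> assume "\<phi> \<in> Hom (graded_quiver_reps \<Gamma>) (graded_corner_rep \<Gamma> P M) (graded_corner_rep \<Gamma> P M')"
      then have \<phi>: "\<phi> \<in> ?B" "\<forall>v\<in>verts \<Gamma>. \<forall>n. \<phi> v ` rgrade (graded_corner_rep \<Gamma> P M) v n
          \<subseteq> rgrade (graded_corner_rep \<Gamma> P M') v n"
        by (simp_all add: graded_quiver_reps_def)
      obtain f where f: "f \<in> ?A" "\<phi> = ?h f" using \<phi>(1) bij_betw_imp_surj_on[OF bij] by blast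
      then have "f \<in> Hom (graded_unital_modules (leavitt_path_algebra \<Gamma> P) (lpa_grade \<Gamma> P)) M M'"
        using iff[OF f(1)] \<phi>(2) by (simp add: graded_unital_modules_def)
      then show "\<phi> \<in> ?h ` Hom (graded_unital_modules (leavitt_path_algebra \<Gamma> P) (lpa_grade \<Gamma> P)) M M'"
        unfolding f(2) by (rule imageI)
    qed
  qed
qed

text \<open>Vertices preserve degrees, so the corners inherit gradings; arrows have degree 1, which
  gives the required shift.\<close>

lemma is_graded_quiver_rep_corner:
  fixes M :: "('f::field, 'u, ('a, 'b, 'f) lpa_elem) graded_rmod"
  assumes M: "graded_unital_right_module (leavitt_path_algebra \<Gamma> P) (lpa_grade \<Gamma> P) M"
  shows "is_graded_quiver_rep \<Gamma> (graded_corner_rep \<Gamma> P M)"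
proof -
  interpret M: graded_unital_right_module "leavitt_path_algebra \<Gamma> P" "lpa_grade \<Gamma> P" M by fact
  interpret G: generator_module \<Gamma> P M "gen_act \<Gamma> P M"
    by (rule generator_module_gen_act[OF M.right_module_axioms])
  let ?\<rho> = "graded_corner_rep \<Gamma> P M"
  have "is_quiver_rep \<Gamma> ?\<rho>" by (rule G.is_quiver_rep_corner) (simp_all add: graded_corner_rep_def)
  moreover have "int_graded (rspace ?\<rho> v) (rgrade ?\<rho> v)" if v: "v \<in> verts \<Gamma>" for v
    using G.int_graded_corner[OF M.graded v] graded_gen_act[OF M, of "Vertex v"] v
    by (simp add: graded_corner_rep_def)
  moreover have "rmap ?\<rho> e ` rgrade ?\<rho> (tail \<Gamma> e) n \<subseteq> rgrade ?\<rho> (head \<Gamma> e) (n + 1)" if e: "e \<in> arcs \<Gamma>" for e n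
  proof (rule image_subsetI)
    fix x assume "x \<in> rgrade ?\<rho> (tail \<Gamma> e) n"
    then have x: "x \<in> grade M n" "x \<in> carrier (corner M (gen_act \<Gamma> P M) (tail \<Gamma> e))"
      by (simp_all add: graded_corner_rep_def)
    then have "rmap ?\<rho> e x = gen_act \<Gamma> P M (Arrow e) x"
      by (simp add: graded_corner_rep_def corner_map_def)
    then show "rmap ?\<rho> e x \<in> rgrade ?\<rho> (head \<Gamma> e) (n + 1)"
      using graded_gen_act[OF M _ x(1), of "Arrow e"] G.act_arrow_corner[OF e, of x] x(2) e
      by (simp add: graded_corner_rep_def)
  qed
  ultimately show ?thesis by (simp add: is_graded_quiver_rep_def)
qed

lemma is_functor_graded_corner_functor:
  "is_functor (graded_unital_modules (leavitt_path_algebra \<Gamma> P) (lpa_grade \<Gamma> P)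
      :: (('f::field, 'u, ('a, 'b, 'f) lpa_elem) graded_rmod, 'u \<Rightarrow> 'u) category)
    (full_subcategory (graded_quiver_reps \<Gamma>) (condition_I \<Gamma> P)) (graded_corner_functor \<Gamma> P)"
  unfolding is_functor_def
proof (intro conjI ballI)
  let ?C = "graded_unital_modules (leavitt_path_algebra \<Gamma> P) (lpa_grade \<Gamma> P)
      :: (('f::field, 'u, ('a, 'b, 'f) lpa_elem) graded_rmod, 'u \<Rightarrow> 'u) category"
  let ?D = "full_subcategory (graded_quiver_reps \<Gamma>) (condition_I \<Gamma> P)
      :: (('a, 'b, 'f, 'u) graded_quiver_rep, 'a \<Rightarrow> 'u \<Rightarrow> 'u) category"
  let ?F = "graded_corner_functor \<Gamma> P :: (('f, 'u, ('a, 'b, 'f) lpa_elem) graded_rmod, 'u \<Rightarrow> 'u, _, _) funct"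
  fix M assume "M \<in> Obj ?C"
  then have M: "graded_unital_right_module (leavitt_path_algebra \<Gamma> P) (lpa_grade \<Gamma> P) M"
    by (simp add: graded_unital_modules_def)
  interpret M: graded_unital_right_module "leavitt_path_algebra \<Gamma> P" "lpa_grade \<Gamma> P" M by fact
  interpret G: generator_module \<Gamma> P M "gen_act \<Gamma> P M"
    by (rule generator_module_gen_act[OF M.right_module_axioms])
  show "on_obj ?F M \<in> Obj ?D"
    using is_graded_quiver_rep_corner[OF M] G.condition_I_corner[of "graded_corner_rep \<Gamma> P M"]
    by (simp add: graded_corner_functor_def full_subcategory_def graded_quiver_reps_def graded_corner_rep_def)
  show "on_hom ?F M M (Id ?C M) = Id ?D (on_obj ?F M)"
    using corner_hom_id[of \<Gamma> M "gen_act \<Gamma> P M"]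
    by (simp add: graded_corner_functor_def full_subcategory_def graded_quiver_reps_def
        graded_unital_modules_def graded_corner_rep_def)
  fix M' f assume "M' \<in> Obj ?C" and f: "f \<in> Hom ?C M M'"
  then have M': "graded_unital_right_module (leavitt_path_algebra \<Gamma> P) (lpa_grade \<Gamma> P) M'"
    by (simp add: graded_unital_modules_def)
  have f': "f \<in> rmod_homs (leavitt_path_algebra \<Gamma> P) M M'" using f by (simp add: graded_unital_modules_def)
  show "on_hom ?F M M' f \<in> Hom ?D (on_obj ?F M) (on_obj ?F M')"
    using bij_betwE[OF bij_betw_graded_corner_hom[OF M M']] f
    by (simp add: graded_corner_functor_def full_subcategory_def)
  fix M'' g
  show "on_hom ?F M M'' (Comp ?C M M' M'' f g) =
      Comp ?D (on_obj ?F M) (on_obj ?F M') (on_obj ?F M'') (on_hom ?F M M' f) (on_hom ?F M' M'' g)"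
    using corner_hom_comp[of \<Gamma> M "gen_act \<Gamma> P M" f M' "gen_act \<Gamma> P M'" g, OF rmod_homs_corner[OF f']]
    by (simp add: graded_corner_functor_def full_subcategory_def graded_quiver_reps_def
        graded_unital_modules_def graded_corner_rep_def del: corner_simps)
qed

theorem equivalent_graded_modules_reps:
  assumes "infinite (UNIV :: 'u set)" "verts \<Gamma> \<lesssim> (UNIV :: 'u set)"
  shows "equivalent_categories
    (graded_unital_modules (leavitt_path_algebra \<Gamma> P) (lpa_grade \<Gamma> P)
      :: (('f::field, 'u, ('a, 'b, 'f) lpa_elem) graded_rmod, 'u \<Rightarrow> 'u) category)
    (full_subcategory (graded_quiver_reps \<Gamma> :: (('a, 'b, 'f, 'u) graded_quiver_rep, 'a \<Rightarrow> 'u \<Rightarrow> 'u) category)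
      (condition_I \<Gamma> P))"
proof (rule equivalent_categories_if_fully_faithful[OF category_graded_unital_modules
      category_full_subcategory[OF category_graded_quiver_reps] is_functor_graded_corner_functor])
  let ?C = "graded_unital_modules (leavitt_path_algebra \<Gamma> P) (lpa_grade \<Gamma> P)
      :: (('f::field, 'u, ('a, 'b, 'f) lpa_elem) graded_rmod, 'u \<Rightarrow> 'u) category"
  let ?D = "full_subcategory (graded_quiver_reps \<Gamma>) (condition_I \<Gamma> P)
      :: (('a, 'b, 'f, 'u) graded_quiver_rep, 'a \<Rightarrow> 'u \<Rightarrow> 'u) category"
  let ?F = "graded_corner_functor \<Gamma> P :: (('f, 'u, ('a, 'b, 'f) lpa_elem) graded_rmod, 'u \<Rightarrow> 'u, _, _) funct"
  {
    fix M M' assume "M \<in> Obj ?C" "M' \<in> Obj ?C"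
    then show "bij_betw (on_hom ?F M M') (Hom ?C M M') (Hom ?D (on_obj ?F M) (on_obj ?F M'))"
      using bij_betw_graded_corner_hom[of M M']
      by (simp add: graded_unital_modules_def graded_corner_functor_def full_subcategory_def)
  }
  fix \<rho> assume "\<rho> \<in> Obj ?D"
  then have \<rho>: "is_graded_quiver_rep \<Gamma> \<rho>" "is_quiver_rep \<Gamma> \<rho>" "condition_I \<Gamma> P \<rho>"
    by (simp_all add: full_subcategory_def graded_quiver_reps_def is_graded_quiver_rep_def)
  obtain N :: "('f, 'u) module" and emb proj k where R: "rep_biproduct \<Gamma> P \<rho> N emb proj k"
    by (rule rep_biproduct_exists[OF assms \<rho>(2,3)])
  interpret R: graded_rep_biproduct \<Gamma> P \<rho> N emb proj k "rgrade \<rho>"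
    using R \<rho>(1) by (intro graded_rep_biproduct.intro graded_rep_biproduct_axioms.intro)
      (auto simp: is_graded_quiver_rep_def image_subset_iff)
  let ?M = "R.graded_rep_module" and ?\<sigma> = "graded_corner_rep \<Gamma> P R.graded_rep_module"
  have \<sigma>: "rspace ?\<sigma> = corner ?M (gen_act \<Gamma> P ?M)" "rmap ?\<sigma> = corner_map \<Gamma> ?M (gen_act \<Gamma> P ?M)"
    by (simp_all add: graded_corner_rep_def)
  have rgrade_\<sigma>: "rgrade ?\<sigma> v n = R.sum_grade n \<inter> carrier (rspace ?\<sigma> v)" for v n
    by (simp add: graded_corner_rep_def R.grade_rep_module)
  have M: "?M \<in> Obj ?C"
    using R.graded_unital_right_module_rep_module by (simp add: graded_unital_modules_def)
  have "R.proj_hom ?\<sigma> v ` rgrade ?\<sigma> v n \<subseteq> rgrade \<rho> v n" if "v \<in> verts \<Gamma>" for v n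
    using that unfolding rgrade_\<sigma> by (auto simp: R.proj_hom_def[OF \<sigma>] R.sum_grade_def)
  then have proj: "R.proj_hom ?\<sigma> \<in> Hom ?D ?\<sigma> \<rho>"
    using R.proj_hom[OF \<sigma>] by (simp add: full_subcategory_def graded_quiver_reps_def)
  have "R.emb_hom v ` rgrade \<rho> v n \<subseteq> rgrade ?\<sigma> v n" if v: "v \<in> verts \<Gamma>" for v n
  proof (rule image_subsetI)
    fix x assume x: "x \<in> rgrade \<rho> v n"
    then have "emb v x \<in> carrier (rspace ?\<sigma> v)"
      unfolding \<sigma>(1) using R.D_submodule(1)[OF v] by (intro R.emb_corner[OF v]) blast
    then show "R.emb_hom v x \<in> rgrade ?\<sigma> v n"
      using v x R.emb_grade[OF v x] unfolding rgrade_\<sigma> by (simp add: R.emb_hom_def[OF \<sigma>])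
  qed
  then have emb: "R.emb_hom \<in> Hom ?D \<rho> ?\<sigma>"
    using R.emb_hom[OF \<sigma>] by (simp add: full_subcategory_def graded_quiver_reps_def)
  \<comment> \<open>The inverse identities are those of the ungraded comparison; the two facts above
    add that both maps preserve degrees.\<close>
  have "is_iso ?D ?\<sigma> \<rho> (R.proj_hom ?\<sigma>)"
    unfolding is_iso_def
  proof (intro conjI bexI[of _ R.emb_hom] proj emb)
    show "Comp ?D ?\<sigma> \<rho> ?\<sigma> (R.proj_hom ?\<sigma>) R.emb_hom = Id ?D ?\<sigma>"
      using R.proj_emb_hom[OF \<sigma>] by (simp add: full_subcategory_def graded_quiver_reps_def)
    show "Comp ?D \<rho> ?\<sigma> \<rho> R.emb_hom (R.proj_hom ?\<sigma>) = Id ?D \<rho>"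
      using R.emb_proj_hom[OF \<sigma>] by (simp add: full_subcategory_def graded_quiver_reps_def)
  qed
  with M show "\<exists>M\<in>Obj ?C. \<exists>f. is_iso ?D (on_obj ?F M) \<rho> f"
    by (auto simp: graded_corner_functor_def)
qed

end

theorem proposition3p2:
  fixes \<Gamma> :: "('v, 'e) pre_digraph" and P :: "'e set set"
  assumes "finitely_separated_digraph \<Gamma> P"
    and "infinite (UNIV :: 'u set)"
    and "verts \<Gamma> \<lesssim> (UNIV :: 'u set)"
  shows "equivalent_categories
           (unital_modules (leavitt_path_algebra \<Gamma> P)
             :: (('f::field, 'u, ('v, 'e, 'f) lpa_elem) rmod, 'u \<Rightarrow> 'u) category)
           (full_subcategory
             (quiver_reps \<Gamma> :: (('v, 'e, 'f, 'u) quiver_rep, 'v \<Rightarrow> 'u \<Rightarrow> 'u) category)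
             (condition_I \<Gamma> P))
       \<and> equivalent_categories
           (full_subcategory
             (graded_quiver_reps \<Gamma> :: (('v, 'e, 'f, 'u) graded_quiver_rep, 'v \<Rightarrow> 'u \<Rightarrow> 'u) category)
             (condition_I \<Gamma> P))
           (graded_unital_modules (leavitt_path_algebra \<Gamma> P) (lpa_grade \<Gamma> P)
             :: (('f, 'u, ('v, 'e, 'f) lpa_elem) graded_rmod, 'u \<Rightarrow> 'u) category)"
  \<comment> \<open>The functor runs from modules to representations in both cases; symmetry turns
    the graded equivalence into the stated direction.\<close>
  using finitely_separated_digraph.equivalent_modules_reps[OF assms]
    equivalent_categories_sym[OF finitely_separated_digraph.equivalent_graded_modules_reps[OF assms]]
  by (rule conjI)

end
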